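(* In the hybrid human/AI control model described in the context, let $V$ be the optimal value function, let $\Delta_q V(q,\theta)=V(q+1,\theta)-V(q,\theta)$, and let $a^*$ be the optimal policy, i.e. the decision rule (with ties broken in favour of escalation) $$a^*(q,\theta,s)=\begin{cases}1 & \text{if } c_h+V(q+1,\theta)\le c_{\mathrm{auto}}(s,\theta)+V(q,\theta),\\ 0 & \text{otherwise.}\end{cases}$$ Then for every state $(q,\theta)\in\mathbb{N}_0\times\Theta$ there exists a unique threshold $T^*(q,\theta)\in[0,1]\cup\{\infty\}$ such that $$a^*(q,\theta,s)=\mathbf{1}\{s\ge T^*(q,\theta)\}\qquad\text{for all } s\in[0,1],$$ and the stationary Markovian policy $a^*$ is optimal: $J_{a^*}(q,\theta)=V(q,\theta)$ for all $(q,\theta)\in\mathbb{N}_0\times\Theta$. Specifically, $$T^*(q,\theta)=\inf\{s\in[0,1]: c_{\mathrm{auto}}(s,\theta)\ge c_h+\Delta_q V(q,\theta)\},$$ with $T^*(q,\theta)=\infty$ if this set is empty.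
   Context: Model. Tasks arrive according to a Poisson process of rate $\lambda>0$, with arrival times $\tau_1<\tau_2<\dots$. The $n$-th task has a risk score $s_n\in[0,1]$, observed on arrival; the scores are i.i.d. with a distribution function $F_S$ on $[0,1]$ having a continuous density $f_S$ that is strictly positive on $(0,1)$. An exogenous reliability process $\theta(t)$ is an irreducible, ergodic continuous-time Markov chain on $\Theta=\{1,\dots,K\}$ with generator $Q=[q_{ij}]$ (so $q_{ii}=-\sum_{j\ne i}q_{ij}$). Arrivals, scores, service times and $\theta(t)$ are independent. Actions. At the arrival of the $n$-th task the controller observes the queue length $q(\tau_n^-)\in\mathbb{N}_0$, the regime $\theta(\tau_n^-)$ and $s_n$, and chooses $a_n\in\{0,1\}$. If $a_n=0$ (automate), the cost $c_{\mathrm{auto}}(s_n,\theta(\tau_n^-))$ is incurred and the queue is unchanged. If $a_n=1$ (escalate), the fixed cost $c_h>0$ is incurred and the queue length increases by $1$. Escalated tasks are served in a queue with infinite buffer and $m\geq 1$ parallel servers with independent exponential service times of rate $\mu>0$ each, so the total service rate with $n$ tasks in system is $\min(n,m)\mu$; $q(t)$ is the number of tasks in system. Cost assumptions. $h:\mathbb{N}_0\to\mathbb{R}_+$ is non-decreasing and convex with $h(0)=0$. $c_{\mathrm{auto}}:[0,1]\times\Theta\to\mathbb{R}_+$ satisfies: (i) for each fixed $\theta$, $c_{\mathrm{auto}}(\cdot,\theta)$ is strictly increasing, continuous and convex; (ii) for each fixed $s$, $c_{\mathrm{auto}}(s,\theta)$ is non-decreasing in $\theta$; (iii) for $s'>s$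 and $\theta'>\theta$, $c_{\mathrm{auto}}(s',\theta')-c_{\mathrm{auto}}(s,\theta')\ge c_{\mathrm{auto}}(s',\theta)-c_{\mathrm{auto}}(s,\theta)$. Objective. A stationary Markovian policy is a (measurable) function $u:\mathbb{N}_0\times\Theta\times[0,1]\to\{0,1\}$, with $a_n=u(q(\tau_n^-),\theta(\tau_n^-),s_n)$. For a discount rate $\alpha>0$, $$J_u(q_0,\theta_0)=\mathbb{E}\Big[\int_0^\infty e^{-\alpha t}h(q(t))\,dt+\sum_{n\ge1}e^{-\alpha\tau_n}\big((1-a_n)c_{\mathrm{auto}}(s_n,\theta(\tau_n^-))+a_n c_h\big)\,\Big|\,q(0)=q_0,\theta(0)=\theta_0\Big],$$ and the optimal value function is $V(q,\theta)=\inf_u J_u(q,\theta)$, the infimum being over stationary Markovian policies. *)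

theory Defs
  imports "HOL-Probability.Probability"
begin

text \<open>
  The primitive random data are the arrival times, the scores, the service times and the regime
  process. The queue is a pathwise function of these data, of the policy and of the initial queue
  length. \<open>law M i\<close> is the probability measure under which the regime starts in \<open>i\<close>, so the
  conditional expectation given $q(0) = q_0$ and $\theta(0) = i$ is the integral under \<open>law M i\<close>
  of the cost of the path started with $q_0$ tasks.
\<close>

record 'w hybrid_model =
  arr_rate :: real
  srv_rate :: real
  servers :: nat
  num_regimes :: nat
  gen :: "nat \<Rightarrow> nat \<Rightarrow> real"
  score_density :: "real \<Rightarrow> real"
  hold_cost :: "nat \<Rightarrow> real"
  auto_cost :: "real \<Rightarrow> nat \<Rightarrow> real"
  esc_cost :: real
  disc_rate :: real
  law :: "nat \<Rightarrow> 'w measure"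
  arr_time :: "nat \<Rightarrow> 'w \<Rightarrow> real"
  score :: "nat \<Rightarrow> 'w \<Rightarrow> real"
  srv_time :: "nat \<Rightarrow> 'w \<Rightarrow> real"
  regime :: "real \<Rightarrow> 'w \<Rightarrow> nat"

definition regimes :: "'w hybrid_model \<Rightarrow> nat set" where
  "regimes M = {1..num_regimes M}"


subsection \<open>Continuous-time Markov chains on a finite set of states\<close>

definition is_generator :: "nat set \<Rightarrow> (nat \<Rightarrow> nat \<Rightarrow> real) \<Rightarrow> bool" where
  "is_generator E Q \<longleftrightarrow>
     (\<forall>i\<in>E. \<forall>j\<in>E. i \<noteq> j \<longrightarrow> 0 \<le> Q i j) \<and> (\<forall>i\<in>E. Q i i = - (\<Sum>j\<in>E - {i}. Q i j))"

definition irreducible_generator :: "nat set \<Rightarrow> (nat \<Rightarrow> nat \<Rightarrow> real) \<Rightarrow> bool" where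
  "irreducible_generator E Q \<longleftrightarrow>
     (\<forall>i\<in>E. \<forall>j\<in>E. (i, j) \<in> {(k, l). k \<in> E \<and> l \<in> E \<and> k \<noteq> l \<and> 0 < Q k l}\<^sup>*)"

primrec mat_power :: "nat set \<Rightarrow> (nat \<Rightarrow> nat \<Rightarrow> real) \<Rightarrow> nat \<Rightarrow> nat \<Rightarrow> nat \<Rightarrow> real" where
  "mat_power E Q 0 i j = (if i = j then 1 else 0)"
| "mat_power E Q (Suc n) i j = (\<Sum>k\<in>E. Q i k * mat_power E Q n k j)"

text \<open>The entries of the matrix exponential $e^{tQ}$.\<close>

definition transition :: "nat set \<Rightarrow> (nat \<Rightarrow> nat \<Rightarrow> real) \<Rightarrow> real \<Rightarrow> nat \<Rightarrow> nat \<Rightarrow> real" where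
  "transition E Q t i j = (\<Sum>n. t ^ n / fact n * mat_power E Q n i j)"

definition ergodic_generator :: "nat set \<Rightarrow> (nat \<Rightarrow> nat \<Rightarrow> real) \<Rightarrow> bool" where
  "ergodic_generator E Q \<longleftrightarrow>
     (\<exists>p. (\<forall>j\<in>E. 0 < p j) \<and> (\<Sum>j\<in>E. p j) = 1 \<and>
          (\<forall>i\<in>E. \<forall>j\<in>E. ((\<lambda>t. transition E Q t i j) \<longlongrightarrow> p j) at_top))"

text \<open>
  A process with right-continuous paths that have left limits (in the discrete topology of \<open>nat\<close>),
  started in \<open>i0\<close>, whose finite-dimensional distributions are those of the Markov chain with
  generator \<open>Q\<close>.
\<close>

definition markov_chain ::
  "'w measure \<Rightarrow> nat set \<Rightarrow> (nat \<Rightarrow> nat \<Rightarrow> real) \<Rightarrow> nat \<Rightarrow> (real \<Rightarrow> 'w \<Rightarrow> nat) \<Rightarrow> bool" where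
  "markov_chain P E Q i0 X \<longleftrightarrow>
     (\<forall>t\<ge>0. X t \<in> measurable P (count_space E)) \<and>
     (\<forall>w\<in>space P. \<forall>t\<ge>0. ((\<lambda>r. X r w) \<longlongrightarrow> X t w) (at_right t)) \<and>
     (\<forall>w\<in>space P. \<forall>t>0. \<exists>l. ((\<lambda>r. X r w) \<longlongrightarrow> l) (at_left t)) \<and>
     (\<forall>(n::nat) (t::nat \<Rightarrow> real) (j::nat \<Rightarrow> nat).
        t 0 = 0 \<longrightarrow> (\<forall>k<n. t k \<le> t (Suc k)) \<longrightarrow> (\<forall>k\<le>n. j k \<in> E) \<longrightarrow>
        measure P {w \<in> space P. \<forall>k\<le>n. X (t k) w = j k} =
          (if j 0 = i0 then 1 else 0) *
          (\<Prod>k<n. transition E Q (t (Suc k) - t k) (j k) (j (Suc k))))"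


subsection \<open>Arrivals, independence\<close>

primrec gap :: "(nat \<Rightarrow> 'w \<Rightarrow> real) \<Rightarrow> nat \<Rightarrow> 'w \<Rightarrow> real" where
  "gap T 0 w = T 0 w"
| "gap T (Suc n) w = T (Suc n) w - T n w"

definition iid :: "'w measure \<Rightarrow> (nat \<Rightarrow> 'w \<Rightarrow> real) \<Rightarrow> (real \<Rightarrow> real) \<Rightarrow> bool" where
  "iid P X f \<longleftrightarrow>
     prob_space.indep_vars P (\<lambda>_. borel) X UNIV \<and> (\<forall>n. distributed P lborel (X n) f)"

definition poisson_arrivals :: "'w measure \<Rightarrow> real \<Rightarrow> (nat \<Rightarrow> 'w \<Rightarrow> real) \<Rightarrow> bool" where
  "poisson_arrivals P l T \<longleftrightarrow> iid P (gap T) (exponential_density l)"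

definition generated_events ::
  "'w measure \<Rightarrow> 'b measure \<Rightarrow> ('i \<Rightarrow> 'w \<Rightarrow> 'b) \<Rightarrow> 'i set \<Rightarrow> 'w set set" where
  "generated_events P N X I =
     sigma_sets (space P) (\<Union>i\<in>I. {X i -` A \<inter> space P | A. A \<in> sets N})"

datatype source = Arrivals | Scores | Services | Regime

definition source_events :: "'w hybrid_model \<Rightarrow> nat \<Rightarrow> source \<Rightarrow> 'w set set" where
  "source_events M i c = (case c of
      Arrivals \<Rightarrow> generated_events (law M i) borel (arr_time M) UNIV
    | Scores \<Rightarrow> generated_events (law M i) borel (score M) UNIV
    | Services \<Rightarrow> generated_events (law M i) borel (srv_time M) UNIV
    | Regime \<Rightarrow> generated_events (law M i) (count_space UNIV) (regime M) {0..})"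

locale hybrid_control =
  fixes M :: "'w hybrid_model"
  assumes arr_rate_pos: "0 < arr_rate M"
    and srv_rate_pos: "0 < srv_rate M"
    and servers_pos: "1 \<le> servers M"
    and num_regimes_pos: "1 \<le> num_regimes M"
    and esc_cost_pos: "0 < esc_cost M"
    and disc_rate_pos: "0 < disc_rate M"
    and hold_cost_nonneg: "\<And>n. 0 \<le> hold_cost M n"
    and hold_cost_mono: "mono (hold_cost M)"
    and hold_cost_convex: "\<And>n. hold_cost M (n + 1) - hold_cost M n
                              \<le> hold_cost M (n + 2) - hold_cost M (n + 1)"
    and hold_cost_zero: "hold_cost M 0 = 0"
    and auto_cost_nonneg:
      "\<And>s i. s \<in> {0..1} \<Longrightarrow> i \<in> regimes M \<Longrightarrow> 0 \<le> auto_cost M s i"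
    and auto_cost_strict_mono:
      "\<And>i. i \<in> regimes M \<Longrightarrow> strict_mono_on {0..1} (\<lambda>s. auto_cost M s i)"
    and auto_cost_continuous:
      "\<And>i. i \<in> regimes M \<Longrightarrow> continuous_on {0..1} (\<lambda>s. auto_cost M s i)"
    and auto_cost_convex:
      "\<And>i. i \<in> regimes M \<Longrightarrow> convex_on {0..1} (\<lambda>s. auto_cost M s i)"
    and auto_cost_mono_regime:
      "\<And>s. s \<in> {0..1} \<Longrightarrow> mono_on (regimes M) (auto_cost M s)"
    and auto_cost_increasing_differences:
      "\<And>s s' i i'. s \<in> {0..1} \<Longrightarrow> s' \<in> {0..1} \<Longrightarrow> s < s' \<Longrightarrow>
         i \<in> regimes M \<Longrightarrow> i' \<in> regimes M \<Longrightarrow> i < i' \<Longrightarrow>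
         auto_cost M s' i - auto_cost M s i \<le> auto_cost M s' i' - auto_cost M s i'"
    and generator: "is_generator (regimes M) (gen M)"
    and irreducible: "irreducible_generator (regimes M) (gen M)"
    and ergodic: "ergodic_generator (regimes M) (gen M)"
    and score_density_continuous: "continuous_on {0..1} (score_density M)"
    and score_density_pos: "\<And>s. s \<in> {0<..<1} \<Longrightarrow> 0 < score_density M s"
    and prob_space_law: "\<And>i. i \<in> regimes M \<Longrightarrow> prob_space (law M i)"
    and arrivals: "\<And>i. i \<in> regimes M \<Longrightarrow> poisson_arrivals (law M i) (arr_rate M) (arr_time M)"
    and score_range:
      "\<And>i n w. i \<in> regimes M \<Longrightarrow> w \<in> space (law M i) \<Longrightarrow> score M n w \<in> {0..1}"
    and scores: "\<And>i. i \<in> regimes M \<Longrightarrow>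
      iid (law M i) (score M) (\<lambda>s. score_density M s * indicator {0..1} s)"
    and services: "\<And>i. i \<in> regimes M \<Longrightarrow>
      iid (law M i) (srv_time M) (exponential_density (srv_rate M))"
    and regime_chain: "\<And>i. i \<in> regimes M \<Longrightarrow>
      markov_chain (law M i) (regimes M) (gen M) i (regime M)"
    and independence: "\<And>i. i \<in> regimes M \<Longrightarrow>
      prob_space.indep_sets (law M i) (source_events M i) UNIV"


subsection \<open>Policies, queue and cost\<close>

type_synonym policy = "nat \<Rightarrow> nat \<Rightarrow> real \<Rightarrow> nat"

definition policies :: "'w hybrid_model \<Rightarrow> policy set" where
  "policies M = {u. \<forall>q. \<forall>i\<in>regimes M.
     u q i \<in> measurable (restrict_space borel {0..1}) (count_space {0, 1})}"

text \<open>
  The queue is represented by the list of the departure times of all tasks escalated so far, in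
  order of arrival. Service is first come first served: a task arriving at time \<open>a\<close> with service
  time \<open>b\<close> starts service at the first time from \<open>a\<close> on at which fewer than \<open>m\<close> of the earlier
  tasks are still in the system.
\<close>

definition admit :: "nat \<Rightarrow> real list \<Rightarrow> real \<Rightarrow> real \<Rightarrow> real list" where
  "admit m ds a b = ds @ [Inf {t. a \<le> t \<and> length (filter (\<lambda>d. t < d) ds) < m} + b]"

text \<open>
  The numbers of tasks in system at time \<open>t\<close> and, as a left limit, just before time \<open>t\<close>, when
  \<open>ds\<close> lists the departure times of the tasks that arrived at or before (respectively before) \<open>t\<close>.
\<close>

definition in_system :: "real list \<Rightarrow> real \<Rightarrow> nat" where
  "in_system ds t = length (filter (\<lambda>d. t < d) ds)"

definition in_system_left :: "real list \<Rightarrow> real \<Rightarrow> nat" where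
  "in_system_left ds t = length (filter (\<lambda>d. t \<le> d) ds)"

definition regime_left :: "'w hybrid_model \<Rightarrow> real \<Rightarrow> 'w \<Rightarrow> nat" where
  "regime_left M t w = Lim (at_left t) (\<lambda>r. regime M r w)"

primrec initial_departures :: "'w hybrid_model \<Rightarrow> 'w \<Rightarrow> nat \<Rightarrow> real list" where
  "initial_departures M w 0 = []"
| "initial_departures M w (Suc k) =
     admit (servers M) (initial_departures M w k) 0 (srv_time M k w)"

text \<open>
  \<open>departures M u q0 w n\<close> lists the departure times of the \<open>q0\<close> initial tasks and of those among
  the first \<open>n\<close> arriving tasks that were escalated. Arriving tasks are numbered from 0, and task
  \<open>n\<close> has the service time with index \<open>q0 + n\<close>, the first \<open>q0\<close> service times belonging to the
  initial tasks.
\<close>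

primrec departures :: "'w hybrid_model \<Rightarrow> policy \<Rightarrow> nat \<Rightarrow> 'w \<Rightarrow> nat \<Rightarrow> real list" where
  "departures M u q0 w 0 = initial_departures M w q0"
| "departures M u q0 w (Suc n) =
     (let ds = departures M u q0 w n; t = arr_time M n w in
      if u (in_system_left ds t) (regime_left M t w) (score M n w) = 1
      then admit (servers M) ds t (srv_time M (q0 + n) w) else ds)"

definition action :: "'w hybrid_model \<Rightarrow> policy \<Rightarrow> nat \<Rightarrow> 'w \<Rightarrow> nat \<Rightarrow> nat" where
  "action M u q0 w n =
     u (in_system_left (departures M u q0 w n) (arr_time M n w))
       (regime_left M (arr_time M n w) w) (score M n w)"

definition queue :: "'w hybrid_model \<Rightarrow> policy \<Rightarrow> nat \<Rightarrow> 'w \<Rightarrow> real \<Rightarrow> nat" where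
  "queue M u q0 w t = in_system (departures M u q0 w (card {n. arr_time M n w \<le> t})) t"

definition J :: "'w hybrid_model \<Rightarrow> policy \<Rightarrow> nat \<Rightarrow> nat \<Rightarrow> ennreal" where
  "J M u q0 i =
     (\<integral>\<^sup>+ w. (\<integral>\<^sup>+ t\<in>{0..}. ennreal (exp (- disc_rate M * t) * hold_cost M (queue M u q0 w t)) \<partial>lborel)
        + (\<Sum>n. ennreal (exp (- disc_rate M * arr_time M n w) *
             ((1 - real (action M u q0 w n)) *
                auto_cost M (score M n w) (regime_left M (arr_time M n w) w)
              + real (action M u q0 w n) * esc_cost M)))
      \<partial>law M i)"

definition V :: "'w hybrid_model \<Rightarrow> nat \<Rightarrow> nat \<Rightarrow> ennreal" where
  "V M q i = (INF u\<in>policies M. J M u q i)"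

text \<open>
  \<open>J\<close> may be infinite for some policies, but \<open>V\<close> is finite: never escalating costs at most
  $h(q)/\alpha + (\lambda/\alpha) \max c_{auto}$. So nothing is lost in passing to real numbers here.
\<close>

definition Delta_V :: "'w hybrid_model \<Rightarrow> nat \<Rightarrow> nat \<Rightarrow> real" where
  "Delta_V M q i = enn2real (V M (q + 1) i) - enn2real (V M q i)"

definition a_star :: "'w hybrid_model \<Rightarrow> policy" where
  "a_star M q i s =
     (if ennreal (esc_cost M) + V M (q + 1) i \<le> ennreal (auto_cost M s i) + V M q i then 1 else 0)"

definition is_threshold :: "'w hybrid_model \<Rightarrow> nat \<Rightarrow> nat \<Rightarrow> ereal \<Rightarrow> bool" where
  "is_threshold M q i T \<longleftrightarrow>
     T \<in> ereal ` {0..1} \<union> {\<infinity>} \<and>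
     (\<forall>s\<in>{0..1}. a_star M q i s = (if T \<le> ereal s then 1 else 0))"

definition T_star :: "'w hybrid_model \<Rightarrow> nat \<Rightarrow> nat \<Rightarrow> ereal" where
  "T_star M q i =
     (let A = {s \<in> {0..1}. esc_cost M + Delta_V M q i \<le> auto_cost M s i}
      in if A = {} then \<infinity> else ereal (Inf A))"

end

theory Submission
  imports Defs
begin

text \<open>
  Between two arrivals the number of tasks in system is a Markov chain, because exponential service
  times are memoryless: if \<open>k\<close> tasks are left at time \<open>t\<close>, their residual departure times have the
  same law as the departure times of \<open>k\<close> tasks that all start afresh. Together with the independence
  of the gaps and scores and the finite-dimensional distributions of the regime, this makes queue
  length and regime after each decision a Markov chain, so the cost of a policy \<open>u\<close> up to the
  \<open>n\<close>-th arrival is the \<open>n\<close>-th iterate, started from 0, of a monotone operator \<open>policy_op u\<close>, and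
  \<open>J u = lfp (policy_op u)\<close> since that operator is sup-continuous. The Bellman operator \<open>bellman\<close> is
  the pointwise minimum of the operators \<open>policy_op u\<close>. Hence \<open>lfp bellman \<le> J u\<close> for every \<open>u\<close>, while
  the policy that is greedy for \<open>W = lfp bellman\<close> satisfies \<open>policy_op u W = W\<close> and therefore
  \<open>J u \<le> W\<close>. So \<open>V = W\<close>, the greedy policy is \<open>a_star\<close>, and it is a threshold rule because the
  automation cost is continuous and increasing in the score.
\<close>

subsection \<open>Lists of departure times\<close>

text \<open>Costs stay in \<open>ennreal\<close> because \<open>hold_cost\<close> may grow at any
  rate: policies may have infinite cost and value functions need not be bounded, which rules out a
  contraction argument in the supremum norm. Least fixed points need neither finiteness nor
  uniqueness; finiteness of \<open>V\<close> enters only when the decision rule is rewritten with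
  \<open>Delta_V\<close>. Two obstacles shape the rest. The controller reads the left limit of the
  regime at random arrival times, while the chain is specified by its distributions at deterministic
  times. So these distributions are first transferred to left limits at deterministic times, and
  independence then allows the arrival times to be frozen while the regime alone is integrated.
  Secondly, the queue is given by a list of departure times fixed on admission, so its future
  depends on the residual times and not on its length alone. The state therefore carries that list,
  and forgetting it is an identity of expectations, not of paths.\<close>

definition nth0 :: "real list \<Rightarrow> nat \<Rightarrow> real" where
  "nth0 xs i = (if i < length xs then xs ! i else 0)"

text \<open>Pulling back along the length and the zero-padded coordinates reduces measurability of a
  list-valued map to that of one discrete map and countably many real ones.\<close>

definition list_space :: "real list measure" where
  "list_space = vimage_algebra UNIV (\<lambda>xs. (length xs, nth0 xs))
     (count_space UNIV \<Otimes>\<^sub>M Pi\<^sub>M UNIV (\<lambda>_. borel))"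

lemma space_list_space [simp]: "space list_space = UNIV"
  by (simp add: list_space_def)

lemma measurable_to_list_space:
  assumes "(\<lambda>x. length (f x)) \<in> measurable N (count_space UNIV)"
    and "\<And>i. (\<lambda>x. nth0 (f x) i) \<in> borel_measurable N"
  shows "f \<in> measurable N list_space"
  unfolding list_space_def
proof (rule measurable_vimage_algebra2)
  show "(\<lambda>x. (length (f x), nth0 (f x)))
      \<in> measurable N (count_space UNIV \<Otimes>\<^sub>M Pi\<^sub>M UNIV (\<lambda>_. borel))"
    by (intro measurable_Pair measurable_PiM_single' assms) auto
qed auto

lemma measurable_list_space_pair:
  "(\<lambda>xs. (length xs, nth0 xs)) \<in> measurable list_space
     (count_space UNIV \<Otimes>\<^sub>M Pi\<^sub>M UNIV (\<lambda>_. borel))"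
  unfolding list_space_def by (rule measurable_vimage_algebra1) (auto simp: space_pair_measure space_PiM)

lemma measurable_length_list_space [measurable]:
  "length \<in> measurable list_space (count_space UNIV)"
  using measurable_compose[OF measurable_list_space_pair measurable_fst] by simp

lemma measurable_nth0 [measurable]: "(\<lambda>xs. nth0 xs i) \<in> borel_measurable list_space"
  using measurable_compose[OF measurable_list_space_pair
      measurable_compose[OF measurable_snd measurable_component_singleton[of i UNIV "\<lambda>_. borel"]]]
  by simp

lemma measurable_list_space_const [measurable]: "(\<lambda>_. xs) \<in> measurable N list_space"
  by (rule measurable_const) simp

lemma measurable_list_snoc [measurable (raw)]:
  assumes [measurable]: "f \<in> measurable N list_space" "b \<in> borel_measurable N"
  shows "(\<lambda>x. f x @ [b x]) \<in> measurable N list_space"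
proof (rule measurable_to_list_space)
  fix i
  have "(\<lambda>x. nth0 (f x @ [b x]) i) =
      (\<lambda>x. if length (f x) = i then b x else nth0 (f x) i)"
    by (auto simp: nth0_def nth_append fun_eq_iff)
  then show "(\<lambda>x. nth0 (f x @ [b x]) i) \<in> borel_measurable N"
    by simp
qed simp

lemma measurable_list_map [measurable (raw)]:
  assumes f [measurable]: "f \<in> measurable N list_space"
    and g [measurable]: "(\<lambda>(x, d). g x d) \<in> borel_measurable (N \<Otimes>\<^sub>M borel)"
  shows "(\<lambda>x. map (g x) (f x)) \<in> measurable N list_space"
proof (rule measurable_to_list_space)
  fix i
  have "(\<lambda>x. nth0 (map (g x) (f x)) i) =
      (\<lambda>x. if i < length (f x) then (\<lambda>(x, d). g x d) (x, nth0 (f x) i) else 0)"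
    by (auto simp: nth0_def fun_eq_iff)
  then show "(\<lambda>x. nth0 (map (g x) (f x)) i) \<in> borel_measurable N"
    by simp
qed simp

text \<open>The position of a surviving entry depends on the entries before it, so coordinates
  cannot be checked one by one. The filtered list is instead built over prefixes of fixed length,
  each step appending at most one entry; the true length is then one of countably many
  values.\<close>

lemma measurable_list_filter [measurable (raw)]:
  assumes f [measurable]: "f \<in> measurable N list_space"
    and P [measurable]: "Measurable.pred (N \<Otimes>\<^sub>M borel) (\<lambda>(x, d). P x d)"
  shows "(\<lambda>x. filter (P x) (f x)) \<in> measurable N list_space"
proof -
  have step: "filter (P x) (take (Suc n) xs) =
      (if n < length xs \<and> (\<lambda>(x, d). P x d) (x, nth0 xs n)
       then filter (P x) (take n xs) @ [nth0 xs n] else filter (P x) (take n xs))" for x n xs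
    by (cases "n < length xs") (auto simp: take_Suc_conv_app_nth nth0_def)
  have *: "(\<lambda>x. filter (P x) (take n (f x))) \<in> measurable N list_space" for n
  proof (induction n)
    case (Suc n)
    note [measurable] = Suc
    show ?case
      unfolding step by measurable
  qed simp
  have "(\<lambda>x. filter (P x) (take (length (f x)) (f x))) \<in> measurable N list_space"
    by (rule measurable_compose_countable[where f="\<lambda>n x. filter (P x) (take n (f x))", OF *]) simp
  then show ?thesis
    by simp
qed

section \<open>Entry times and residual times in the first-come-first-served queue\<close>

definition entry :: "nat \<Rightarrow> real list \<Rightarrow> real \<Rightarrow> real" where
  "entry m ds a = Inf {t. a \<le> t \<and> length (filter (\<lambda>d. t < d) ds) < m}"

text \<open>The nonstrict comparison keeps a task that departs exactly at t, so the length is the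
  queue length just before t, as in \<open>in_system_left\<close>.\<close>

definition residual :: "real \<Rightarrow> real list \<Rightarrow> real list" where
  "residual t ds = map (\<lambda>d. d - t) (filter (\<lambda>d. t \<le> d) ds)"

lemma admit_entry: "admit m ds a b = ds @ [entry m ds a + b]"
  by (simp add: admit_def entry_def)

lemma length_filter_mono:
  assumes "\<And>x. x \<in> set xs \<Longrightarrow> P x \<Longrightarrow> Q x"
  shows "length (filter P xs) \<le> length (filter Q xs)"
  using assms by (induction xs) auto

text \<open>This is right continuity of the number of tasks in system: no departure falls strictly
  between s and e.\<close>

lemma exists_next_value:
  fixes s :: real
  shows "\<exists>e>s. \<forall>d\<in>set ds. s < d \<longrightarrow> e \<le> d"
proof (induction ds)
  case Nil
  show ?case by (auto intro: exI[of _ "s + 1"])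
next
  case (Cons x ds)
  then obtain e where e: "e > s" "\<forall>d\<in>set ds. s < d \<longrightarrow> e \<le> d" by blast
  show ?case
  proof (cases "s < x")
    case True
    with e show ?thesis by (intro exI[of _ "min e x"]) auto
  next
    case False
    with e show ?thesis by (intro exI[of _ e]) auto
  qed
qed

text \<open>The set under the infimum is closed upwards and, the count being right-continuous,
  contains its infimum. Later facts about \<open>entry\<close> rest on this equivalence and not on
  the infimum itself.\<close>

lemma entry_le_iff:
  assumes m: "1 \<le> m"
  shows "entry m ds a \<le> c \<longleftrightarrow> a \<le> c \<and> length (filter (\<lambda>d. c < d) ds) < m"
proof -
  let ?A = "{t. a \<le> t \<and> length (filter (\<lambda>d. t < d) ds) < m}"
  \<comment> \<open>From the last departure on the system is empty, so this time witnesses that the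
    set is nonempty.\<close>
  define M where "M = fold max ds a"
  have M: "a \<le> M" "\<forall>d\<in>set ds. d \<le> M"
    unfolding M_def by (induction ds arbitrary: a) (auto, (meson max.bounded_iff order_trans)+)
  then have "M \<in> ?A"
    using m by (auto simp: filter_False not_less)
  then have ne: "?A \<noteq> {}" by blast
  have bdd: "bdd_below ?A" by (rule bdd_belowI[of _ a]) auto
  let ?S = "entry m ds a"
  have aS: "a \<le> ?S"
    unfolding entry_def by (rule cInf_greatest[OF ne]) auto
  \<comment> \<open>The count is constant from the infimum up to the next departure e. If it were
    still m or more there, e would be a larger lower bound.\<close>
  obtain e where e: "e > ?S" "\<forall>d\<in>set ds. ?S < d \<longrightarrow> e \<le> d"
    using exists_next_value by blast
  have S: "length (filter (\<lambda>d. ?S < d) ds) < m"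
  proof (rule ccontr)
    assume *: "\<not> length (filter (\<lambda>d. ?S < d) ds) < m"
    have "e \<le> t" if t: "t \<in> ?A" for t
    proof (rule ccontr)
      assume "\<not> e \<le> t"
      have "?S \<le> t"
        unfolding entry_def by (rule cInf_lower[OF t bdd])
      have "length (filter (\<lambda>d. ?S < d) ds) \<le> length (filter (\<lambda>d. t < d) ds)"
        using e \<open>\<not> e \<le> t\<close> by (intro length_filter_mono) auto
      with * t show False by auto
    qed
    then have "e \<le> ?S"
      unfolding entry_def by (intro cInf_greatest[OF ne]) auto
    with e show False by simp
  qed
  show ?thesis
  proof
    assume c: "?S \<le> c"
    have "length (filter (\<lambda>d. c < d) ds) \<le> length (filter (\<lambda>d. ?S < d) ds)"
      using c by (intro length_filter_mono) auto
    with S aS c show "a \<le> c \<and> length (filter (\<lambda>d. c < d) ds) < m" by auto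
  next
    assume "a \<le> c \<and> length (filter (\<lambda>d. c < d) ds) < m"
    then show "?S \<le> c"
      unfolding entry_def by (intro cInf_lower[OF _ bdd]) auto
  qed
qed

lemma eq_if_same_upper_bounds:
  fixes x y :: real
  assumes "\<And>c. x \<le> c \<longleftrightarrow> y \<le> c"
  shows "x = y"
  using assms by (meson order_antisym order_refl)

lemma entry_ge: "1 \<le> m \<Longrightarrow> a \<le> entry m ds a"
  using entry_le_iff[of m ds a "entry m ds a"] by simp

text \<open>Capping departures at t empties the system from t on and changes no count before t. So
  the history up to t tells whether service starts before t, and when.\<close>

lemma entry_map_min:
  assumes m: "1 \<le> m" and t: "0 \<le> t"
  shows "entry m (map (min t) ds) 0 = min t (entry m ds 0)"
proof (rule eq_if_same_upper_bounds)
  fix c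
  have "length (filter (\<lambda>d. c < d) (map (min t) ds)) =
      (if c < t then length (filter (\<lambda>d. c < d) ds) else 0)"
    by (auto simp: filter_map o_def)
  then show "entry m (map (min t) ds) 0 \<le> c \<longleftrightarrow> min t (entry m ds 0) \<le> c"
    using m t by (auto simp: entry_le_iff min_le_iff_disj)
qed

text \<open>From t on, the counts of the residual list are those of the full list with the clock
  reset at t; an entry time that already lies in the past becomes 0.\<close>

lemma entry_residual:
  assumes m: "1 \<le> m" and "a \<le> t"
  shows "entry m (residual t ds) 0 = max 0 (entry m ds a - t)"
proof (rule eq_if_same_upper_bounds)
  fix c
  have "length (filter (\<lambda>d. c < d) (residual t ds)) = length (filter (\<lambda>d. t + c < d) ds)"
    if "0 \<le> c"
  proof -
    have "filter (\<lambda>d. t \<le> d \<and> c < d - t) ds = filter (\<lambda>d. t + c < d) ds"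
      using that by (intro filter_cong) auto
    then show ?thesis
      by (simp add: residual_def filter_map o_def conj_commute)
  qed
  moreover have "entry m ds a - t \<le> c \<longleftrightarrow> entry m ds a \<le> t + c" by linarith
  ultimately show "entry m (residual t ds) 0 \<le> c \<longleftrightarrow> max 0 (entry m ds a - t) \<le> c"
    using m \<open>a \<le> t\<close> by (auto simp: entry_le_iff)
qed

lemma length_residual_less:
  assumes m: "1 \<le> m" and S: "entry m ds a < t"
  shows "length (residual t ds) < m"
proof -
  have "length (residual t ds) \<le> length (filter (\<lambda>d. entry m ds a < d) ds)"
    using S unfolding residual_def length_map by (intro length_filter_mono) auto
  also have "\<dots> < m"
    using entry_le_iff[OF m, of ds a "entry m ds a"] by simp
  finally show ?thesis .
qed

lemma entry_zero_if_short:
  assumes "1 \<le> m" "length ds < m"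
  shows "entry m ds 0 = 0"
proof (rule antisym)
  have "length (filter (\<lambda>d. 0 < d) ds) < m"
    using assms(2) by (meson le_less_trans length_filter_le)
  then show "entry m ds 0 \<le> 0"
    using assms by (simp add: entry_le_iff)
qed (rule entry_ge[OF assms(1)])

lemma measurable_entry [measurable (raw)]:
  assumes m: "1 \<le> m" and [measurable]: "f \<in> measurable N list_space"
  shows "(\<lambda>x. entry m (f x) 0) \<in> borel_measurable N"
proof -
  have "{x \<in> space N. entry m (f x) 0 \<le> c} \<in> sets N" for c
    unfolding entry_le_iff[OF m] by measurable
  then show ?thesis
    by (simp add: borel_measurable_iff_le)
qed

lemma measurable_residual [measurable (raw)]:
  assumes [measurable]: "f \<in> measurable N list_space" "t \<in> borel_measurable N"
  shows "(\<lambda>x. residual (t x) (f x)) \<in> measurable N list_space"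
  unfolding residual_def by measurable

lemma measurable_admit [measurable (raw)]:
  assumes m: "1 \<le> m"
    and [measurable]: "f \<in> measurable N list_space" "b \<in> borel_measurable N"
  shows "(\<lambda>x. admit m (f x) 0 (b x)) \<in> measurable N list_space"
  unfolding admit_entry using measurable_entry[OF m assms(2)] by measurable

subsection \<open>Memorylessness of the service system\<close>

definition exp_law :: "real \<Rightarrow> real measure" where
  "exp_law l = density lborel (\<lambda>x. ennreal (exponential_density l x))"

lemma sets_exp_law [simp, measurable_cong]: "sets (exp_law l) = sets borel"
  and space_exp_law [simp]: "space (exp_law l) = UNIV"
  by (simp_all add: exp_law_def)

lemma prob_space_exp_law: "0 < l \<Longrightarrow> prob_space (exp_law l)"
  unfolding exp_law_def by (rule prob_space_exponential_density)

lemma AE_exp_law_nonneg: "AE x in exp_law l. 0 \<le> x"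
  unfolding exp_law_def by (subst AE_density) (auto simp: exponential_density_def)

lemma AE_exp_law_pos: "AE x in exp_law l. 0 < x"
proof -
  have "AE x in lborel. x \<noteq> (0::real)" by (rule AE_lborel_singleton)
  then have "AE x in lborel. 0 < ennreal (exponential_density l x) \<longrightarrow> 0 < x"
    by eventually_elim (auto simp: exponential_density_def)
  then show ?thesis
    unfolding exp_law_def by (subst AE_density) auto
qed

text \<open>Past c the exponential density is \<open>exp (- l * c)\<close> times its own
  translate.\<close>

lemma exp_law_shift:
  assumes l: "0 < l" and c: "0 \<le> c" and f [measurable]: "f \<in> borel_measurable borel"
  shows "(\<integral>\<^sup>+b. indicator {c..} b * f (b - c) \<partial>exp_law l) = ennreal (exp (- l * c)) * (\<integral>\<^sup>+b. f b \<partial>exp_law l)"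
proof -
  have "(\<integral>\<^sup>+b. indicator {c..} b * f (b - c) \<partial>exp_law l) =
      (\<integral>\<^sup>+b. ennreal (exponential_density l b) * (indicator {c..} b * f (b - c)) \<partial>lborel)"
    unfolding exp_law_def by (subst nn_integral_density) auto
  also have "\<dots> = (\<integral>\<^sup>+b. ennreal (exponential_density l (c + 1 * b))
      * (indicator {c..} (c + 1 * b) * f ((c + 1 * b) - c)) \<partial>lborel)"
    by (subst nn_integral_real_affine[of _ 1 c]) auto
  also have "\<dots> = (\<integral>\<^sup>+b. ennreal (exp (- l * c)) * (ennreal (exponential_density l b) * f b) \<partial>lborel)"
  proof (intro nn_integral_cong)
    fix b :: real
    show "ennreal (exponential_density l (c + 1 * b)) * (indicator {c..} (c + 1 * b) * f ((c + 1 * b) - c))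
       = ennreal (exp (- l * c)) * (ennreal (exponential_density l b) * f b)"
    proof (cases "b < 0")
      case False
      have "exponential_density l (c + b) = exp (- l * c) * exponential_density l b"
        using False c by (simp add: exponential_density_def exp_add[symmetric] algebra_simps)
      then show ?thesis
        using False by (simp add: ennreal_mult' mult.assoc)
    qed (simp add: exponential_density_def)
  qed
  also have "\<dots> = ennreal (exp (- l * c)) * (\<integral>\<^sup>+b. f b \<partial>exp_law l)"
    unfolding exp_law_def by (subst nn_integral_cmult) (auto simp: nn_integral_density)
  finally show ?thesis .
qed

text \<open>Taking f constant in \<open>exp_law_shift\<close> identifies the factor as the tail
  probability. The product form expresses memorylessness without a conditional probability, so
  nothing has to be divided by.\<close>

lemma exp_law_memoryless:
  assumes l: "0 < l" and c: "0 \<le> c" and f [measurable]: "f \<in> borel_measurable borel"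
  shows "(\<integral>\<^sup>+b. indicator {c..} b * f (b - c) \<partial>exp_law l) =
    (\<integral>\<^sup>+b. indicator {c..} b \<partial>exp_law l) * (\<integral>\<^sup>+b. f b \<partial>exp_law l)"
proof -
  interpret prob_space "exp_law l" by (rule prob_space_exp_law[OF l])
  have "(\<integral>\<^sup>+b. indicator {c..} b * 1 \<partial>exp_law l) = ennreal (exp (- l * c)) * (\<integral>\<^sup>+b. 1 \<partial>exp_law l)"
    by (rule exp_law_shift[OF l c]) simp
  then have "(\<integral>\<^sup>+b. indicator {c..} b \<partial>exp_law l) = ennreal (exp (- l * c))"
    by (simp add: emeasure_space_1[simplified])
  then show ?thesis
    by (simp only: exp_law_shift[OF l c f])
qed

text \<open>The joint law of the departure times, in order of entry, of n tasks that are all present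
  and unserved at time 0; \<open>initial_departures_law\<close> identifies it with the law of
  \<open>initial_departures\<close>.\<close>

primrec departure_law :: "nat \<Rightarrow> real \<Rightarrow> nat \<Rightarrow> real list measure" where
  "departure_law m l 0 = return list_space []"
| "departure_law m l (Suc n) =
     distr (departure_law m l n \<Otimes>\<^sub>M exp_law l) list_space (\<lambda>(ds, b). admit m ds 0 b)"

lemma sets_departure_law [simp, measurable_cong]: "sets (departure_law m l n) = sets list_space"
  by (cases n) auto

lemma space_departure_law [simp]: "space (departure_law m l n) = UNIV"
  by (cases n) auto

context
  fixes m :: nat and l :: real
  assumes m: "1 \<le> m" and l: "0 < l"
begin

lemma measurable_admit_pair: "(\<lambda>(ds, b). admit m ds 0 b) \<in> measurable (list_space \<Otimes>\<^sub>M borel) list_space"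
  using measurable_admit[OF m, of fst "list_space \<Otimes>\<^sub>M borel" snd] by (simp add: split_beta')

lemma prob_space_departure_law: "prob_space (departure_law m l n)"
proof (induction n)
  case 0
  show ?case by (simp add: prob_space_return)
next
  case (Suc n)
  interpret prob_space "departure_law m l n" by fact
  interpret E: prob_space "exp_law l" by (rule prob_space_exp_law[OF l])
  interpret P: pair_prob_space "departure_law m l n" "exp_law l" ..
  show ?case
    using measurable_admit_pair by (auto intro!: P.prob_space_distr cong: measurable_cong_sets sets_pair_measure_cong)
qed

lemma nn_integral_departure_law_Suc:
  assumes [measurable]: "f \<in> borel_measurable list_space"
  shows "(\<integral>\<^sup>+ds. f ds \<partial>departure_law m l (Suc n)) =
    (\<integral>\<^sup>+ds. (\<integral>\<^sup>+b. f (admit m ds 0 b) \<partial>exp_law l) \<partial>departure_law m l n)"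
proof -
  interpret prob_space "departure_law m l n" by (rule prob_space_departure_law)
  interpret E: prob_space "exp_law l" by (rule prob_space_exp_law[OF l])
  note [measurable] = measurable_admit_pair
  have "(\<integral>\<^sup>+ds. f ds \<partial>departure_law m l (Suc n)) =
      (\<integral>\<^sup>+x. f (case x of (ds, b) \<Rightarrow> admit m ds 0 b) \<partial>(departure_law m l n \<Otimes>\<^sub>M exp_law l))"
    by (simp add: nn_integral_distr)
  also have "\<dots> = (\<integral>\<^sup>+ds. (\<integral>\<^sup>+b. f (admit m ds 0 b) \<partial>exp_law l) \<partial>departure_law m l n)"
    by (subst E.nn_integral_fst[symmetric]) auto
  finally show ?thesis .
qed

text \<open>
  The last task enters service at a time determined by the earlier departures. Carrying a function
  \<open>\<phi>\<close> of the departure times stopped at \<open>t\<close> through the induction is what decouples this entry time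
  from the residual times.
\<close>

lemma residual_admit_integral:
  fixes \<phi> \<psi> :: "real list \<Rightarrow> ennreal" and t :: real
  assumes t: "0 \<le> t"
    and [measurable]: "\<phi> \<in> borel_measurable list_space" "\<psi> \<in> borel_measurable list_space"
  defines "A \<equiv> \<lambda>x. \<integral>\<^sup>+b. \<phi> (x @ [entry m x 0 + b]) * indicator {..<t} (entry m x 0 + b) \<partial>exp_law l"
    and "B \<equiv> \<lambda>x. \<phi> (x @ [t]) * (\<integral>\<^sup>+b. indicator {t..} (entry m x 0 + b) \<partial>exp_law l)"
  shows "(\<integral>\<^sup>+b. \<phi> (map (min t) (admit m ds 0 b)) * \<psi> (residual t (admit m ds 0 b)) \<partial>exp_law l) =
     A (map (min t) ds) * \<psi> (residual t ds)
     + B (map (min t) ds) * (\<integral>\<^sup>+b. \<psi> (admit m (residual t ds) 0 b) \<partial>exp_law l)"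
proof -
  interpret E: prob_space "exp_law l" by (rule prob_space_exp_law[OF l])
  note [measurable] = measurable_admit[OF m] measurable_entry[OF m]
  let ?x = "map (min t) ds" and ?r = "residual t ds" and ?S = "entry m ds 0"
  have Sx: "entry m ?x 0 = min t ?S"
    by (rule entry_map_min[OF m t])
  have Sr: "entry m ?r 0 = max 0 (?S - t)"
    by (rule entry_residual[OF m t])
  \<comment> \<open>A collects the event that the last task departs before t, B the event that it is
    still present, where its capped departure is t. Either it starts service at or after t, and then
    its whole service time lies ahead, or it starts before t, and then memorylessness is
    needed.\<close>
  show ?thesis
  proof (cases "t \<le> ?S")
    case True
    have Ax: "A ?x = 0"
      unfolding A_def
      by (intro nn_integral_0_iff_AE[THEN iffD2] AE_mp[OF AE_exp_law_nonneg AE_I2])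
        (use True in \<open>auto simp: Sx\<close>)
    have Bx: "B ?x = \<phi> (?x @ [t])"
    proof -
      have "(\<integral>\<^sup>+b. indicator {t..} (entry m ?x 0 + b) \<partial>exp_law l) = (\<integral>\<^sup>+b. 1 \<partial>exp_law l)"
        by (intro nn_integral_cong_AE AE_mp[OF AE_exp_law_nonneg AE_I2]) (use True in \<open>auto simp: Sx\<close>)
      also have "\<dots> = 1" using E.emeasure_space_1 by simp
      finally show ?thesis by (simp add: B_def)
    qed
    have "(\<integral>\<^sup>+b. \<phi> (map (min t) (admit m ds 0 b)) * \<psi> (residual t (admit m ds 0 b)) \<partial>exp_law l)
       = (\<integral>\<^sup>+b. \<phi> (?x @ [t]) * \<psi> (admit m ?r 0 b) \<partial>exp_law l)"
    proof (intro nn_integral_cong_AE AE_mp[OF AE_exp_law_nonneg AE_I2] impI)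
      fix b :: real assume "0 \<le> b"
      then have "residual t (admit m ds 0 b) = admit m ?r 0 b"
        using True unfolding admit_entry Sr by (simp add: residual_def)
      then show "\<phi> (map (min t) (admit m ds 0 b)) * \<psi> (residual t (admit m ds 0 b)) =
          \<phi> (?x @ [t]) * \<psi> (admit m ?r 0 b)"
        using True \<open>0 \<le> b\<close> by (simp add: admit_entry min_def)
    qed
    also have "\<dots> = \<phi> (?x @ [t]) * (\<integral>\<^sup>+b. \<psi> (admit m ?r 0 b) \<partial>exp_law l)"
      by (rule nn_integral_cmult) simp
    finally show ?thesis
      by (simp add: Ax Bx)
  next
    case False
    then have Sx': "entry m ?x 0 = ?S" and r: "length ?r < m"
      using length_residual_less[OF m, of ds 0 t] by (auto simp: Sx)
    \<comment> \<open>Before t the last task has found a free server, so fewer than m earlier tasks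
      remain and re-admitting it to the residual list starts it at once.\<close>
    have adm: "admit m ?r 0 b = ?r @ [b]" for b
      by (simp add: admit_entry entry_zero_if_short[OF m r])
    have "(\<integral>\<^sup>+b. \<phi> (map (min t) (admit m ds 0 b)) * \<psi> (residual t (admit m ds 0 b)) \<partial>exp_law l)
       = (\<integral>\<^sup>+b. \<phi> (?x @ [?S + b]) * indicator {..<t} (?S + b) * \<psi> ?r +
            \<phi> (?x @ [t]) * (indicator {t - ?S..} b * \<psi> (?r @ [b - (t - ?S)])) \<partial>exp_law l)"
      by (intro nn_integral_cong)
        (auto simp: admit_entry residual_def indicator_def min_def algebra_simps)
    also have "\<dots> = A ?x * \<psi> ?r +
       \<phi> (?x @ [t]) * (\<integral>\<^sup>+b. indicator {t - ?S..} b * \<psi> (?r @ [b - (t - ?S)]) \<partial>exp_law l)"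
      unfolding A_def Sx' by (simp add: nn_integral_add nn_integral_cmult nn_integral_multc)
    \<comment> \<open>By time t an amount \<open>t - ?S\<close> of the service has elapsed; the
      remainder is again exponential.\<close>
    also have "(\<integral>\<^sup>+b. indicator {t - ?S..} b * \<psi> (?r @ [b - (t - ?S)]) \<partial>exp_law l) =
       (\<integral>\<^sup>+b. indicator {t - ?S..} b \<partial>exp_law l) * (\<integral>\<^sup>+b. \<psi> (?r @ [b]) \<partial>exp_law l)"
      using False by (intro exp_law_memoryless[OF l]) auto
    also have "(\<integral>\<^sup>+b. indicator {t - ?S..} b \<partial>exp_law l) = (\<integral>\<^sup>+b. indicator {t..} (entry m ?x 0 + b) \<partial>exp_law l)"
      unfolding Sx' by (intro nn_integral_cong) (auto simp: indicator_def algebra_simps)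
    finally show ?thesis
      by (simp add: B_def adm mult.assoc)
  qed
qed

lemma length_departure_law: "AE ds in departure_law m l n. length ds = n"
proof (induction n)
  case 0
  have "Measurable.pred list_space (\<lambda>ds. length ds = 0)"
    by measurable
  then have "AE ds in return list_space []. length ds = 0"
    by (subst AE_return) simp_all
  then show ?case
    by (simp only: departure_law.simps(1))
next
  case (Suc n)
  interpret prob_space "departure_law m l n" by (rule prob_space_departure_law)
  interpret E: prob_space "exp_law l" by (rule prob_space_exp_law[OF l])
  interpret P: pair_sigma_finite "departure_law m l n" "exp_law l" ..
  note [measurable] = measurable_admit_pair
  have "AE x in departure_law m l n \<Otimes>\<^sub>M exp_law l. length (fst x) = n"
  proof (rule P.AE_pair_measure)
    show "{x \<in> space (departure_law m l n \<Otimes>\<^sub>M exp_law l). length (fst x) = n}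
        \<in> sets (departure_law m l n \<Otimes>\<^sub>M exp_law l)"
      by measurable
    show "AE ds in departure_law m l n. AE b in exp_law l. length (fst (ds, b)) = n"
      using Suc by simp
  qed
  then have "AE x in departure_law m l n \<Otimes>\<^sub>M exp_law l. length (case x of (ds, b) \<Rightarrow> admit m ds 0 b) = Suc n"
    by eventually_elim (auto simp: admit_def)
  moreover have "{ds \<in> space list_space. length ds = Suc n} \<in> sets list_space"
    by measurable
  ultimately show ?case
    unfolding departure_law.simps(2) by (subst AE_distr_iff) simp_all
qed

text \<open>Given the departures capped at t, only the number of remaining tasks matters for their
  residual times. Peeling off the last task turns the pair of \<phi> and \<psi> into one pair with A
  and one with B, so the induction must range over all such pairs.\<close>

lemma departure_law_residual_history:
  assumes t: "0 \<le> t"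
    and "\<phi> \<in> borel_measurable list_space" "\<psi> \<in> borel_measurable list_space"
  shows "(\<integral>\<^sup>+ds. \<phi> (map (min t) ds) * \<psi> (residual t ds) \<partial>departure_law m l n) =
    (\<integral>\<^sup>+ds. \<phi> (map (min t) ds) * (\<integral>\<^sup>+r. \<psi> r \<partial>departure_law m l (length (residual t ds)))
       \<partial>departure_law m l n)"
  using assms(2,3)
proof (induction n arbitrary: \<phi> \<psi>)
  case 0
  note [measurable] = 0
  have [measurable]: "(\<lambda>ds. \<integral>\<^sup>+r. \<psi> r \<partial>departure_law m l (length (residual t ds)))
      \<in> borel_measurable list_space"
    by (rule measurable_compose[where g="\<lambda>n. \<integral>\<^sup>+r. \<psi> r \<partial>departure_law m l n"
          and N="count_space UNIV"]) simp_all
  have "(\<lambda>ds. \<phi> (map (min t) ds) * (\<integral>\<^sup>+r. \<psi> r \<partial>departure_law m l (length (residual t ds))))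
      \<in> borel_measurable list_space"
    "(\<lambda>ds. \<phi> (map (min t) ds) * \<psi> (residual t ds)) \<in> borel_measurable list_space"
    by measurable
  then show ?case
    using 0 by (simp only: departure_law.simps(1)) (simp add: nn_integral_return, simp add: residual_def nn_integral_return)
next
  case (Suc n)
  note [measurable] = Suc.prems measurable_admit[OF m] measurable_entry[OF m]
  interpret prob_space "departure_law m l n" by (rule prob_space_departure_law)
  interpret E: prob_space "exp_law l" by (rule prob_space_exp_law[OF l])
  define \<Psi> where "\<Psi> k = (\<integral>\<^sup>+r. \<psi> r \<partial>departure_law m l k)" for k
  define \<psi>' where "\<psi>' r = (\<integral>\<^sup>+b. \<psi> (admit m r 0 b) \<partial>exp_law l)" for r
  define A where "A x = (\<integral>\<^sup>+b. \<phi> (x @ [entry m x 0 + b]) * indicator {..<t} (entry m x 0 + b) \<partial>exp_law l)" for x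
  define B where "B x = \<phi> (x @ [t]) * (\<integral>\<^sup>+b. indicator {t..} (entry m x 0 + b) \<partial>exp_law l)" for x
  have [measurable]: "\<psi>' \<in> borel_measurable list_space" "A \<in> borel_measurable list_space"
    "B \<in> borel_measurable list_space"
    unfolding \<psi>'_def A_def B_def by measurable
  have \<Psi>': "(\<integral>\<^sup>+r. \<psi>' r \<partial>departure_law m l k) = \<Psi> (Suc k)" for k
    unfolding \<psi>'_def \<Psi>_def by (subst nn_integral_departure_law_Suc) simp_all
  have [measurable]: "(\<lambda>r. \<Psi> (length r)) \<in> borel_measurable list_space"
    by (rule measurable_compose[OF measurable_length_list_space]) simp
  let ?x = "map (min t)" and ?r = "residual t"
  have "(\<integral>\<^sup>+ds. \<phi> (?x ds) * \<psi> (?r ds) \<partial>departure_law m l (Suc n)) =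
     (\<integral>\<^sup>+ds. A (?x ds) * \<psi> (?r ds) + B (?x ds) * \<psi>' (?r ds) \<partial>departure_law m l n)"
    by (subst nn_integral_departure_law_Suc)
      (simp_all add: residual_admit_integral[OF t] A_def B_def \<psi>'_def)
  also have "\<dots> = (\<integral>\<^sup>+ds. A (?x ds) * \<Psi> (length (?r ds)) \<partial>departure_law m l n) +
      (\<integral>\<^sup>+ds. B (?x ds) * \<Psi> (Suc (length (?r ds))) \<partial>departure_law m l n)"
    using Suc.IH[of A \<psi>] Suc.IH[of B \<psi>']
    by (simp add: nn_integral_add \<Psi>' flip: \<Psi>_def)
  also have "\<dots> = (\<integral>\<^sup>+ds. A (?x ds) * \<Psi> (length (?r ds)) + B (?x ds) * \<Psi> (Suc (length (?r ds))) \<partial>departure_law m l n)"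
  proof (rule nn_integral_add[symmetric])
    have [measurable]: "(\<lambda>ds. \<Psi> (Suc (length (?r ds)))) \<in> borel_measurable list_space"
      "(\<lambda>ds. \<Psi> (length (?r ds))) \<in> borel_measurable list_space"
      by measurable
    show "(\<lambda>ds. A (?x ds) * \<Psi> (length (?r ds))) \<in> borel_measurable (departure_law m l n)"
      "(\<lambda>ds. B (?x ds) * \<Psi> (Suc (length (?r ds)))) \<in> borel_measurable (departure_law m l n)"
      by measurable
  qed
  \<comment> \<open>Admission lengthens the list by one whatever b is, so the value at
    \<open>Suc\<close> is an average over b. This is the shape in which
    \<open>residual_admit_integral\<close> can be read backwards, now for a function of the
    length.\<close>
  also have "\<dots> = (\<integral>\<^sup>+ds. A (?x ds) * \<Psi> (length (?r ds)) +
      B (?x ds) * (\<integral>\<^sup>+b. \<Psi> (length (admit m (?r ds) 0 b)) \<partial>exp_law l) \<partial>departure_law m l n)"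
    using E.emeasure_space_1 by (simp add: admit_def)
  also have "\<dots> = (\<integral>\<^sup>+ds. \<phi> (?x ds) * \<Psi> (length (?r ds)) \<partial>departure_law m l (Suc n))"
    by (subst nn_integral_departure_law_Suc)
      (simp_all add: residual_admit_integral[OF t, of \<phi> "\<lambda>r. \<Psi> (length r)"] A_def B_def)
  finally show ?case
    by (simp add: \<Psi>_def)
qed

lemma departure_law_residual:
  assumes "0 \<le> t" "\<psi> \<in> borel_measurable list_space"
  shows "(\<integral>\<^sup>+ds. \<psi> (residual t ds) \<partial>departure_law m l n) =
    (\<integral>\<^sup>+ds. (\<integral>\<^sup>+r. \<psi> r \<partial>departure_law m l (length (residual t ds))) \<partial>departure_law m l n)"
  using departure_law_residual_history[OF assms(1) _ assms(2), of "\<lambda>_. 1"] by simp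

end

subsection \<open>Left limits of a finite Markov chain\<close>

text \<open>Each multiplication by Q costs at most its largest absolute row sum, bounded here by the
  sum over all rows. Row i is inserted because i may lie outside E.\<close>

lemma mat_power_bound:
  assumes E: "finite E"
  shows "\<bar>mat_power E Q n i j\<bar> \<le> (\<Sum>l\<in>insert i E. \<Sum>k\<in>E. \<bar>Q l k\<bar>) ^ n"
proof -
  define C where "C = (\<Sum>l\<in>insert i E. \<Sum>k\<in>E. \<bar>Q l k\<bar>)"
  have C: "0 \<le> C"
    unfolding C_def by (intro sum_nonneg) auto
  have row: "(\<Sum>k\<in>E. \<bar>Q l k\<bar>) \<le> C" if "l \<in> insert i E" for l
    unfolding C_def using that E by (intro member_le_sum) (auto intro: sum_nonneg)
  have "\<bar>mat_power E Q n l j\<bar> \<le> C ^ n" if "l \<in> insert i E" for l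
    using that
  proof (induction n arbitrary: l)
    case (Suc n)
    have "\<bar>mat_power E Q (Suc n) l j\<bar> \<le> (\<Sum>k\<in>E. \<bar>Q l k\<bar> * \<bar>mat_power E Q n k j\<bar>)"
      by (simp add: sum_abs flip: abs_mult)
    also have "\<dots> \<le> (\<Sum>k\<in>E. \<bar>Q l k\<bar> * C ^ n)"
      using Suc.IH by (intro sum_mono mult_left_mono) auto
    also have "\<dots> \<le> C ^ Suc n"
      using row[OF Suc.prems] C by (simp add: mult_right_mono flip: sum_distrib_right)
    finally show ?case .
  qed auto
  then show ?thesis
    by (simp add: C_def)
qed

text \<open>A power series that converges everywhere is continuous; this is what carries the
  finite-dimensional distributions over to left limits.\<close>

lemma isCont_transition:
  assumes E: "finite E"
  shows "isCont (\<lambda>t. transition E Q t i j) x"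
proof -
  define C where "C = (\<Sum>l\<in>insert i E. \<Sum>k\<in>E. \<bar>Q l k\<bar>)"
  have "summable (\<lambda>n. mat_power E Q n i j / fact n * y ^ n)" for y :: real
  proof (rule summable_comparison_test')
    show "summable (\<lambda>n. (C * \<bar>y\<bar>) ^ n / fact n)"
      using summable_exp[of "C * \<bar>y\<bar>"] by (simp add: field_simps)
    show "norm (mat_power E Q n i j / fact n * y ^ n) \<le> (C * \<bar>y\<bar>) ^ n / fact n" for n
      using mat_power_bound[OF E, of Q n i j] unfolding C_def
      by (simp add: abs_mult power_mult_distrib power_abs divide_right_mono mult_right_mono)
  qed
  then have "isCont (\<lambda>x. \<Sum>n. mat_power E Q n i j / fact n * x ^ n) x"
    by (rule isCont_powser_converges_everywhere)
  then show ?thesis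
    by (simp add: transition_def mult.commute)
qed

lemma measurable_transition [measurable (raw)]:
  assumes "finite E" and [measurable]: "f \<in> borel_measurable N"
  shows "(\<lambda>x. transition E Q (f x) i j) \<in> borel_measurable N"
proof -
  have "(\<lambda>t. transition E Q t i j) \<in> borel_measurable borel"
    by (intro borel_measurable_continuous_onI continuous_at_imp_continuous_on ballI isCont_transition assms)
  from measurable_compose[OF assms(2) this] show ?thesis .
qed

text \<open>At nonpositive times, where the path is not constrained from the left, the start i
  serves as default, so that the value lies in the set of states at every time.\<close>

definition left_value :: "(real \<Rightarrow> 'w \<Rightarrow> nat) \<Rightarrow> nat \<Rightarrow> real \<Rightarrow> 'w \<Rightarrow> nat" where
  "left_value X i t w = (if 0 < t then Lim (at_left t) (\<lambda>r. X r w) else i)"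

text \<open>The largest multiple of \<open>1 / Suc n\<close> strictly below t, cut off at 0.
  Strictness approximates the left limit even when t is a grid point, and countably many grid values
  make the process at this point jointly measurable.\<close>

definition left_grid :: "nat \<Rightarrow> real \<Rightarrow> real" where
  "left_grid n t = max 0 ((real_of_int \<lceil>t * real (Suc n)\<rceil> - 1) / real (Suc n))"

lemma filterlim_left_grid:
  assumes t: "0 < t"
  shows "filterlim (\<lambda>n. left_grid n t) (at_left t) sequentially"
proof -
  have up: "left_grid n t < t" for n
  proof -
    have "real_of_int \<lceil>t * real (Suc n)\<rceil> - 1 < t * real (Suc n)" by linarith
    then show ?thesis
      using t by (simp add: left_grid_def pos_divide_less_eq del: of_nat_Suc)
  qed
  have low: "t - 1 / real (Suc n) \<le> left_grid n t" for n
  proof -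
    have "t * real (Suc n) - 1 \<le> real_of_int \<lceil>t * real (Suc n)\<rceil> - 1" by linarith
    then have "(t * real (Suc n) - 1) / real (Suc n) \<le> (real_of_int \<lceil>t * real (Suc n)\<rceil> - 1) / real (Suc n)"
      by (intro divide_right_mono) auto
    moreover have "(t * real (Suc n) - 1) / real (Suc n) = t - 1 / real (Suc n)"
      by (simp add: field_simps)
    ultimately show ?thesis
      unfolding left_grid_def by linarith
  qed
  have "(\<lambda>n. left_grid n t) \<longlonglongrightarrow> t"
  proof (rule tendsto_sandwich[where h="\<lambda>_. t"])
    have "(\<lambda>n. t - 1 / real (Suc n)) \<longlonglongrightarrow> t - 0"
      by (intro tendsto_diff tendsto_const LIMSEQ_inverse_real_of_nat[unfolded inverse_eq_divide])
    then show "(\<lambda>n. t - 1 / real (Suc n)) \<longlonglongrightarrow> t" by simp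
  qed (use up low less_imp_le in \<open>auto intro!: always_eventually\<close>)
  then show ?thesis
    using up by (auto simp: filterlim_at less_imp_neq)
qed

lemma measurable_at_left_grid:
  assumes X: "\<And>t. 0 \<le> t \<Longrightarrow> X t \<in> measurable N (count_space UNIV)"
  shows "(\<lambda>(t, w). X (left_grid n t) w) \<in> measurable (borel \<Otimes>\<^sub>M N) (count_space UNIV)"
proof -
  have "(\<lambda>x. X (max 0 ((real_of_int \<lceil>fst x * real (Suc n)\<rceil> - 1) / real (Suc n))) (snd x))
      \<in> measurable (borel \<Otimes>\<^sub>M N) (count_space UNIV)"
    by (rule measurable_compose_countable[where
          f="\<lambda>c x. X (max 0 ((real_of_int c - 1) / real (Suc n))) (snd x)"])
      (auto intro!: measurable_compose[OF measurable_snd X])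
  then show ?thesis
    by (simp add: left_grid_def split_beta')
qed

section \<open>Independence and integration over the diagonal\<close>

context prob_space
begin

text \<open>
  Two copies of the sample point replace a product decomposition of the sample space: a quantity that
  depends on \<open>w\<close> through \<open>N1\<close> and \<open>N2\<close> is read as the restriction of \<open>F\<close> to the diagonal.
\<close>

lemma nn_integral_diagonal:
  assumes ind: "indep_set (sets N1) (sets N2)"
    and sp: "space N1 = space M" "space N2 = space M"
    and F: "F \<in> borel_measurable (N1 \<Otimes>\<^sub>M N2)"
  shows "(\<integral>\<^sup>+w. F (w, w) \<partial>M) = (\<integral>\<^sup>+w. \<integral>\<^sup>+v. F (w, v) \<partial>M \<partial>M)"
proof -
  have ev: "sets N1 \<subseteq> events" "sets N2 \<subseteq> events"
    using ind by (auto dest: indep_setD_ev1 indep_setD_ev2)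
  have rv: "(\<lambda>w. w) \<in> measurable M N1" "(\<lambda>w. w) \<in> measurable M N2"
    using ev sp by (auto simp: measurable_def sets.sets_into_space intro!: sets.Int)
  have ident: "{(\<lambda>w. w) -` A \<inter> space M | A. A \<in> sets N} = sets N" if "space N = space M" for N
  proof -
    have "A \<inter> space M = A" if "A \<in> sets N" for A
      using sets.sets_into_space[OF that] \<open>space N = space M\<close> by auto
    then have "(\<lambda>A. (\<lambda>w. w) -` A \<inter> space M) ` sets N = (\<lambda>A. A) ` sets N"
      by (intro image_cong refl) (simp only: vimage_ident)
    then show ?thesis
      unfolding setcompr_eq_image by simp
  qed
  have "sigma_sets (space M) {(\<lambda>w. w) -` A \<inter> space M | A. A \<in> sets N} = sets N"
    if sp: "space N = space M" for N
    unfolding ident[OF sp] by (subst sp[symmetric]) (rule sets.sigma_sets_eq)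
  \<comment> \<open>The identity is read as two random variables with values in the coarser spaces
    N1 and N2; their independence makes the law of the diagonal a product measure.\<close>
  then have "indep_var N1 (\<lambda>w. w) N2 (\<lambda>w. w)"
    using ind sp rv by (simp add: indep_var_eq)
  then have eq: "distr M N1 (\<lambda>w. w) \<Otimes>\<^sub>M distr M N2 (\<lambda>w. w) = distr M (N1 \<Otimes>\<^sub>M N2) (\<lambda>w. (w, w))"
    by (simp add: indep_var_distribution_eq)
  interpret D: prob_space "distr M N2 (\<lambda>w. w)"
    by (rule prob_space_distr[OF rv(2)])
  have "(\<integral>\<^sup>+w. F (w, w) \<partial>M) = (\<integral>\<^sup>+x. F x \<partial>distr M (N1 \<Otimes>\<^sub>M N2) (\<lambda>w. (w, w)))"
    using F rv by (subst nn_integral_distr) (auto intro: measurable_Pair)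
  also have "\<dots> = (\<integral>\<^sup>+w. \<integral>\<^sup>+v. F (w, v) \<partial>distr M N2 (\<lambda>w. w) \<partial>distr M N1 (\<lambda>w. w))"
    unfolding eq[symmetric] using F
    by (subst D.nn_integral_fst[symmetric]) (auto cong: measurable_cong_sets sets_pair_measure_cong)
  also have "\<dots> = (\<integral>\<^sup>+w. \<integral>\<^sup>+v. F (w, v) \<partial>distr M N2 (\<lambda>w. w) \<partial>M)"
    using F rv D.borel_measurable_nn_integral_fst[of F N1]
    by (subst nn_integral_distr) (auto cong: measurable_cong_sets sets_pair_measure_cong)
  also have "\<dots> = (\<integral>\<^sup>+w. \<integral>\<^sup>+v. F (w, v) \<partial>M \<partial>M)"
    using F rv sp by (intro nn_integral_cong nn_integral_distr) (auto intro: measurable_compose[OF measurable_Pair1'])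
  finally show ?thesis .
qed

text \<open>Group a finite family by its sources. The intersection within a group belongs to the
  algebra of that source, so the probability factors first over the sources and then inside each
  group.\<close>

lemma indep_sets_refine:
  assumes G: "indep_sets G UNIV" and alg: "\<And>k. sigma_algebra (space M) (G k)"
    and sub: "\<And>i. F i \<subseteq> G (p i)" and ind: "\<And>k. indep_sets F {i. p i = k}"
  shows "indep_sets F UNIV"
proof (rule indep_setsI)
  show "F i \<subseteq> events" for i
    using ind[of "p i"] by (auto simp: indep_sets_def)
next
  fix A J assume J: "J \<noteq> {}" "finite J" "J \<subseteq> UNIV" and A: "\<forall>j\<in>J. A j \<in> F j"
  define Jk where "Jk k = {j \<in> J. p j = k}" for k
  define B where "B k = (\<Inter>j\<in>Jk k. A j)" for k
  have Jk: "finite (Jk k)" "Jk k \<subseteq> {i. p i = k}" for k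
    using J by (auto simp: Jk_def)
  have ne: "Jk k \<noteq> {}" if "k \<in> p ` J" for k
    using that by (auto simp: Jk_def)
  have B: "B k \<in> G k" if "k \<in> p ` J" for k
  proof -
    interpret sigma_algebra "space M" "G k" by (rule alg)
    show ?thesis
      unfolding B_def using A sub by (intro finite_INT Jk ne[OF that]) (auto simp: Jk_def)
  qed
  have "(\<Inter>j\<in>J. A j) = (\<Inter>k\<in>p ` J. B k)"
    by (auto simp: B_def Jk_def)
  also have "prob \<dots> = (\<Prod>k\<in>p ` J. prob (B k))"
    using J B by (intro indep_setsD[OF G]) auto
  also have "\<dots> = (\<Prod>k\<in>p ` J. \<Prod>j\<in>Jk k. prob (A j))"
    unfolding B_def using A by (intro prod.cong refl indep_setsD[OF ind Jk(2)] ne Jk) (auto simp: Jk_def)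
  also have "\<dots> = (\<Prod>j\<in>J. prob (A j))"
    unfolding Jk_def using J by (intro prod.image_gen[symmetric]) auto
  finally show "prob (\<Inter>j\<in>J. A j) = (\<Prod>j\<in>J. prob (A j))" .
qed

lemma indep_set_disjoint_index:
  assumes ind: "indep_sets F UNIV" and st: "\<And>i. Int_stable (F i)" and disj: "I \<inter> I' = {}"
  shows "indep_set (sigma_sets (space M) (\<Union>i\<in>I. F i)) (sigma_sets (space M) (\<Union>i\<in>I'. F i))"
proof -
  have "indep_sets (\<lambda>b. sigma_sets (space M) (\<Union>i\<in>case_bool I I' b. F i)) UNIV"
    using disj
    by (intro indep_sets_collect_sigma indep_sets_mono_index[OF _ ind] st)
      (auto simp: disjoint_family_on_def split: bool.splits)
  moreover have "(\<lambda>b. sigma_sets (space M) (\<Union>i\<in>case_bool I I' b. F i)) =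
      case_bool (sigma_sets (space M) (\<Union>i\<in>I. F i)) (sigma_sets (space M) (\<Union>i\<in>I'. F i))"
    by (auto simp: fun_eq_iff split: bool.split)
  ultimately show ?thesis
    by (simp add: indep_set_def)
qed

section \<open>Left limits of the chain at deterministic times\<close>

context
  fixes E :: "nat set" and Q :: "nat \<Rightarrow> nat \<Rightarrow> real" and i0 :: nat and X :: "real \<Rightarrow> 'a \<Rightarrow> nat"
  assumes chain: "markov_chain M E Q i0 X" and fin: "finite E" and i0: "i0 \<in> E"
begin

lemma chain_in: "0 \<le> t \<Longrightarrow> w \<in> space M \<Longrightarrow> X t w \<in> E"
  using chain measurable_space[of "X t" M "count_space E" w] unfolding markov_chain_def by auto

lemma chain_measurable: "0 \<le> t \<Longrightarrow> X t \<in> measurable M (count_space UNIV)"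
  using chain unfolding markov_chain_def by (auto intro: measurable_compose[where N="count_space E"])

lemma eventually_left_value:
  assumes w: "w \<in> space M" and t: "0 < t"
  shows "\<forall>\<^sub>F r in at_left t. X r w = left_value X i0 t w"
proof -
  obtain l where l: "((\<lambda>r. X r w) \<longlongrightarrow> l) (at_left t)"
    using chain w t unfolding markov_chain_def by blast
  then have "Lim (at_left t) (\<lambda>r. X r w) = l"
    by (intro tendsto_Lim) auto
  with l t show ?thesis
    by (simp add: left_value_def tendsto_discrete)
qed

lemma eventually_left_grid:
  assumes w: "w \<in> space M" and t: "0 < t"
  shows "\<forall>\<^sub>F n in sequentially. X (left_grid n t) w = left_value X i0 t w"
  using filterlim_left_grid[OF t] eventually_left_value[OF assms]
  unfolding filterlim_iff by blast

lemma left_value_in: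
  assumes w: "w \<in> space M"
  shows "left_value X i0 t w \<in> E"
proof (cases "0 < t")
  case True
  from eventually_happens[OF eventually_left_grid[OF w True]]
  obtain n where "X (left_grid n t) w = left_value X i0 t w" by auto
  moreover have "X (left_grid n t) w \<in> E"
    by (rule chain_in[OF _ w]) (simp add: left_grid_def)
  ultimately show ?thesis by simp
qed (simp add: left_value_def i0)

text \<open>In a discrete space the left limit is the eventual value along the grid, a countable
  condition. N is kept general so that the result applies to the events generated by the regime
  alone.\<close>

lemma measurable_left_value:
  assumes sp: "space N = space M" and X: "\<And>t. 0 \<le> t \<Longrightarrow> X t \<in> measurable N (count_space UNIV)"
  shows "(\<lambda>(t, w). left_value X i0 t w) \<in> measurable (borel \<Otimes>\<^sub>M N) (count_space UNIV)"
proof -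
  note [measurable] = measurable_at_left_grid[OF X]
  have eq: "left_value X i0 t w = j \<longleftrightarrow>
      (if 0 < t then \<exists>n0. \<forall>n\<ge>n0. (\<lambda>(t, w). X (left_grid n t) w) (t, w) = j else i0 = j)"
    if w: "w \<in> space M" for t w j
  proof (cases "0 < t")
    case True
    from eventually_left_grid[OF w this]
    obtain n1 where n1: "\<And>n. n \<ge> n1 \<Longrightarrow> X (left_grid n t) w = left_value X i0 t w"
      by (auto simp: eventually_sequentially)
    have "left_value X i0 t w = j" if "\<forall>n\<ge>n0. X (left_grid n t) w = j" for n0
      using that n1[of "max n0 n1"] by simp
    with True n1 show ?thesis by auto
  qed (auto simp: left_value_def)
  have "Measurable.pred (borel \<Otimes>\<^sub>M N)
     (\<lambda>x. if 0 < fst x then \<exists>n0. \<forall>n\<ge>n0. (\<lambda>(t, w). X (left_grid n t) w) x = j else i0 = j)" for j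
    by measurable
  moreover have "case_prod (left_value X i0) x = j \<longleftrightarrow>
      (if 0 < fst x then \<exists>n0. \<forall>n\<ge>n0. (\<lambda>(t, w). X (left_grid n t) w) x = j else i0 = j)"
    if "x \<in> space (borel \<Otimes>\<^sub>M N)" for x j
    using eq[of "snd x" "fst x" j] that by (cases x) (simp add: space_pair_measure sp)
  then have "(case_prod (left_value X i0)) -` {j} \<inter> space (borel \<Otimes>\<^sub>M N) =
      {x \<in> space (borel \<Otimes>\<^sub>M N).
        if 0 < fst x then \<exists>n0. \<forall>n\<ge>n0. (\<lambda>(t, w). X (left_grid n t) w) x = j else i0 = j}" for j
    by blast
  ultimately have "(case_prod (left_value X i0)) -` {j} \<inter> space (borel \<Otimes>\<^sub>M N) \<in> sets (borel \<Otimes>\<^sub>M N)" for j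
    by (simp add: pred_def)
  then show ?thesis
    by (simp add: measurable_count_space_eq2_countable)
qed

lemma left_value_random: "left_value X i0 t \<in> measurable M (count_space UNIV)"
proof -
  have "(\<lambda>w. (t, w)) \<in> measurable M (borel \<Otimes>\<^sub>M M)"
    by simp
  moreover have "(\<lambda>(t, w). left_value X i0 t w) \<in> measurable (borel \<Otimes>\<^sub>M M) (count_space UNIV)"
    by (rule measurable_left_value) (auto intro: chain_measurable)
  ultimately have "(\<lambda>w. case (t, w) of (t, w) \<Rightarrow> left_value X i0 t w) \<in> measurable M (count_space UNIV)"
    by (rule measurable_compose)
  then show ?thesis by simp
qed

lemma AE_chain_start: "AE w in M. X 0 w = i0"
proof -
  have "prob {w \<in> space M. \<forall>k\<le>0. X ((\<lambda>_. 0) k) w = (\<lambda>_::nat. i0) k} = 1"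
    using chain[unfolded markov_chain_def, THEN conjunct2, THEN conjunct2, THEN conjunct2,
        rule_format, of "\<lambda>_. 0" 0 "\<lambda>_. i0"] i0 by simp
  then have "prob {w \<in> space M. X 0 w = i0} = 1" by simp
  then show ?thesis
    by (intro AE_prob_1[THEN eventually_mono]) auto
qed

text \<open>Observe the chain slightly before each \<open>t l\<close>. The indicators converge
  because paths are eventually constant from the left, the transition probabilities because they are
  continuous.\<close>

lemma left_value_fdd:
  assumes t0: "0 < t 0" and t: "\<And>l. t l < t (Suc l)" and a: "\<And>l. l < k \<Longrightarrow> a l \<in> E"
  shows "prob {w \<in> space M. \<forall>l<k. left_value X i0 (t l) w = a l} =
    (\<Prod>l<k. transition E Q (case_nat 0 t (Suc l) - case_nat 0 t l) (case_nat i0 a l) (case_nat i0 a (Suc l)))"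
proof -
  \<comment> \<open>One shift serves all times; being at most \<open>t 0\<close>, it keeps the
    shifted times nonnegative and ordered after time 0.\<close>
  define \<epsilon> where "\<epsilon> = (\<lambda>n. t 0 / real (Suc n))"
  define s where "s n = case_nat 0 (\<lambda>l. t l - \<epsilon> n)" for n
  define a' where "a' = case_nat i0 a"
  have \<epsilon>: "0 < \<epsilon> n" "\<epsilon> n \<le> t 0" for n
    using t0 by (auto simp: \<epsilon>_def field_simps)
  have \<epsilon>0: "\<epsilon> \<longlonglongrightarrow> 0"
    unfolding \<epsilon>_def divide_inverse
    by (rule tendsto_mult_right_zero[OF LIMSEQ_inverse_real_of_nat])
  have tpos: "t 0 \<le> t l" for l
    using t by (auto intro!: lift_Suc_mono_le[of t 0 l] simp: less_imp_le)
  have mono: "s n l \<le> s n (Suc l)" for n l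
    using \<epsilon>[of n] t by (cases l) (auto simp: s_def less_imp_le)
  have fdd: "prob {w \<in> space M. \<forall>l\<le>k. X (s n l) w = a' l} =
      (\<Prod>l<k. transition E Q (s n (Suc l) - s n l) (a' l) (a' (Suc l)))" for n
  proof -
    have "a' l \<in> E" if "l \<le> k" for l
      using that a i0 by (cases l) (auto simp: a'_def)
    moreover have "s n 0 = 0" "a' 0 = i0" by (auto simp: s_def a'_def)
    ultimately show ?thesis
      using chain[unfolded markov_chain_def, THEN conjunct2, THEN conjunct2, THEN conjunct2,
          rule_format, of "s n" k a'] mono[of n] by simp
  qed
  have s_nonneg: "0 \<le> s n l" for n l
    using \<epsilon>[of n] tpos[of "l - 1"] by (cases l) (auto simp: s_def intro: order_trans)
  have meas: "{w \<in> space M. \<forall>l\<le>k. X (s n l) w = a' l} \<in> events" for n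
  proof -
    note [measurable] = chain_measurable[OF s_nonneg]
    show ?thesis by measurable
  qed
  have meas': "{w \<in> space M. \<forall>l<k. left_value X i0 (t l) w = a l} \<in> events"
  proof -
    note [measurable] = left_value_random
    show ?thesis by measurable
  qed
  have "(\<lambda>n. prob {w \<in> space M. \<forall>l\<le>k. X (s n l) w = a' l}) \<longlonglongrightarrow>
      prob {w \<in> space M. \<forall>l<k. left_value X i0 (t l) w = a l}"
  proof -
    have "(\<lambda>n. \<integral>w. (indicator {w \<in> space M. \<forall>l\<le>k. X (s n l) w = a' l} w :: real) \<partial>M) \<longlonglongrightarrow>
        (\<integral>w. (indicator {w \<in> space M. \<forall>l<k. left_value X i0 (t l) w = a l} w :: real) \<partial>M)"
    proof (rule integral_dominated_convergence[where w="\<lambda>_. 1"])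
      show "AE w in M. (\<lambda>n. indicator {w \<in> space M. \<forall>l\<le>k. X (s n l) w = a' l} w :: real)
          \<longlonglongrightarrow> indicator {w \<in> space M. \<forall>l<k. left_value X i0 (t l) w = a l} w"
        using AE_chain_start
      proof (rule AE_mp[OF _ AE_I2], intro impI)
        fix w assume w: "w \<in> space M" "X 0 w = i0"
        have "\<forall>\<^sub>F n in sequentially. X (t l - \<epsilon> n) w = left_value X i0 (t l) w" for l
        proof -
          have "filterlim (\<lambda>n. t l - \<epsilon> n) (at_left (t l)) sequentially"
            using tendsto_diff[OF tendsto_const \<epsilon>0, of "t l"] \<epsilon>
            by (auto simp: filterlim_at less_imp_neq)
          then show ?thesis
            using eventually_left_value[OF w(1), of "t l"] t0 tpos[of l]
            unfolding filterlim_iff by force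
        qed
        then have "\<forall>\<^sub>F n in sequentially. \<forall>l\<in>{..<k}. X (t l - \<epsilon> n) w = left_value X i0 (t l) w"
          by (simp add: eventually_ball_finite_distrib)
        then have "\<forall>\<^sub>F n in sequentially. indicator {w \<in> space M. \<forall>l\<le>k. X (s n l) w = a' l} w =
            (indicator {w \<in> space M. \<forall>l<k. left_value X i0 (t l) w = a l} w :: real)"
        proof eventually_elim
          case (elim n)
          \<comment> \<open>The coordinate at time 0 is satisfied because \<open>X 0 w = i0\<close>,
            which holds only almost surely.\<close>
          have "(\<forall>l\<le>k. X (s n l) w = a' l) \<longleftrightarrow> (\<forall>l<k. X (s n (Suc l)) w = a' (Suc l))"
            using w(2) All_less_Suc2[of k "\<lambda>l. X (s n l) w = a' l"]
            by (simp add: less_Suc_eq_le) (simp add: s_def a'_def)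
          with elim show ?case
            by (auto simp: indicator_def s_def a'_def)
        qed
        then show "(\<lambda>n. indicator {w \<in> space M. \<forall>l\<le>k. X (s n l) w = a' l} w :: real)
          \<longlonglongrightarrow> indicator {w \<in> space M. \<forall>l<k. left_value X i0 (t l) w = a l} w"
          by (rule tendsto_eventually)
      qed
      show "(\<lambda>w. indicator {w \<in> space M. \<forall>l<k. left_value X i0 (t l) w = a l} w :: real) \<in> borel_measurable M"
        by (rule borel_measurable_indicator[OF meas'])
      show "(\<lambda>w. indicator {w \<in> space M. \<forall>l\<le>k. X (s n l) w = a' l} w :: real) \<in> borel_measurable M" for n
        by (rule borel_measurable_indicator[OF meas])
    qed (auto simp: indicator_def)
    moreover have "(\<integral>w. (indicator A w :: real) \<partial>M) = prob A" if "A \<in> events" for A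
      using that by simp
    ultimately show ?thesis
      by (simp only: meas meas')
  qed
  moreover have "(\<lambda>n. prob {w \<in> space M. \<forall>l\<le>k. X (s n l) w = a' l}) \<longlonglongrightarrow>
      (\<Prod>l<k. transition E Q (case_nat 0 t (Suc l) - case_nat 0 t l) (a' l) (a' (Suc l)))"
    unfolding fdd
  proof (intro tendsto_prod isCont_tendsto_compose[OF isCont_transition[OF fin]] tendsto_diff)
    have "(\<lambda>n. s n l) \<longlonglongrightarrow> case_nat 0 t l" for l
      using tendsto_diff[OF tendsto_const \<epsilon>0, of "t (l - 1)"] by (cases l) (auto simp: s_def)
    then show "(\<lambda>n. s n (Suc l)) \<longlonglongrightarrow> case_nat 0 t (Suc l)" "(\<lambda>n. s n l) \<longlonglongrightarrow> case_nat 0 t l" for l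
      by blast+
  qed
  ultimately show ?thesis
    unfolding a'_def by (rule LIMSEQ_unique)
qed

text \<open>The Markov property in integrated form. As E is finite, the integrand is a finite
  combination over histories, and extending a history by one state adds one factor to the product in
  \<open>left_value_fdd\<close>. For \<open>k = 0\<close> the predecessor is the start at time
  0.\<close>

lemma left_value_markov:
  fixes \<Phi> :: "(nat \<Rightarrow> nat) \<Rightarrow> nat \<Rightarrow> ennreal"
  assumes t0: "0 < t 0" and t: "\<And>l. t l < t (Suc l)"
    and \<Phi>: "\<And>a b j. (\<And>l. l < k \<Longrightarrow> a l = b l) \<Longrightarrow> \<Phi> a j = \<Phi> b j"
  shows "(\<integral>\<^sup>+w. \<Phi> (\<lambda>l. left_value X i0 (t l) w) (left_value X i0 (t k) w) \<partial>M) =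
    (\<integral>\<^sup>+w. (\<Sum>j\<in>E. ennreal (transition E Q (t k - case_nat 0 t k)
              (case_nat i0 (\<lambda>l. left_value X i0 (t l) w) k) j)
           * \<Phi> (\<lambda>l. left_value X i0 (t l) w) j) \<partial>M)"
proof -
  define Y where "Y l w = left_value X i0 (t l) w" for l w
  define H where "H = {..<k} \<rightarrow>\<^sub>E E"
  define q where "q a j = ennreal (transition E Q (t k - case_nat 0 t k) (case_nat i0 a k) j)" for a j
  define Ev where "Ev a = {w \<in> space M. \<forall>l<k. Y l w = a l}" for a
  note [measurable] = left_value_random
  have [measurable]: "Y l \<in> measurable M (count_space UNIV)" for l
    unfolding Y_def by measurable
  have [measurable]: "Ev a \<in> events" for a
    unfolding Ev_def by measurable
  have Ek [measurable]: "{w \<in> space M. Y k w = j} \<in> events" for j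
    by measurable
  have H: "finite H" unfolding H_def using fin by (auto intro: finite_PiE)
  have YE: "Y l w \<in> E" if "w \<in> space M" for l w
    unfolding Y_def by (rule left_value_in[OF that])
  \<comment> \<open>The events \<open>Ev a\<close> for histories a in H partition the sample space,
    so the sum evaluates f at the observed history.\<close>
  have one: "(\<Sum>a\<in>H. f a * indicator (Ev a) w) = f (restrict (\<lambda>l. Y l w) {..<k})"
    if w: "w \<in> space M" for w and f :: "(nat \<Rightarrow> nat) \<Rightarrow> ennreal"
  proof -
    let ?a = "restrict (\<lambda>l. Y l w) {..<k}"
    have "?a \<in> H" using YE[OF w] by (auto simp: H_def)
    moreover have "w \<in> Ev a \<longleftrightarrow> a = ?a" if "a \<in> H" for a
      using that w by (auto simp: Ev_def H_def PiE_def extensional_def fun_eq_iff)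
    ultimately have "(\<Sum>a\<in>H. f a * indicator (Ev a) w) = (\<Sum>a\<in>H. if a = ?a then f a else 0)"
      by (intro sum.cong) (auto simp: indicator_def)
    with \<open>?a \<in> H\<close> show ?thesis
      using H by (simp add: sum.delta)
  qed
  have qq: "q (restrict a {..<k}) j = q a j" for a j
    by (cases k) (auto simp: q_def)
  have \<Phi>r: "\<Phi> (restrict a {..<k}) j = \<Phi> a j" for a j
    by (rule \<Phi>) simp
  have prob: "emeasure M (Ev a \<inter> {w \<in> space M. Y k w = j}) = emeasure M (Ev a) * q a j"
    if a: "a \<in> H" and j: "j \<in> E" for a j
  proof -
    have aE: "a l \<in> E" if "l < k" for l using a that by (auto simp: H_def)
    define b where "b = a(k := j)"
    have "Ev a \<inter> {w \<in> space M. Y k w = j} = {w \<in> space M. \<forall>l<Suc k. Y l w = b l}"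
      by (auto simp: Ev_def b_def less_Suc_eq)
    then have "prob (Ev a \<inter> {w \<in> space M. Y k w = j}) =
        (\<Prod>l<Suc k. transition E Q (case_nat 0 t (Suc l) - case_nat 0 t l) (case_nat i0 b l) (case_nat i0 b (Suc l)))"
      using aE j unfolding Y_def by (simp only:) (intro left_value_fdd[OF t0 t], auto simp: b_def less_Suc_eq)
    also have "\<dots> = (\<Prod>l<k. transition E Q (case_nat 0 t (Suc l) - case_nat 0 t l) (case_nat i0 a l) (case_nat i0 a (Suc l)))
        * transition E Q (t k - case_nat 0 t k) (case_nat i0 a k) j"
    proof -
      have "case_nat i0 b l = case_nat i0 a l" if "l \<le> k" for l
        using that by (cases l) (auto simp: b_def)
      then show ?thesis
        by (simp add: b_def)
    qed
    also have "(\<Prod>l<k. transition E Q (case_nat 0 t (Suc l) - case_nat 0 t l) (case_nat i0 a l) (case_nat i0 a (Suc l)))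
        = prob (Ev a)"
      unfolding Ev_def Y_def using aE by (intro left_value_fdd[OF t0 t, symmetric])
    finally show ?thesis
      by (simp add: emeasure_eq_measure q_def ennreal_mult')
  qed
  have "(\<integral>\<^sup>+w. \<Phi> (\<lambda>l. Y l w) (Y k w) \<partial>M) =
      (\<integral>\<^sup>+w. (\<Sum>j\<in>E. \<Sum>a\<in>H. \<Phi> a j * indicator (Ev a \<inter> {w \<in> space M. Y k w = j}) w) \<partial>M)"
  proof (intro nn_integral_cong)
    fix w assume w: "w \<in> space M"
    have "(\<Sum>j\<in>E. \<Sum>a\<in>H. \<Phi> a j * indicator (Ev a \<inter> {w \<in> space M. Y k w = j}) w) =
        (\<Sum>j\<in>E. if j = Y k w then (\<Sum>a\<in>H. \<Phi> a j * indicator (Ev a) w) else 0)"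
      using w by (intro sum.cong refl) (auto simp: indicator_inter_arith)
    also have "\<dots> = \<Phi> (\<lambda>l. Y l w) (Y k w)"
      using YE[OF w] fin by (simp add: sum.delta one[OF w] \<Phi>r)
    finally show "\<Phi> (\<lambda>l. Y l w) (Y k w) =
        (\<Sum>j\<in>E. \<Sum>a\<in>H. \<Phi> a j * indicator (Ev a \<inter> {w \<in> space M. Y k w = j}) w)" ..
  qed
  also have "\<dots> = (\<Sum>j\<in>E. \<Sum>a\<in>H. \<Phi> a j * (emeasure M (Ev a) * q a j))"
    by (simp add: nn_integral_sum nn_integral_cmult prob)
  also have "\<dots> = (\<integral>\<^sup>+w. (\<Sum>j\<in>E. \<Sum>a\<in>H. q a j * \<Phi> a j * indicator (Ev a) w) \<partial>M)"
    by (simp add: nn_integral_sum nn_integral_cmult ac_simps)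
  also have "\<dots> = (\<integral>\<^sup>+w. (\<Sum>j\<in>E. q (\<lambda>l. Y l w) j * \<Phi> (\<lambda>l. Y l w) j) \<partial>M)"
    by (intro nn_integral_cong sum.cong refl) (simp add: one \<Phi>r qq)
  finally show ?thesis
    unfolding Y_def q_def .
qed

end

end

subsection \<open>The state after each decision\<close>

text \<open>
  A state consists of the time of the last arrival, the regime just before it, and the residual
  departure times of the tasks in system just after the decision.
\<close>

type_synonym state = "real \<times> nat \<times> real list"

abbreviation state_space :: "state measure" where
  "state_space \<equiv> borel \<Otimes>\<^sub>M (count_space UNIV \<Otimes>\<^sub>M list_space)"

text \<open>The service time b is consumed whether or not the task is escalated, as in
  \<open>departures\<close>, so the index of the service time at each stage is
  deterministic.\<close>

definition next_state ::
  "nat \<Rightarrow> policy \<Rightarrow> state \<Rightarrow> real \<Rightarrow> real \<Rightarrow> real \<Rightarrow> nat \<Rightarrow> state" where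
  "next_state m u z g x b j =
     (fst z + g, j,
      let r = residual g (snd (snd z)) in if u (length r) j x = 1 then admit m r 0 b else r)"

primrec run :: "nat \<Rightarrow> policy \<Rightarrow> state \<Rightarrow> (nat \<Rightarrow> real) \<Rightarrow> (nat \<Rightarrow> real) \<Rightarrow> (nat \<Rightarrow> real) \<Rightarrow> (nat \<Rightarrow> nat)
    \<Rightarrow> nat \<Rightarrow> state" where
  "run m u z g x b a 0 = z"
| "run m u z g x b a (Suc k) = next_state m u (run m u z g x b a k) (g k) (x k) (b k) (a k)"

lemma run_cong:
  assumes "\<And>l. l < k \<Longrightarrow> a l = a' l"
  shows "run m u z g x b a k = run m u z g x b a' k"
  using assms by (induction k) auto

lemma run_regime: "fst (snd (run m u z g x b a k)) = case_nat (fst (snd z)) a k"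
  by (cases k) (auto simp: next_state_def)

lemma measurable_policy:
  fixes u :: policy
  assumes u: "\<And>q j. u q j \<in> measurable borel (count_space UNIV)"
    and [measurable]: "n \<in> measurable N (count_space UNIV)" "j \<in> measurable N (count_space UNIV)"
      "x \<in> borel_measurable N"
  shows "(\<lambda>w. u (n w) (j w) (x w) :: nat) \<in> measurable N (count_space UNIV)"
proof -
  have 1: "(\<lambda>w. u q i (x w)) \<in> measurable N (count_space UNIV)" for q i
    by (rule measurable_compose[OF assms(4) u])
  have 2: "(\<lambda>w. u q (j w) (x w)) \<in> measurable N (count_space UNIV)" for q
    by (rule measurable_compose_countable[where f="\<lambda>i w. u q i (x w)", OF 1 assms(3)])
  show ?thesis
    by (rule measurable_compose_countable[where f="\<lambda>q w. u q (j w) (x w)", OF 2 assms(2)])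
qed

lemma measurable_next_state:
  assumes m: "1 \<le> m" and u: "\<And>q j. u q j \<in> measurable borel (count_space UNIV)"
    and [measurable]: "z \<in> measurable N state_space" "g \<in> borel_measurable N" "x \<in> borel_measurable N"
      "b \<in> borel_measurable N" "j \<in> measurable N (count_space UNIV)"
  shows "(\<lambda>w. next_state m u (z w) (g w) (x w) (b w) (j w)) \<in> measurable N state_space"
proof -
  note [measurable] = measurable_admit[OF m] measurable_policy[of u, OF u]
  show ?thesis
    unfolding next_state_def Let_def by measurable
qed

lemma measurable_run:
  assumes m: "1 \<le> m" and u: "\<And>q j. u q j \<in> measurable borel (count_space UNIV)"
    and z: "z \<in> measurable N state_space"
    and "\<And>l. l < k \<Longrightarrow> (\<lambda>w. g w l) \<in> borel_measurable N" "\<And>l. l < k \<Longrightarrow> (\<lambda>w. x w l) \<in> borel_measurable N"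
      "\<And>l. l < k \<Longrightarrow> (\<lambda>w. b w l) \<in> borel_measurable N"
      "\<And>l. l < k \<Longrightarrow> (\<lambda>w. a w l) \<in> measurable N (count_space UNIV)"
  shows "(\<lambda>w. run m u (z w) (g w) (x w) (b w) (a w) k) \<in> measurable N state_space"
  using assms(4-) z
proof (induction k)
  case (Suc k)
  then show ?case
    unfolding run.simps by (intro measurable_next_state[OF m u]) auto
qed simp

subsection \<open>Independence of the primitive data\<close>

text \<open>The indices of the independent blocks of data: gaps replace arrival times, which are
  dependent, and the whole regime process is a single block.\<close>

datatype primitive = PGap nat | PScore nat | PService nat | PChain

primrec primitive_source :: "primitive \<Rightarrow> source" where
  "primitive_source (PGap n) = Arrivals"
| "primitive_source (PScore n) = Scores"
| "primitive_source (PService n) = Services"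
| "primitive_source PChain = Regime"

definition primitive_events :: "'w hybrid_model \<Rightarrow> nat \<Rightarrow> primitive \<Rightarrow> 'w set set" where
  "primitive_events M i c = (case c of
      PGap n \<Rightarrow> {gap (arr_time M) n -` A \<inter> space (law M i) | A. A \<in> sets borel}
    | PScore n \<Rightarrow> {score M n -` A \<inter> space (law M i) | A. A \<in> sets borel}
    | PService n \<Rightarrow> {srv_time M n -` A \<inter> space (law M i) | A. A \<in> sets borel}
    | PChain \<Rightarrow> source_events M i Regime)"

definition primitive_algebra :: "'w hybrid_model \<Rightarrow> nat \<Rightarrow> primitive set \<Rightarrow> 'w measure" where
  "primitive_algebra M i I = sigma (space (law M i)) (\<Union>c\<in>I. primitive_events M i c)"

lemma Int_stable_vimage: "Int_stable {f -` A \<inter> S | A. A \<in> sets N}"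
proof (rule Int_stableI)
  fix B C assume "B \<in> {f -` A \<inter> S | A. A \<in> sets N}" "C \<in> {f -` A \<inter> S | A. A \<in> sets N}"
  then obtain A A' where "B = f -` A \<inter> S" "C = f -` A' \<inter> S" "A \<in> sets N" "A' \<in> sets N" by auto
  then show "B \<inter> C \<in> {f -` A \<inter> S | A. A \<in> sets N}"
    by (intro CollectI exI[of _ "A \<inter> A'"]) auto
qed

lemma sigma_algebra_generated_events: "sigma_algebra (space P) (generated_events P N X I)"
  unfolding generated_events_def by (rule sigma_algebra_sigma_sets) auto

lemma sets_sigma_generated_events:
  "sets (sigma (space P) (generated_events P N X I)) = generated_events P N X I"
  using sigma_algebra.sets_measure_of_eq[OF sigma_algebra_generated_events] .

lemma (in prob_space) indep_sets_reindex:
  assumes "inj f" and ind: "indep_sets (\<lambda>n. F (f n)) UNIV"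
  shows "indep_sets F (range f)"
proof (rule indep_setsI)
  show "F i \<subseteq> events" if "i \<in> range f" for i
    using ind that by (auto simp: indep_sets_def)
next
  fix A K assume K: "K \<noteq> {}" "K \<subseteq> range f" "finite K" and A: "\<forall>j\<in>K. A j \<in> F j"
  define L where "L = f -` K"
  have KL: "K = f ` L" using K by (auto simp: L_def)
  have "finite L" unfolding L_def using \<open>inj f\<close> K by (intro finite_vimageI)
  then have "prob (\<Inter>l\<in>L. A (f l)) = (\<Prod>l\<in>L. prob (A (f l)))"
    using KL K A by (intro indep_setsD[OF ind]) auto
  then show "prob (\<Inter>j\<in>K. A j) = (\<Prod>j\<in>K. prob (A j))"
    unfolding KL using \<open>inj f\<close> by (simp add: prod.reindex inj_on_def)
qed

context hybrid_control
begin

lemma finite_regimes [simp]: "finite (regimes M)"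
  by (simp add: regimes_def)

context
  fixes i :: nat
  assumes i: "i \<in> regimes M"
begin

interpretation prob_space "law M i"
  by (rule prob_space_law[OF i])

lemma gap_indep: "indep_vars (\<lambda>_. borel) (gap (arr_time M)) UNIV"
  and gap_distributed: "distributed (law M i) lborel (gap (arr_time M) n) (exponential_density (arr_rate M))"
  using arrivals[OF i] by (auto simp: poisson_arrivals_def iid_def)

lemma score_indep: "indep_vars (\<lambda>_. borel) (score M) UNIV"
  and score_distributed: "distributed (law M i) lborel (score M n) (\<lambda>s. score_density M s * indicator {0..1} s)"
  using scores[OF i] by (auto simp: iid_def)

lemma service_indep: "indep_vars (\<lambda>_. borel) (srv_time M) UNIV"
  and service_distributed: "distributed (law M i) lborel (srv_time M n) (exponential_density (srv_rate M))"
  using services[OF i] by (auto simp: iid_def)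

lemma primitive_events_sub: "primitive_events M i c \<subseteq> source_events M i (primitive_source c)"
proof -
  have *: "X n -` A \<inter> space (law M i) \<in> generated_events (law M i) N X UNIV" if "A \<in> sets N" for X n A N
    unfolding generated_events_def using that by (intro sigma_sets.Basic) auto
  have gap: "gap (arr_time M) n -` A \<inter> space (law M i) \<in> generated_events (law M i) borel (arr_time M) UNIV"
    if "A \<in> sets borel" for n A
  proof -
    let ?S = "sigma (space (law M i)) (generated_events (law M i) borel (arr_time M) UNIV)"
    have "generated_events (law M i) borel (arr_time M) UNIV \<subseteq> Pow (space (law M i))"
      unfolding generated_events_def
      by (intro subsetI PowI sigma_sets_into_sp[of _ "space (law M i)"]) auto
    then have sp: "space ?S = space (law M i)" by simp
    have [measurable]: "arr_time M n \<in> borel_measurable ?S" for n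
      by (rule measurableI) (simp_all add: sets_sigma_generated_events sp *)
    have "gap (arr_time M) n \<in> borel_measurable ?S"
      by (cases n) (simp_all add: gap.simps[abs_def] cong: measurable_cong)
    from measurable_sets[OF this that] show ?thesis
      by (simp add: sets_sigma_generated_events sp)
  qed
  show ?thesis
    by (cases c) (auto simp: primitive_events_def source_events_def intro!: * gap)
qed

lemma primitive_Int_stable: "Int_stable (primitive_events M i c)"
proof (cases c)
  case PChain
  interpret sigma_algebra "space (law M i)" "source_events M i Regime"
    by (simp add: source_events_def sigma_algebra_generated_events)
  show ?thesis
    using PChain by (auto simp: primitive_events_def Int_stable_def)
qed (simp_all add: primitive_events_def Int_stable_vimage)

text \<open>Independence across sources is combined with independence of the sequence inside each
  source; the regime contributes one block, for which nothing is left to show.\<close>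

lemma primitives_indep: "indep_sets (primitive_events M i) UNIV"
proof (rule indep_sets_refine[OF independence[OF i]])
  show "sigma_algebra (space (law M i)) (source_events M i c)" for c
    by (cases c) (simp_all add: source_events_def sigma_algebra_generated_events)
  show "primitive_events M i c \<subseteq> source_events M i (primitive_source c)" for c
    by (rule primitive_events_sub)
  show "indep_sets (primitive_events M i) {c. primitive_source c = s}" for s
  proof (cases s)
    case Arrivals
    have "primitive_source c = s \<Longrightarrow> c \<in> range PGap" for c
      using Arrivals by (cases c) auto
    then have "{c. primitive_source c = s} = range PGap"
      using Arrivals by auto
    then show ?thesis
      using gap_indep by (auto simp: indep_vars_def2 primitive_events_def inj_def intro!: indep_sets_reindex)
  next
    case Scores
    have "primitive_source c = s \<Longrightarrow> c \<in> range PScore" for c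
      using Scores by (cases c) auto
    then have "{c. primitive_source c = s} = range PScore"
      using Scores by auto
    then show ?thesis
      using score_indep by (auto simp: indep_vars_def2 primitive_events_def inj_def intro!: indep_sets_reindex)
  next
    case Services
    have "primitive_source c = s \<Longrightarrow> c \<in> range PService" for c
      using Services by (cases c) auto
    then have "{c. primitive_source c = s} = range PService"
      using Services by auto
    then show ?thesis
      using service_indep by (auto simp: indep_vars_def2 primitive_events_def inj_def intro!: indep_sets_reindex)
  next
    case Regime
    have "primitive_source c = s \<Longrightarrow> c = PChain" for c
      using Regime by (cases c) auto
    then have eq: "{c. primitive_source c = s} = {PChain}"
      using Regime by auto
    have "primitive_events M i PChain \<subseteq> events"
      using independence[OF i] by (auto simp: indep_sets_def primitive_events_def)
    then show ?thesis
      unfolding eq by (auto simp: indep_sets_def subset_singleton_iff)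
  qed
qed

lemma primitive_events_Pow: "(\<Union>c\<in>I. primitive_events M i c) \<subseteq> Pow (space (law M i))"
proof -
  have "primitive_events M i c \<subseteq> events" for c
    using primitives_indep by (simp add: indep_sets_def)
  then show ?thesis
    using sets.sets_into_space by blast
qed

lemma space_primitive_algebra [simp]: "space (primitive_algebra M i I) = space (law M i)"
  unfolding primitive_algebra_def using primitive_events_Pow by (simp add: space_measure_of)

lemma sets_primitive_algebra:
  "sets (primitive_algebra M i I) = sigma_sets (space (law M i)) (\<Union>c\<in>I. primitive_events M i c)"
  unfolding primitive_algebra_def using primitive_events_Pow by (simp add: sets_measure_of)

lemma primitive_algebra_events: "sets (primitive_algebra M i I) \<subseteq> events"
  unfolding sets_primitive_algebra using primitives_indep
  by (intro sets.sigma_sets_subset) (auto simp: indep_sets_def)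

lemma measurable_from_primitive_algebra:
  "f \<in> measurable (primitive_algebra M i I) N \<Longrightarrow> f \<in> measurable (law M i) N"
  using primitive_algebra_events by (auto simp: measurable_def)

lemma measurable_primitive:
  fixes Y :: "'w \<Rightarrow> real"
  assumes "c \<in> I" "primitive_events M i c = {Y -` A \<inter> space (law M i) | A. A \<in> sets borel}"
  shows "Y \<in> borel_measurable (primitive_algebra M i I)"
proof (rule measurableI)
  fix A :: "real set" assume "A \<in> sets borel"
  then have "Y -` A \<inter> space (law M i) \<in> primitive_events M i c"
    unfolding assms(2) by blast
  with assms(1) show "Y -` A \<inter> space (primitive_algebra M i I) \<in> sets (primitive_algebra M i I)"
    by (auto simp: sets_primitive_algebra intro!: sigma_sets.Basic)
qed simp

lemma measurable_gap: "PGap n \<in> I \<Longrightarrow> gap (arr_time M) n \<in> borel_measurable (primitive_algebra M i I)"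
  and measurable_score: "PScore n \<in> I \<Longrightarrow> score M n \<in> borel_measurable (primitive_algebra M i I)"
  and measurable_service: "PService n \<in> I \<Longrightarrow> srv_time M n \<in> borel_measurable (primitive_algebra M i I)"
  by (rule measurable_primitive, assumption, simp add: primitive_events_def)+

lemma measurable_regime:
  assumes "PChain \<in> I" "0 \<le> t"
  shows "regime M t \<in> measurable (primitive_algebra M i I) (count_space UNIV)"
proof (rule measurableI)
  fix A :: "nat set"
  have "regime M t -` A \<inter> space (law M i) \<in> primitive_events M i PChain"
    using assms(2)
    by (auto simp: primitive_events_def source_events_def generated_events_def intro!: sigma_sets.Basic)
  then show "regime M t -` A \<inter> space (primitive_algebra M i I) \<in> sets (primitive_algebra M i I)"
    using assms(1) by (auto simp: sets_primitive_algebra intro!: sigma_sets.Basic)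
qed simp

lemma nn_integral_primitive_diagonal:
  assumes "I \<inter> I' = {}"
    and "F \<in> borel_measurable (primitive_algebra M i I \<Otimes>\<^sub>M primitive_algebra M i I')"
  shows "(\<integral>\<^sup>+w. F (w, w) \<partial>law M i) = (\<integral>\<^sup>+w. \<integral>\<^sup>+v. F (w, v) \<partial>law M i \<partial>law M i)"
  using assms(2)
  by (intro nn_integral_diagonal[of "primitive_algebra M i I" "primitive_algebra M i I'"])
    (simp_all add: sets_primitive_algebra indep_set_disjoint_index[OF primitives_indep primitive_Int_stable assms(1)])

text \<open>Freezes the data in I and integrates the one primitive c against its law. Every gap,
  score and service time that a stage consumes is averaged in this way.\<close>

lemma nn_integral_fresh:
  assumes c: "c \<notin> I" and Y: "Y \<in> borel_measurable (primitive_algebra M i {c})"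
    and D: "distr (law M i) borel Y = D"
    and F: "case_prod F \<in> borel_measurable (primitive_algebra M i I \<Otimes>\<^sub>M borel)"
  shows "(\<integral>\<^sup>+w. F w (Y w) \<partial>law M i) = (\<integral>\<^sup>+w. \<integral>\<^sup>+y. F w y \<partial>D \<partial>law M i)"
proof -
  have F': "(\<lambda>(w, v). F w (Y v)) \<in> borel_measurable (primitive_algebra M i I \<Otimes>\<^sub>M primitive_algebra M i {c})"
  proof -
    have "(\<lambda>x. (fst x, Y (snd x))) \<in> measurable (primitive_algebra M i I \<Otimes>\<^sub>M primitive_algebra M i {c})
        (primitive_algebra M i I \<Otimes>\<^sub>M borel)"
      using Y by measurable
    from measurable_compose[OF this F] show ?thesis
      by (simp add: split_beta')
  qed
  have "(\<integral>\<^sup>+w. F w (Y w) \<partial>law M i) = (\<integral>\<^sup>+w. \<integral>\<^sup>+v. F w (Y v) \<partial>law M i \<partial>law M i)"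
    using nn_integral_primitive_diagonal[of I "{c}" "\<lambda>(w, v). F w (Y v)"] c F' by simp
  also have "\<dots> = (\<integral>\<^sup>+w. \<integral>\<^sup>+y. F w y \<partial>D \<partial>law M i)"
  proof (intro nn_integral_cong)
    fix w assume w: "w \<in> space (law M i)"
    have "F w \<in> borel_measurable borel"
      using measurable_compose[OF measurable_Pair1' F, of w] w by simp
    then show "(\<integral>\<^sup>+v. F w (Y v) \<partial>law M i) = (\<integral>\<^sup>+y. F w y \<partial>D)"
      unfolding D[symmetric]
      by (subst nn_integral_distr) (auto intro: measurable_from_primitive_algebra[OF Y])
  qed
  finally show ?thesis .
qed

end

end

subsection \<open>One step of the controlled chain\<close>

lemma measurable_uncurry5:
  assumes F: "(\<lambda>(z, g, x, b, j). F z g x b j) \<in> borel_measurable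
      (S \<Otimes>\<^sub>M (borel \<Otimes>\<^sub>M (borel \<Otimes>\<^sub>M (borel \<Otimes>\<^sub>M count_space UNIV))))"
    and [measurable]: "z \<in> measurable N S" "g \<in> borel_measurable N" "x \<in> borel_measurable N"
      "b \<in> borel_measurable N" "j \<in> measurable N (count_space UNIV)"
  shows "(\<lambda>w. F (z w) (g w) (x w) (b w) (j w)) \<in> borel_measurable N"
proof -
  have "(\<lambda>w. (z w, g w, x w, b w, j w)) \<in> measurable N
      (S \<Otimes>\<^sub>M (borel \<Otimes>\<^sub>M (borel \<Otimes>\<^sub>M (borel \<Otimes>\<^sub>M count_space UNIV))))"
    by measurable
  from measurable_compose[OF this F] show ?thesis by simp
qed

lemma measurable_nat2:
  fixes f :: "nat \<Rightarrow> nat \<Rightarrow> 'b"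
  assumes [measurable]: "n \<in> measurable N (count_space UNIV)" "j \<in> measurable N (count_space UNIV)"
    and f: "\<And>n j. f n j \<in> space S"
  shows "(\<lambda>w. f (n w) (j w)) \<in> measurable N S"
proof -
  have 1: "(\<lambda>w. f n (j w)) \<in> measurable N S" for n
    by (rule measurable_compose[OF assms(2)]) (use f in simp)
  show ?thesis
    by (rule measurable_compose_countable[where f="\<lambda>n w. f n (j w)", OF 1 assms(1)])
qed

lemma measurable_transition_regime:
  assumes E: "finite E"
    and t [measurable]: "t \<in> borel_measurable N" and i [measurable]: "i \<in> measurable N (count_space UNIV)"
  shows "(\<lambda>w. transition E Q (t w) (i w) j) \<in> borel_measurable N"
  by (rule measurable_compose_countable[where f="\<lambda>i w. transition E Q (t w) i j",
        OF measurable_transition[OF E t] i])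

lemma arr_time_gap: "T n w = (\<Sum>l\<le>n. gap T l w)"
  by (induction n) auto

lemma arr_time_Suc_gap: "gap T k w = T k w - case_nat 0 (\<lambda>l. T l w) k"
  by (cases k) auto

context hybrid_control
begin

text \<open>
  Policies and costs are only measurable for scores in the unit interval and actual regimes; outside
  they are replaced by measurable dummies.
\<close>

definition clipped :: "policy \<Rightarrow> policy" where
  "clipped u q j x = (if j \<in> regimes M then u q j (max 0 (min 1 x)) else 0)"

definition clipped_cost :: "real \<Rightarrow> nat \<Rightarrow> real" where
  "clipped_cost x j = (if j \<in> regimes M then auto_cost M (max 0 (min 1 x)) j else 0)"

definition score_law :: "real measure" where
  "score_law = density lborel (\<lambda>s. ennreal (score_density M s * indicator {0..1} s))"

lemma sets_score_law [simp, measurable_cong]: "sets score_law = sets borel"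
  and space_score_law [simp]: "space score_law = UNIV"
  by (simp_all add: score_law_def)

lemma measurable_clipped:
  assumes u: "u \<in> policies M"
  shows "clipped u q j \<in> measurable borel (count_space UNIV)"
proof (cases "j \<in> regimes M")
  case True
  have "(\<lambda>x::real. max 0 (min 1 x)) \<in> measurable borel (restrict_space borel {0..1})"
    by (rule measurable_restrict_space2) auto
  moreover have "u q j \<in> measurable (restrict_space borel {0..1}) (count_space {0, 1})"
    using u True by (auto simp: policies_def)
  ultimately have "(\<lambda>x. u q j (max 0 (min 1 x))) \<in> measurable borel (count_space {0, 1})"
    by (rule measurable_compose)
  from measurable_compose[OF this, of "\<lambda>x. x" "count_space UNIV"] True show ?thesis
    by (simp add: clipped_def[abs_def])
qed (simp add: clipped_def[abs_def])

lemma measurable_clipped_cost: "(\<lambda>x. clipped_cost x j) \<in> borel_measurable borel"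
proof (cases "j \<in> regimes M")
  case True
  have "continuous_on UNIV (\<lambda>x. auto_cost M (max 0 (min 1 x)) j)"
    by (rule continuous_on_compose2[OF auto_cost_continuous[OF True]]) (auto intro!: continuous_intros)
  then show ?thesis
    using True by (simp add: clipped_cost_def borel_measurable_continuous_onI)
qed (simp add: clipped_cost_def)

lemma measurable_clipped_cost' [measurable (raw)]:
  assumes [measurable]: "x \<in> borel_measurable N" "j \<in> measurable N (count_space UNIV)"
  shows "(\<lambda>w. clipped_cost (x w) (j w)) \<in> borel_measurable N"
  by (rule measurable_compose_countable[where f="\<lambda>j w. clipped_cost (x w) j",
        OF measurable_compose[OF assms(1) measurable_clipped_cost] assms(2)])

section \<open>The path of states and its one-step law\<close>

context
  fixes i :: nat
  assumes i: "i \<in> regimes M"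
begin

interpretation prob_space "law M i"
  by (rule prob_space_law[OF i])

lemma distr_gap: "distr (law M i) borel (gap (arr_time M) n) = exp_law (arr_rate M)"
  using distributed_distr_eq_density[OF gap_distributed[OF i]]
  by (simp add: exp_law_def cong: distr_cong)

lemma distr_service: "distr (law M i) borel (srv_time M n) = exp_law (srv_rate M)"
  using distributed_distr_eq_density[OF service_distributed[OF i]]
  by (simp add: exp_law_def cong: distr_cong)

lemma distr_score: "distr (law M i) borel (score M n) = score_law"
  using distributed_distr_eq_density[OF score_distributed[OF i]]
  by (simp add: score_law_def cong: distr_cong)

lemma gap_random [measurable]: "gap (arr_time M) n \<in> borel_measurable (law M i)"
  and score_random [measurable]: "score M n \<in> borel_measurable (law M i)"
  and service_random [measurable]: "srv_time M n \<in> borel_measurable (law M i)"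
  using distributed_measurable[OF gap_distributed[OF i]] distributed_measurable[OF score_distributed[OF i]]
    distributed_measurable[OF service_distributed[OF i]] by simp_all

lemma prob_space_score_law: "prob_space score_law"
  unfolding distr_score[of 0, symmetric] by (rule prob_space_distr) simp

lemma AE_gap_pos: "AE w in law M i. \<forall>n. 0 < gap (arr_time M) n w"
proof -
  have "AE w in law M i. 0 < gap (arr_time M) n w" for n
    using AE_exp_law_pos[of "arr_rate M"] unfolding distr_gap[of n, symmetric]
    by (subst (asm) AE_distr_iff) simp_all
  then show ?thesis by (simp add: AE_all_countable)
qed

lemma AE_service_nonneg: "AE w in law M i. \<forall>n. 0 \<le> srv_time M n w"
proof -
  have "AE w in law M i. 0 \<le> srv_time M n w" for n
    using AE_exp_law_nonneg[of "srv_rate M"] unfolding distr_service[of n, symmetric]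
    by (subst (asm) AE_distr_iff) simp_all
  then show ?thesis by (simp add: AE_all_countable)
qed

text \<open>
  The sample point \<open>w\<close> drives arrivals, scores and services and \<open>v\<close> drives the regime, so that the
  regime can be integrated out with everything else frozen. The process itself is the diagonal.
\<close>

definition path :: "policy \<Rightarrow> nat \<Rightarrow> 'w \<Rightarrow> 'w \<Rightarrow> nat \<Rightarrow> state" where
  "path u q w v k = run (servers M) (clipped u) (0, i, initial_departures M w q)
     (\<lambda>l. gap (arr_time M) l w) (\<lambda>l. score M l w) (\<lambda>l. srv_time M (q + l) w)
     (\<lambda>l. left_value (regime M) i (arr_time M l w) v) k"

text \<open>What a path reads before stage k, apart from the regime; the first q service times
  belong to the initial tasks.\<close>

definition past :: "nat \<Rightarrow> nat \<Rightarrow> primitive set" where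
  "past q k = PGap ` {..<k} \<union> PScore ` {..<k} \<union> PService ` {..<q + k}"

lemma measurable_initial_departures:
  assumes f: "f \<in> measurable N (primitive_algebra M i I)" and I: "PService ` {..<q} \<subseteq> I"
  shows "(\<lambda>x. initial_departures M (f x) q) \<in> measurable N list_space"
  using I
proof (induction q)
  case (Suc q)
  then have "(\<lambda>x. srv_time M q (f x)) \<in> borel_measurable N"
    by (intro measurable_compose[OF f measurable_service[OF i]]) auto
  moreover have "(\<lambda>x. initial_departures M (f x) q) \<in> measurable N list_space"
    using Suc.prems by (intro Suc.IH) (auto simp: lessThan_Suc)
  ultimately show ?case
    by (simp add: measurable_admit[OF servers_pos])
qed simp

lemma measurable_arr_time:
  assumes f: "f \<in> measurable N (primitive_algebra M i I)" and I: "PGap ` {..n} \<subseteq> I"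
  shows "(\<lambda>x. arr_time M n (f x)) \<in> borel_measurable N"
proof -
  have "(\<lambda>x. gap (arr_time M) l (f x)) \<in> borel_measurable N" if "l \<le> n" for l
    by (rule measurable_compose[OF f measurable_gap[OF i]]) (use I that in auto)
  then have "(\<lambda>x. \<Sum>l\<le>n. gap (arr_time M) l (f x)) \<in> borel_measurable N"
    by (intro borel_measurable_sum) simp
  then show ?thesis
    by (simp only: arr_time_gap[of "arr_time M" n])
qed

lemma measurable_mark:
  assumes t: "t \<in> borel_measurable N" and f: "f \<in> measurable N (primitive_algebra M i I)" and I: "PChain \<in> I"
  shows "(\<lambda>x. left_value (regime M) i (t x) (f x)) \<in> measurable N (count_space UNIV)"
proof -
  have "(\<lambda>(t, w). left_value (regime M) i t w)
      \<in> measurable (borel \<Otimes>\<^sub>M primitive_algebra M i I) (count_space UNIV)"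
    by (rule measurable_left_value[OF regime_chain[OF i] finite_regimes i])
      (auto intro: measurable_regime[OF i I] simp: i)
  moreover have "(\<lambda>x. (t x, f x)) \<in> measurable N (borel \<Otimes>\<^sub>M primitive_algebra M i I)"
    using t f by measurable
  ultimately have "(\<lambda>x. case (t x, f x) of (t, w) \<Rightarrow> left_value (regime M) i t w) \<in> measurable N (count_space UNIV)"
    by (rule measurable_compose[rotated])
  then show ?thesis by simp
qed

lemma measurable_path:
  assumes u: "u \<in> policies M"
    and f: "f \<in> measurable N (primitive_algebra M i I)" and I: "past q k \<subseteq> I"
    and h: "h \<in> measurable N (primitive_algebra M i I')" and I': "PChain \<in> I'"
  shows "(\<lambda>x. path u q (f x) (h x) k) \<in> measurable N state_space"
  unfolding path_def
proof (rule measurable_run[OF servers_pos measurable_clipped[OF u]])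
  have "(\<lambda>x. initial_departures M (f x) q) \<in> measurable N list_space"
    using I by (intro measurable_initial_departures[OF f]) (auto simp: past_def)
  then show "(\<lambda>x. (0, i, initial_departures M (f x) q)) \<in> measurable N state_space"
    by measurable
  fix l assume l: "l < k"
  show "(\<lambda>x. gap (arr_time M) l (f x)) \<in> borel_measurable N"
    using I l by (intro measurable_compose[OF f measurable_gap[OF i]]) (auto simp: past_def)
  show "(\<lambda>x. score M l (f x)) \<in> borel_measurable N"
    using I l by (intro measurable_compose[OF f measurable_score[OF i]]) (auto simp: past_def)
  show "(\<lambda>x. srv_time M (q + l) (f x)) \<in> borel_measurable N"
    using I l by (intro measurable_compose[OF f measurable_service[OF i]]) (auto simp: past_def)
  show "(\<lambda>x. left_value (regime M) i (arr_time M l (f x)) (h x)) \<in> measurable N (count_space UNIV)"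
    using I l by (intro measurable_mark[OF measurable_arr_time[OF f] h I']) (auto simp: past_def)
qed

text \<open>Off the diagonal, w fixes a strictly increasing sequence of arrival times once its gaps
  are positive, and \<open>left_value_markov\<close> averages over the regime copy v alone.
  Independence leads from the diagonal to two copies and back.\<close>

lemma path_regime_step:
  assumes u: "u \<in> policies M"
    and F: "(\<lambda>(z, g, x, b, j). F z g x b j) \<in> borel_measurable
      (state_space \<Otimes>\<^sub>M (borel \<Otimes>\<^sub>M (borel \<Otimes>\<^sub>M (borel \<Otimes>\<^sub>M count_space UNIV))))"
  shows "(\<integral>\<^sup>+w. F (path u q w w k) (gap (arr_time M) k w) (score M k w) (srv_time M (q + k) w)
            (left_value (regime M) i (arr_time M k w) w) \<partial>law M i) =
    (\<integral>\<^sup>+w. (\<Sum>j\<in>regimes M. ennreal (transition (regimes M) (gen M) (gap (arr_time M) k w)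
                  (fst (snd (path u q w w k))) j) *
            F (path u q w w k) (gap (arr_time M) k w) (score M k w) (srv_time M (q + k) w) j) \<partial>law M i)"
proof -
  let ?N1 = "primitive_algebra M i (- {PChain})" and ?N2 = "primitive_algebra M i {PChain}"
  let ?E = "regimes M"
  define p where "p g z j = ennreal (transition ?E (gen M) g (fst (snd z)) j)" for g and z :: state and j
  define A where "A w v = F (path u q w v k) (gap (arr_time M) k w) (score M k w) (srv_time M (q + k) w)
      (left_value (regime M) i (arr_time M k w) v)" for w v
  define B where "B w v = (\<Sum>j\<in>?E. p (gap (arr_time M) k w) (path u q w v k) j *
      F (path u q w v k) (gap (arr_time M) k w) (score M k w) (srv_time M (q + k) w) j)" for w v
  have [measurable]: "(\<lambda>x. path u q (fst x) (snd x) k) \<in> measurable (?N1 \<Otimes>\<^sub>M ?N2) state_space"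
    by (rule measurable_path[OF u measurable_fst _ measurable_snd]) (auto simp: past_def)
  have [measurable]: "(\<lambda>x. gap (arr_time M) k (fst x)) \<in> borel_measurable (?N1 \<Otimes>\<^sub>M ?N2)"
    "(\<lambda>x. score M k (fst x)) \<in> borel_measurable (?N1 \<Otimes>\<^sub>M ?N2)"
    "(\<lambda>x. srv_time M (q + k) (fst x)) \<in> borel_measurable (?N1 \<Otimes>\<^sub>M ?N2)"
    by (auto intro!: measurable_compose[OF measurable_fst measurable_gap[OF i]]
        measurable_compose[OF measurable_fst measurable_score[OF i]]
        measurable_compose[OF measurable_fst measurable_service[OF i]])
  have [measurable]: "(\<lambda>x. left_value (regime M) i (arr_time M k (fst x)) (snd x))
      \<in> measurable (?N1 \<Otimes>\<^sub>M ?N2) (count_space UNIV)"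
    by (intro measurable_mark[OF measurable_arr_time[OF measurable_fst] measurable_snd]) auto
  have A: "(\<lambda>x. A (fst x) (snd x)) \<in> borel_measurable (?N1 \<Otimes>\<^sub>M ?N2)"
    unfolding A_def by (intro measurable_uncurry5[OF F]) measurable
  have B: "(\<lambda>x. B (fst x) (snd x)) \<in> borel_measurable (?N1 \<Otimes>\<^sub>M ?N2)"
    unfolding B_def p_def
    by (intro borel_measurable_sum borel_measurable_times_ennreal measurable_compose[OF _ measurable_ennreal]
        measurable_uncurry5[OF F] measurable_transition_regime) measurable
  have AB: "(\<integral>\<^sup>+v. A w v \<partial>law M i) = (\<integral>\<^sup>+v. B w v \<partial>law M i)"
    if pos: "\<forall>n. 0 < gap (arr_time M) n w" for w
  proof -
    define t where "t l = arr_time M l w" for l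
    have t0: "0 < t 0" and t: "t l < t (Suc l)" for l
      using pos[rule_format, of 0] pos[rule_format, of "Suc l"] by (auto simp: t_def)
    define R where "R a = run (servers M) (clipped u) (0, i, initial_departures M w q)
     (\<lambda>l. gap (arr_time M) l w) (\<lambda>l. score M l w) (\<lambda>l. srv_time M (q + l) w) a k" for a
    \<comment> \<open>The path up to stage k reads only the first k marks of the regime, so this is
      a function of the history as \<open>left_value_markov\<close> requires.\<close>
    define \<Phi> where "\<Phi> a j = F (R a) (gap (arr_time M) k w) (score M k w) (srv_time M (q + k) w) j" for a j
    have "\<Phi> a j = \<Phi> b j" if "\<And>l. l < k \<Longrightarrow> a l = b l" for a b j
      unfolding \<Phi>_def R_def using run_cong[of k a b] that by simp
    note left_value_markov[OF regime_chain[OF i] finite_regimes i t0 t, of k \<Phi>, OF this]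
    moreover have "path u q w v k = R (\<lambda>l. left_value (regime M) i (t l) v)" for v
      by (simp add: path_def R_def t_def)
    moreover have "fst (snd (R a)) = case_nat i a k" for a
      unfolding R_def run_regime by (cases k) simp_all
    moreover have "gap (arr_time M) k w = t k - case_nat 0 t k"
      unfolding t_def by (rule arr_time_Suc_gap)
    ultimately show ?thesis
      by (simp add: A_def B_def p_def \<Phi>_def flip: t_def)
  qed
  have "(\<integral>\<^sup>+w. A w w \<partial>law M i) = (\<integral>\<^sup>+w. \<integral>\<^sup>+v. A w v \<partial>law M i \<partial>law M i)"
    using nn_integral_primitive_diagonal[OF i _ A] by simp
  also have "\<dots> = (\<integral>\<^sup>+w. \<integral>\<^sup>+v. B w v \<partial>law M i \<partial>law M i)"
    by (rule nn_integral_cong_AE) (use AE_gap_pos in eventually_elim, rule AB)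
  also have "\<dots> = (\<integral>\<^sup>+w. B w w \<partial>law M i)"
    using nn_integral_primitive_diagonal[OF i _ B] by simp
  finally show ?thesis
    by (simp add: A_def B_def p_def)
qed

text \<open>With the current regime gone from the integrand, the service time, score and gap of
  stage k are independent of the path. They are peeled off in this order, with I1, I2 and I3 the
  data still present.\<close>

lemma path_fresh_step:
  assumes u: "u \<in> policies M"
    and F: "(\<lambda>(z, g, x, b). F z g x b) \<in> borel_measurable
      (state_space \<Otimes>\<^sub>M (borel \<Otimes>\<^sub>M (borel \<Otimes>\<^sub>M borel)))"
  shows "(\<integral>\<^sup>+w. F (path u q w w k) (gap (arr_time M) k w) (score M k w) (srv_time M (q + k) w) \<partial>law M i) =
    (\<integral>\<^sup>+w. \<integral>\<^sup>+g. \<integral>\<^sup>+x. \<integral>\<^sup>+b. F (path u q w w k) g x b \<partial>exp_law (srv_rate M) \<partial>score_law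
       \<partial>exp_law (arr_rate M) \<partial>law M i)"
proof -
  interpret S: prob_space "exp_law (srv_rate M)" by (rule prob_space_exp_law[OF srv_rate_pos])
  interpret A: prob_space "exp_law (arr_rate M)" by (rule prob_space_exp_law[OF arr_rate_pos])
  interpret X: prob_space score_law by (rule prob_space_score_law)
  have F4: "(\<lambda>x. F (z x) (g x) (s x) (b x)) \<in> borel_measurable N"
    if [measurable]: "z \<in> measurable N state_space" "g \<in> borel_measurable N" "s \<in> borel_measurable N"
      "b \<in> borel_measurable N" for z g s b and N :: "('w \<times> real) measure"
  proof -
    have "(\<lambda>x. (z x, g x, s x, b x)) \<in> measurable N (state_space \<Otimes>\<^sub>M (borel \<Otimes>\<^sub>M (borel \<Otimes>\<^sub>M borel)))"
      by measurable
    from measurable_compose[OF this F] show ?thesis by simp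
  qed
  define F1 where "F1 = (\<lambda>(z, g, x). \<integral>\<^sup>+b. F z g x b \<partial>exp_law (srv_rate M))"
  have [measurable]: "F1 \<in> borel_measurable (state_space \<Otimes>\<^sub>M (borel \<Otimes>\<^sub>M borel))"
  proof -
    have "(\<lambda>(y, b). (\<lambda>(z, g, x, b). F z g x b) (fst y, fst (snd y), snd (snd y), b))
        \<in> borel_measurable ((state_space \<Otimes>\<^sub>M (borel \<Otimes>\<^sub>M borel)) \<Otimes>\<^sub>M exp_law (srv_rate M))"
      using F by measurable
    from S.borel_measurable_nn_integral[OF this] show ?thesis
      by (simp add: F1_def split_beta')
  qed
  define F2 where "F2 = (\<lambda>(z, g). \<integral>\<^sup>+x. F1 (z, g, x) \<partial>score_law)"
  have [measurable]: "F2 \<in> borel_measurable (state_space \<Otimes>\<^sub>M borel)"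
    unfolding F2_def by measurable
  define I1 where "I1 = insert PChain (past q k) \<union> {PGap k, PScore k}"
  define I2 where "I2 = insert PChain (past q k) \<union> {PGap k}"
  define I3 where "I3 = insert PChain (past q k)"
  have P: "(\<lambda>x. path u q (fst x) (fst x) k) \<in> measurable (primitive_algebra M i I \<Otimes>\<^sub>M borel) state_space"
    if "past q k \<subseteq> I" "PChain \<in> I" for I
    using that by (intro measurable_path[OF u measurable_fst _ measurable_fst])
  have "(\<integral>\<^sup>+w. F (path u q w w k) (gap (arr_time M) k w) (score M k w) (srv_time M (q + k) w) \<partial>law M i) =
     (\<integral>\<^sup>+w. \<integral>\<^sup>+b. F (path u q w w k) (gap (arr_time M) k w) (score M k w) b \<partial>exp_law (srv_rate M) \<partial>law M i)"
  proof (rule nn_integral_fresh[OF i _ measurable_service[OF i] distr_service])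
    show "PService (q + k) \<notin> I1"
      by (auto simp: I1_def past_def)
    show "(\<lambda>(w, b). F (path u q w w k) (gap (arr_time M) k w) (score M k w) b)
        \<in> borel_measurable (primitive_algebra M i I1 \<Otimes>\<^sub>M borel)"
      unfolding split_beta'
      by (intro F4 P measurable_compose[OF measurable_fst measurable_gap[OF i]]
          measurable_compose[OF measurable_fst measurable_score[OF i]]) (auto simp: I1_def)
  qed simp
  also have "\<dots> = (\<integral>\<^sup>+w. F1 (path u q w w k, gap (arr_time M) k w, score M k w) \<partial>law M i)"
    by (simp add: F1_def)
  also have "\<dots> = (\<integral>\<^sup>+w. \<integral>\<^sup>+x. F1 (path u q w w k, gap (arr_time M) k w, x) \<partial>score_law \<partial>law M i)"
  proof (rule nn_integral_fresh[OF i _ measurable_score[OF i] distr_score])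
    show "PScore k \<notin> I2"
      by (auto simp: I2_def past_def)
    have [measurable]: "(\<lambda>x. path u q (fst x) (fst x) k) \<in> measurable (primitive_algebra M i I2 \<Otimes>\<^sub>M borel) state_space"
      "(\<lambda>x. gap (arr_time M) k (fst x)) \<in> borel_measurable (primitive_algebra M i I2 \<Otimes>\<^sub>M borel)"
      by (intro P measurable_compose[OF measurable_fst measurable_gap[OF i]], auto simp: I2_def)+
    show "(\<lambda>(w, x). F1 (path u q w w k, gap (arr_time M) k w, x))
        \<in> borel_measurable (primitive_algebra M i I2 \<Otimes>\<^sub>M borel)"
      unfolding split_beta' by measurable
  qed simp
  also have "\<dots> = (\<integral>\<^sup>+w. F2 (path u q w w k, gap (arr_time M) k w) \<partial>law M i)"
    by (simp add: F2_def)
  also have "\<dots> = (\<integral>\<^sup>+w. \<integral>\<^sup>+g. F2 (path u q w w k, g) \<partial>exp_law (arr_rate M) \<partial>law M i)"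
  proof (rule nn_integral_fresh[OF i _ measurable_gap[OF i] distr_gap])
    show "PGap k \<notin> I3"
      by (auto simp: I3_def past_def)
    have [measurable]: "(\<lambda>x. path u q (fst x) (fst x) k) \<in> measurable (primitive_algebra M i I3 \<Otimes>\<^sub>M borel) state_space"
      by (intro P) (auto simp: I3_def)
    show "(\<lambda>(w, g). F2 (path u q w w k, g)) \<in> borel_measurable (primitive_algebra M i I3 \<Otimes>\<^sub>M borel)"
      unfolding split_beta' by measurable
  qed simp
  finally show ?thesis
    by (simp add: F1_def F2_def)
qed

text \<open>The regime is averaged first, because its transition probabilities depend on the current
  gap, which must not yet have been integrated out.\<close>

lemma path_step:
  assumes u: "u \<in> policies M"
    and F: "(\<lambda>(z, g, x, b, j). F z g x b j) \<in> borel_measurable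
      (state_space \<Otimes>\<^sub>M (borel \<Otimes>\<^sub>M (borel \<Otimes>\<^sub>M (borel \<Otimes>\<^sub>M count_space UNIV))))"
  shows "(\<integral>\<^sup>+w. F (path u q w w k) (gap (arr_time M) k w) (score M k w) (srv_time M (q + k) w)
            (left_value (regime M) i (arr_time M k w) w) \<partial>law M i) =
    (\<integral>\<^sup>+w. \<integral>\<^sup>+g. \<integral>\<^sup>+x. \<integral>\<^sup>+b. (\<Sum>j\<in>regimes M.
        ennreal (transition (regimes M) (gen M) g (fst (snd (path u q w w k))) j) * F (path u q w w k) g x b j)
       \<partial>exp_law (srv_rate M) \<partial>score_law \<partial>exp_law (arr_rate M) \<partial>law M i)"
  unfolding path_regime_step[OF u F]
proof (rule path_fresh_step[OF u])
  show "(\<lambda>(z, g, x, b). \<Sum>j\<in>regimes M. ennreal (transition (regimes M) (gen M) g (fst (snd z)) j) * F z g x b j)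
      \<in> borel_measurable (state_space \<Otimes>\<^sub>M (borel \<Otimes>\<^sub>M (borel \<Otimes>\<^sub>M borel)))"
    unfolding split_beta'
    by (intro borel_measurable_sum borel_measurable_times_ennreal measurable_compose[OF _ measurable_ennreal]
        measurable_uncurry5[OF F] measurable_transition_regime) measurable
qed

end

end

subsection \<open>The expected cost as a least fixed point\<close>

lemma sup_continuous_sum_ennreal:
  fixes f :: "'i \<Rightarrow> 'a::complete_lattice \<Rightarrow> ennreal"
  assumes "\<And>i. i \<in> I \<Longrightarrow> sup_continuous (f i)"
  shows "sup_continuous (\<lambda>x. \<Sum>i\<in>I. f i x)"
  using assms by (induction I rule: infinite_finite_induct)
    (auto intro!: sup_continuous_const sup_continuous_add_ennreal)

lemma sup_continuous_apply2: "sup_continuous (\<lambda>f :: 'a \<Rightarrow> 'b \<Rightarrow> 'c::complete_lattice. f x y)"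
  by (simp add: sup_continuous_def image_comp)

context hybrid_control
begin

text \<open>The cost up to the next arrival, discounted to the start of the stage; before that
  arrival only the departures in R change the count.\<close>

definition hold :: "real list \<Rightarrow> real \<Rightarrow> ennreal" where
  "hold R g = (\<integral>\<^sup>+r. indicator {0..<g} r *
     ennreal (exp (- disc_rate M * r) * hold_cost M (length (filter (\<lambda>d. r < d) R))) \<partial>lborel)"

definition decision :: "policy \<Rightarrow> (nat \<Rightarrow> nat \<Rightarrow> ennreal) \<Rightarrow> nat \<Rightarrow> nat \<Rightarrow> real \<Rightarrow> ennreal" where
  "decision u f k j x = (if clipped u k j x = 1 then ennreal (esc_cost M) + f (Suc k) j
     else ennreal (clipped_cost x j) + f k j)"

definition stage :: "policy \<Rightarrow> (nat \<Rightarrow> nat \<Rightarrow> ennreal) \<Rightarrow> real list \<Rightarrow> real \<Rightarrow> real \<Rightarrow> nat \<Rightarrow> ennreal" where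
  "stage u f R g x j = hold R g + ennreal (exp (- disc_rate M * g)) * decision u f (length (residual g R)) j x"

definition stage_mean :: "(real list \<Rightarrow> real \<Rightarrow> real \<Rightarrow> nat \<Rightarrow> ennreal) \<Rightarrow> nat \<Rightarrow> real list \<Rightarrow> ennreal" where
  "stage_mean S i R = (\<integral>\<^sup>+g. \<integral>\<^sup>+x. (\<Sum>j\<in>regimes M.
      ennreal (transition (regimes M) (gen M) g i j) * S R g x j) \<partial>score_law \<partial>exp_law (arr_rate M))"

abbreviation fresh :: "nat \<Rightarrow> real list measure" where
  "fresh n \<equiv> departure_law (servers M) (srv_rate M) n"

text \<open>The situation just after a decision has the same form as the initial one: so many fresh
  tasks, a known regime and a full exponential gap ahead. So one function f of queue length and
  regime serves as cost to go.\<close>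

definition policy_op :: "policy \<Rightarrow> (nat \<Rightarrow> nat \<Rightarrow> ennreal) \<Rightarrow> nat \<Rightarrow> nat \<Rightarrow> ennreal" where
  "policy_op u f q i = (\<integral>\<^sup>+R. stage_mean (stage u f) i R \<partial>fresh q)"

lemma ex_regime: "1 \<in> regimes M"
  using num_regimes_pos by (auto simp: regimes_def)

lemma prob_score_law: "prob_space score_law"
  by (rule prob_space_score_law[OF ex_regime])

lemma prob_fresh: "prob_space (fresh n)"
  by (rule prob_space_departure_law[OF servers_pos srv_rate_pos])

lemma sigma_finite_laws:
  "sigma_finite_measure score_law" "sigma_finite_measure (exp_law (arr_rate M))"
  "sigma_finite_measure (exp_law (srv_rate M))" "sigma_finite_measure (fresh n)"
  using prob_score_law prob_space_exp_law[OF arr_rate_pos] prob_space_exp_law[OF srv_rate_pos] prob_fresh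
  by (auto intro!: prob_space_imp_sigma_finite)

lemma measurable_hold [measurable (raw)]:
  assumes [measurable]: "R \<in> measurable N list_space" "g \<in> borel_measurable N"
  shows "(\<lambda>w. hold (R w) (g w)) \<in> borel_measurable N"
proof -
  have [measurable]: "(\<lambda>x. hold_cost M (length (filter (\<lambda>d. snd x < d) (R (fst x)))))
      \<in> borel_measurable (N \<Otimes>\<^sub>M lborel)"
    by (rule measurable_compose[where N="count_space UNIV"]) measurable
  have "(\<lambda>x. indicator {0..<g (fst x)} (snd x) * ennreal (exp (- disc_rate M * snd x) *
      hold_cost M (length (filter (\<lambda>d. snd x < d) (R (fst x)))))) \<in> borel_measurable (N \<Otimes>\<^sub>M lborel)"
    unfolding indicator_def atLeastLessThan_iff by measurable
  then show ?thesis
    unfolding hold_def by (intro lborel.borel_measurable_nn_integral) (simp add: split_beta')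
qed

lemma measurable_decision:
  assumes u: "u \<in> policies M"
    and [measurable]: "k \<in> measurable N (count_space UNIV)" "j \<in> measurable N (count_space UNIV)"
      "x \<in> borel_measurable N"
  shows "(\<lambda>w. decision u f (k w) (j w) (x w)) \<in> borel_measurable N"
proof -
  have [measurable]: "(\<lambda>w. clipped u (k w) (j w) (x w)) \<in> measurable N (count_space UNIV)"
    by (rule measurable_policy[OF measurable_clipped[OF u]]) measurable
  have [measurable]: "(\<lambda>w. f (Suc (k w)) (j w)) \<in> borel_measurable N" "(\<lambda>w. f (k w) (j w)) \<in> borel_measurable N"
    by (rule measurable_nat2; measurable; simp)+
  show ?thesis
    unfolding decision_def by measurable
qed

lemma measurable_stage:
  assumes u: "u \<in> policies M"
    and [measurable]: "R \<in> measurable N list_space" "g \<in> borel_measurable N"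
      "x \<in> borel_measurable N" "j \<in> measurable N (count_space UNIV)"
  shows "(\<lambda>w. stage u f (R w) (g w) (x w) (j w)) \<in> borel_measurable N"
proof -
  have [measurable]: "(\<lambda>w. decision u f (length (residual (g w) (R w))) (j w) (x w)) \<in> borel_measurable N"
    by (rule measurable_decision[OF u]) measurable
  show ?thesis
    unfolding stage_def by measurable
qed

lemma measurable_stage_mean:
  assumes u: "u \<in> policies M"
    and [measurable]: "R \<in> measurable N list_space" and i [measurable]: "i \<in> measurable N (count_space UNIV)"
  shows "(\<lambda>w. stage_mean (stage u f) (i w) (R w)) \<in> borel_measurable N"
proof -
  interpret X: sigma_finite_measure score_law by (rule sigma_finite_laws)
  interpret A: sigma_finite_measure "exp_law (arr_rate M)" by (rule sigma_finite_laws)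
  have [measurable]: "(\<lambda>y. stage u f (R (fst (fst y))) (snd (fst y)) (snd y) j)
      \<in> borel_measurable ((N \<Otimes>\<^sub>M exp_law (arr_rate M)) \<Otimes>\<^sub>M score_law)" for j
    by (rule measurable_stage[OF u]) measurable
  have [measurable]: "(\<lambda>y. transition (regimes M) (gen M) (snd (fst y)) (i (fst (fst y))) j)
      \<in> borel_measurable ((N \<Otimes>\<^sub>M exp_law (arr_rate M)) \<Otimes>\<^sub>M score_law)" for j
    by (rule measurable_transition_regime[OF finite_regimes]) measurable
  have "(\<lambda>y. \<Sum>j\<in>regimes M. ennreal (transition (regimes M) (gen M) (snd (fst y)) (i (fst (fst y))) j) *
     stage u f (R (fst (fst y))) (snd (fst y)) (snd y) j)
      \<in> borel_measurable ((N \<Otimes>\<^sub>M exp_law (arr_rate M)) \<Otimes>\<^sub>M score_law)"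
    by measurable
  then have "(\<lambda>z. \<integral>\<^sup>+x. (\<Sum>j\<in>regimes M. ennreal (transition (regimes M) (gen M) (snd z) (i (fst z)) j) *
     stage u f (R (fst z)) (snd z) x j) \<partial>score_law) \<in> borel_measurable (N \<Otimes>\<^sub>M exp_law (arr_rate M))"
    by (intro X.borel_measurable_nn_integral) (simp add: split_beta')
  then show ?thesis
    unfolding stage_mean_def by (intro A.borel_measurable_nn_integral) (simp add: split_beta')
qed

lemma sup_continuous_policy_op:
  assumes u: "u \<in> policies M"
  shows "sup_continuous (policy_op u)"
proof (intro sup_continuous_fun)
  fix q i
  interpret X: sigma_finite_measure score_law by (rule sigma_finite_laws)
  have S: "sup_continuous (\<lambda>f. stage u f R g x j)" for R g x j
    unfolding stage_def decision_def
    by (cases "clipped u (length (residual g R)) j x = 1")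
      (auto intro!: sup_continuous_add_ennreal sup_continuous_const sup_continuous_mult_left_ennreal sup_continuous_apply2)
  have [measurable]: "(\<lambda>y. stage u f R (fst y) (snd y) j) \<in> borel_measurable (exp_law (arr_rate M) \<Otimes>\<^sub>M score_law)"
    for f R j
    by (rule measurable_stage[OF u]) measurable
  have m2: "(\<lambda>y. \<Sum>j\<in>regimes M. ennreal (transition (regimes M) (gen M) (fst y) i j) * stage u f R (fst y) (snd y) j)
      \<in> borel_measurable (exp_law (arr_rate M) \<Otimes>\<^sub>M score_law)" for f R
  proof -
    have [measurable]: "(\<lambda>y. transition (regimes M) (gen M) (fst y) i j)
        \<in> borel_measurable (exp_law (arr_rate M) \<Otimes>\<^sub>M score_law)" for j
      by (rule measurable_transition[OF finite_regimes]) measurable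
    show ?thesis by measurable
  qed
  have m1: "(\<lambda>g. \<integral>\<^sup>+x. (\<Sum>j\<in>regimes M. ennreal (transition (regimes M) (gen M) g i j) * stage u f R g x j) \<partial>score_law)
      \<in> borel_measurable (exp_law (arr_rate M))" for f R
    using m2 by (intro X.borel_measurable_nn_integral) (simp add: split_beta')
  have m0: "(\<lambda>x. \<Sum>j\<in>regimes M. ennreal (transition (regimes M) (gen M) g i j) * stage u f R g x j)
      \<in> borel_measurable score_law" for f R g
    using measurable_compose[OF measurable_Pair1' m2, of g] by simp
  have "sup_continuous (\<lambda>f. stage_mean (stage u f) i R)" for R
    unfolding stage_mean_def
    by (intro sup_continuous_nn_integral sup_continuous_sum_ennreal sup_continuous_mult_left_ennreal S m0 m1)
  moreover have "(\<lambda>R. stage_mean (stage u f) i R) \<in> borel_measurable (fresh q)" for f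
    by (rule measurable_stage_mean[OF u]) measurable
  ultimately show "sup_continuous (\<lambda>f. policy_op u f q i)"
    unfolding policy_op_def by (rule sup_continuous_nn_integral)
qed

text \<open>
  \<open>mix\<close> forgets the residual times and resamples them from fresh tasks; \<open>path_mix\<close> below says that
  this does not change expectations along the path.
\<close>

definition mix :: "(state \<Rightarrow> ennreal) \<Rightarrow> state \<Rightarrow> ennreal" where
  "mix G z = (\<integral>\<^sup>+R. G (fst z, fst (snd z), R) \<partial>fresh (length (snd (snd z))))"

lemma measurable_mix:
  assumes [measurable]: "G \<in> borel_measurable state_space"
  shows "mix G \<in> borel_measurable state_space"
proof -
  have 1: "(\<lambda>z :: state. \<integral>\<^sup>+R. G (fst z, fst (snd z), R) \<partial>fresh n) \<in> borel_measurable state_space" for n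
  proof -
    interpret F: sigma_finite_measure "fresh n" by (rule sigma_finite_laws)
    show ?thesis by measurable
  qed
  have 2: "(\<lambda>z :: state. length (snd (snd z))) \<in> measurable state_space (count_space UNIV)"
    by measurable
  show ?thesis
    unfolding mix_def
    by (rule measurable_compose_countable[where
          f="\<lambda>n z. \<integral>\<^sup>+R. G (fst z, fst (snd z), R) \<partial>fresh n", OF 1 2])
qed

text \<open>Given their number, the tasks left after g are fresh. The decision depends on that
  number only, and admitting a fresh task to k fresh ones gives \<open>fresh (Suc k)\<close>, so
  resampling the list afterwards changes no expectation.\<close>

lemma fresh_next_state:
  assumes u: "u \<in> policies M" and g: "0 \<le> g" and G [measurable]: "G \<in> borel_measurable state_space"
  shows "(\<integral>\<^sup>+R. \<integral>\<^sup>+b. G (next_state (servers M) (clipped u) (s, i, R) g x b j) \<partial>exp_law (srv_rate M) \<partial>fresh n) =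
    (\<integral>\<^sup>+R. \<integral>\<^sup>+b. mix G (next_state (servers M) (clipped u) (s, i, R) g x b j) \<partial>exp_law (srv_rate M) \<partial>fresh n)"
proof -
  interpret S: prob_space "exp_law (srv_rate M)" by (rule prob_space_exp_law[OF srv_rate_pos])
  note [measurable] = measurable_admit[OF servers_pos]
  define \<psi> where "\<psi> G r = (\<integral>\<^sup>+b. G (s + g, j, if clipped u (length r) j x = 1
      then admit (servers M) r 0 b else r) \<partial>exp_law (srv_rate M))" for G :: "state \<Rightarrow> ennreal" and r
  have \<psi>_meas: "\<psi> G \<in> borel_measurable list_space" if [measurable]: "G \<in> borel_measurable state_space" for G
  proof -
    have [measurable]: "Measurable.pred (list_space \<Otimes>\<^sub>M exp_law (srv_rate M)) (\<lambda>y. clipped u (length (fst y)) j x = 1)"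
      by (rule measurable_compose[where N="count_space UNIV" and f="\<lambda>y. length (fst y)"]) measurable
    have "(\<lambda>y. G (s + g, j, if clipped u (length (fst y)) j x = 1 then admit (servers M) (fst y) 0 (snd y) else fst y))
        \<in> borel_measurable (list_space \<Otimes>\<^sub>M exp_law (srv_rate M))"
      by measurable
    then show ?thesis
      unfolding \<psi>_def[abs_def] by (intro S.borel_measurable_nn_integral) (simp add: split_beta')
  qed
  have eq: "(\<integral>\<^sup>+b. G (next_state (servers M) (clipped u) (s, i, R) g x b j) \<partial>exp_law (srv_rate M)) = \<psi> G (residual g R)"
    for G R
    by (simp add: next_state_def \<psi>_def Let_def)
  have \<psi>_mix: "(\<integral>\<^sup>+r. \<psi> G r \<partial>fresh k) = (\<integral>\<^sup>+r. \<psi> (mix G) r \<partial>fresh k)" for k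
  proof -
    interpret F: prob_space "fresh k" by (rule prob_fresh)
    note L = length_departure_law[OF servers_pos srv_rate_pos, of k]
    show ?thesis
    proof (cases "clipped u k j x = 1")
      case True
      define c where "c = (\<integral>\<^sup>+r. G (s + g, j, r) \<partial>fresh (Suc k))"
      have "(\<integral>\<^sup>+r. \<psi> G r \<partial>fresh k) =
          (\<integral>\<^sup>+r. \<integral>\<^sup>+b. G (s + g, j, admit (servers M) r 0 b) \<partial>exp_law (srv_rate M) \<partial>fresh k)"
        using L True by (intro nn_integral_cong_AE) (auto simp: \<psi>_def)
      also have "\<dots> = c"
        unfolding c_def by (subst nn_integral_departure_law_Suc[OF servers_pos srv_rate_pos]) simp_all
      finally have 1: "(\<integral>\<^sup>+r. \<psi> G r \<partial>fresh k) = c" .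
      have "(\<integral>\<^sup>+r. \<psi> (mix G) r \<partial>fresh k) = (\<integral>\<^sup>+r. \<integral>\<^sup>+b. c \<partial>exp_law (srv_rate M) \<partial>fresh k)"
        using L True by (intro nn_integral_cong_AE) (auto simp: \<psi>_def mix_def c_def admit_def)
      also have "\<dots> = c"
        using S.emeasure_space_1 F.emeasure_space_1 by simp
      finally show ?thesis using 1 by simp
    next
      case False
      define c where "c = (\<integral>\<^sup>+r. G (s + g, j, r) \<partial>fresh k)"
      have "(\<integral>\<^sup>+r. \<psi> G r \<partial>fresh k) = c"
        unfolding c_def using L False S.emeasure_space_1 by (intro nn_integral_cong_AE) (auto simp: \<psi>_def)
      moreover have "(\<integral>\<^sup>+r. \<psi> (mix G) r \<partial>fresh k) = (\<integral>\<^sup>+r. c \<partial>fresh k)"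
        using L False S.emeasure_space_1 by (intro nn_integral_cong_AE) (auto simp: \<psi>_def mix_def c_def)
      ultimately show ?thesis
        using F.emeasure_space_1 by simp
    qed
  qed
  show ?thesis
    unfolding eq departure_law_residual[OF servers_pos srv_rate_pos g \<psi>_meas[OF G]]
      departure_law_residual[OF servers_pos srv_rate_pos g \<psi>_meas[OF measurable_mix[OF G]]] \<psi>_mix ..
qed

definition step_mean :: "policy \<Rightarrow> (state \<Rightarrow> ennreal) \<Rightarrow> state \<Rightarrow> ennreal" where
  "step_mean u G z = (\<integral>\<^sup>+g. \<integral>\<^sup>+x. \<integral>\<^sup>+b. (\<Sum>j\<in>regimes M.
     ennreal (transition (regimes M) (gen M) g (fst (snd z)) j) *
     G (next_state (servers M) (clipped u) z g x b j)) \<partial>exp_law (srv_rate M) \<partial>score_law \<partial>exp_law (arr_rate M))"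

lemma step_integrand_measurable:
  assumes u: "u \<in> policies M" and G [measurable]: "G \<in> borel_measurable state_space"
    and [measurable]: "z \<in> measurable N state_space" "g \<in> borel_measurable N" "x \<in> borel_measurable N"
      "b \<in> borel_measurable N"
  shows "(\<lambda>w. \<Sum>j\<in>regimes M. ennreal (transition (regimes M) (gen M) (g w) (fst (snd (z w))) j) *
     G (next_state (servers M) (clipped u) (z w) (g w) (x w) (b w) j)) \<in> borel_measurable N"
proof -
  have [measurable]: "(\<lambda>w. next_state (servers M) (clipped u) (z w) (g w) (x w) (b w) j) \<in> measurable N state_space" for j
    by (rule measurable_next_state[OF servers_pos measurable_clipped[OF u]]) measurable
  have [measurable]: "(\<lambda>w. transition (regimes M) (gen M) (g w) (fst (snd (z w))) j) \<in> borel_measurable N" for j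
    by (rule measurable_transition_regime[OF finite_regimes]) measurable
  show ?thesis by measurable
qed

lemma step_mean_measurable:
  assumes u: "u \<in> policies M" and G: "G \<in> borel_measurable state_space"
  shows "step_mean u G \<in> borel_measurable state_space"
proof -
  interpret X: sigma_finite_measure score_law by (rule sigma_finite_laws)
  interpret A: sigma_finite_measure "exp_law (arr_rate M)" by (rule sigma_finite_laws)
  interpret S: sigma_finite_measure "exp_law (srv_rate M)" by (rule sigma_finite_laws)
  show ?thesis
    unfolding step_mean_def[abs_def]
    apply (intro A.borel_measurable_nn_integral)
    unfolding split_beta'
    apply (intro X.borel_measurable_nn_integral)
    unfolding split_beta'
    apply (intro S.borel_measurable_nn_integral)
    unfolding split_beta'
    by (rule step_integrand_measurable[OF u G]; measurable)
qed

text \<open>Fubini moves the average over the residual list inside those over gap and score, next to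
  the service time, where \<open>fresh_next_state\<close> applies for each nonnegative gap, score
  and next regime.\<close>

lemma mix_step_mean:
  assumes u: "u \<in> policies M" and G: "G \<in> borel_measurable state_space"
  shows "mix (step_mean u G) z = mix (step_mean u (mix G)) z"
proof -
  define n where "n = length (snd (snd z))"
  define s i where "s = fst z" and "i = fst (snd z)"
  interpret X: prob_space score_law by (rule prob_score_law)
  interpret A: prob_space "exp_law (arr_rate M)" by (rule prob_space_exp_law[OF arr_rate_pos])
  interpret S: prob_space "exp_law (srv_rate M)" by (rule prob_space_exp_law[OF srv_rate_pos])
  interpret F: prob_space "fresh n" by (rule prob_fresh)
  interpret FA: pair_sigma_finite "fresh n" "exp_law (arr_rate M)" ..
  interpret FX: pair_sigma_finite "fresh n" score_law ..
  let ?N = "next_state (servers M) (clipped u)"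
  let ?p = "\<lambda>g j. ennreal (transition (regimes M) (gen M) g i j)"
  have swap: "mix (step_mean u G) z = (\<integral>\<^sup>+g. \<integral>\<^sup>+x. (\<Sum>j\<in>regimes M. ?p g j *
      (\<integral>\<^sup>+R. \<integral>\<^sup>+b. G (?N (s, i, R) g x b j) \<partial>exp_law (srv_rate M) \<partial>fresh n)) \<partial>score_law \<partial>exp_law (arr_rate M))"
    if G [measurable]: "G \<in> borel_measurable state_space" for G
  proof -
    note meas = step_integrand_measurable[OF u G, where z="\<lambda>y. (s, i, r y)" for r, simplified]
    have "mix (step_mean u G) z = (\<integral>\<^sup>+R. \<integral>\<^sup>+g. \<integral>\<^sup>+x. \<integral>\<^sup>+b. (\<Sum>j\<in>regimes M. ?p g j * G (?N (s, i, R) g x b j))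
        \<partial>exp_law (srv_rate M) \<partial>score_law \<partial>exp_law (arr_rate M) \<partial>fresh n)"
      by (simp add: mix_def step_mean_def n_def s_def i_def)
    also have "\<dots> = (\<integral>\<^sup>+g. \<integral>\<^sup>+R. \<integral>\<^sup>+x. \<integral>\<^sup>+b. (\<Sum>j\<in>regimes M. ?p g j * G (?N (s, i, R) g x b j))
        \<partial>exp_law (srv_rate M) \<partial>score_law \<partial>fresh n \<partial>exp_law (arr_rate M))"
      apply (rule FA.Fubini'[symmetric])
      unfolding split_beta'
      apply (intro X.borel_measurable_nn_integral)
      unfolding split_beta'
      apply (intro S.borel_measurable_nn_integral)
      unfolding split_beta'
      by (rule meas; measurable)
    also have "\<dots> = (\<integral>\<^sup>+g. \<integral>\<^sup>+x. \<integral>\<^sup>+R. \<integral>\<^sup>+b. (\<Sum>j\<in>regimes M. ?p g j * G (?N (s, i, R) g x b j))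
        \<partial>exp_law (srv_rate M) \<partial>fresh n \<partial>score_law \<partial>exp_law (arr_rate M))"
      apply (intro nn_integral_cong)
      apply (rule FX.Fubini'[symmetric])
      unfolding split_beta'
      apply (intro S.borel_measurable_nn_integral)
      unfolding split_beta'
      by (rule meas; measurable)
    also have "\<dots> = (\<integral>\<^sup>+g. \<integral>\<^sup>+x. (\<Sum>j\<in>regimes M. ?p g j *
      (\<integral>\<^sup>+R. \<integral>\<^sup>+b. G (?N (s, i, R) g x b j) \<partial>exp_law (srv_rate M) \<partial>fresh n)) \<partial>score_law \<partial>exp_law (arr_rate M))"
    proof (intro nn_integral_cong)
      fix g x :: real
      have N2: "(\<lambda>y. G (?N (s, i, fst y) g x (snd y) j)) \<in> borel_measurable (fresh n \<Otimes>\<^sub>M exp_law (srv_rate M))" for j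
      proof -
        have "(\<lambda>y. ?N (s, i, fst y) g x (snd y) j) \<in> measurable (fresh n \<Otimes>\<^sub>M exp_law (srv_rate M)) state_space"
          by (rule measurable_next_state[OF servers_pos measurable_clipped[OF u]]) measurable
        from measurable_compose[OF this G] show ?thesis .
      qed
      have N1: "(\<lambda>b. G (?N (s, i, R) g x b j)) \<in> borel_measurable (exp_law (srv_rate M))" for R j
        using measurable_compose[OF measurable_Pair1' N2, of R] by simp
      have N3: "(\<lambda>R. \<integral>\<^sup>+b. G (?N (s, i, R) g x b j) \<partial>exp_law (srv_rate M)) \<in> borel_measurable (fresh n)" for j
        using N2 by (intro S.borel_measurable_nn_integral) (simp add: split_beta')
      show "(\<integral>\<^sup>+R. \<integral>\<^sup>+b. (\<Sum>j\<in>regimes M. ?p g j * G (?N (s, i, R) g x b j)) \<partial>exp_law (srv_rate M) \<partial>fresh n) =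
        (\<Sum>j\<in>regimes M. ?p g j * (\<integral>\<^sup>+R. \<integral>\<^sup>+b. G (?N (s, i, R) g x b j) \<partial>exp_law (srv_rate M) \<partial>fresh n))"
        using N1 N3 by (simp add: nn_integral_sum nn_integral_cmult)
    qed
    finally show ?thesis .
  qed
  show ?thesis
    unfolding swap[OF G] swap[OF measurable_mix[OF G]]
    by (rule nn_integral_cong_AE, use AE_exp_law_nonneg in eventually_elim)
      (simp add: fresh_next_state[OF u _ G])
qed

lemma path_step_mean:
  assumes i: "i \<in> regimes M" and u: "u \<in> policies M" and G [measurable]: "G \<in> borel_measurable state_space"
  shows "(\<integral>\<^sup>+w. G (path i u q w w (Suc k)) \<partial>law M i) = (\<integral>\<^sup>+w. step_mean u G (path i u q w w k) \<partial>law M i)"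
proof -
  have "(\<integral>\<^sup>+w. G (path i u q w w (Suc k)) \<partial>law M i) =
     (\<integral>\<^sup>+w. G (next_state (servers M) (clipped u) (path i u q w w k) (gap (arr_time M) k w) (score M k w)
        (srv_time M (q + k) w) (left_value (regime M) i (arr_time M k w) w)) \<partial>law M i)"
    by (simp add: path_def[OF i])
  also have "\<dots> = (\<integral>\<^sup>+w. step_mean u G (path i u q w w k) \<partial>law M i)"
    unfolding step_mean_def
  proof (rule path_step[OF i u])
    have "(\<lambda>y. next_state (servers M) (clipped u) (fst y) (fst (snd y)) (fst (snd (snd y)))
        (fst (snd (snd (snd y)))) (snd (snd (snd (snd y)))))
      \<in> measurable (state_space \<Otimes>\<^sub>M (borel \<Otimes>\<^sub>M (borel \<Otimes>\<^sub>M (borel \<Otimes>\<^sub>M count_space UNIV)))) state_space"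
      by (rule measurable_next_state[OF servers_pos measurable_clipped[OF u]]) measurable
    from measurable_compose[OF this G]
    show "(\<lambda>(z, g, x, b, j). G (next_state (servers M) (clipped u) z g x b j))
      \<in> borel_measurable (state_space \<Otimes>\<^sub>M (borel \<Otimes>\<^sub>M (borel \<Otimes>\<^sub>M (borel \<Otimes>\<^sub>M count_space UNIV))))"
      by (simp add: split_beta')
  qed
  finally show ?thesis .
qed

lemma length_initial_departures [simp]: "length (initial_departures M w q) = q"
  by (induction q) (auto simp: admit_def)

lemma initial_departures_law:
  assumes i: "i \<in> regimes M" and "f \<in> borel_measurable list_space"
  shows "(\<integral>\<^sup>+w. f (initial_departures M w q) \<partial>law M i) = (\<integral>\<^sup>+R. f R \<partial>fresh q)"
  using assms(2)
proof (induction q arbitrary: f)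
  case 0
  interpret prob_space "law M i" by (rule prob_space_law[OF i])
  show ?case
    using 0 emeasure_space_1 by (simp add: nn_integral_return)
next
  case (Suc q)
  interpret S: sigma_finite_measure "exp_law (srv_rate M)" by (rule sigma_finite_laws)
  note [measurable] = Suc.prems measurable_admit[OF servers_pos]
  let ?I = "PService ` {..<q}"
  have [measurable]: "(\<lambda>y. initial_departures M (fst y) q) \<in> measurable (primitive_algebra M i ?I \<Otimes>\<^sub>M borel) list_space"
    by (rule measurable_initial_departures[OF i measurable_fst]) auto
  have "(\<integral>\<^sup>+w. f (initial_departures M w (Suc q)) \<partial>law M i) =
      (\<integral>\<^sup>+w. f (admit (servers M) (initial_departures M w q) 0 (srv_time M q w)) \<partial>law M i)"
    by simp
  also have "\<dots> = (\<integral>\<^sup>+w. \<integral>\<^sup>+b. f (admit (servers M) (initial_departures M w q) 0 b) \<partial>exp_law (srv_rate M) \<partial>law M i)"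
  proof (rule nn_integral_fresh[OF i _ measurable_service[OF i] distr_service[OF i]])
    show "PService q \<notin> ?I" by auto
    show "(\<lambda>(w, b). f (admit (servers M) (initial_departures M w q) 0 b))
        \<in> borel_measurable (primitive_algebra M i ?I \<Otimes>\<^sub>M borel)"
      unfolding split_beta' by measurable
  qed simp
  also have "\<dots> = (\<integral>\<^sup>+R. \<integral>\<^sup>+b. f (admit (servers M) R 0 b) \<partial>exp_law (srv_rate M) \<partial>fresh q)"
    by (rule Suc.IH) measurable
  also have "\<dots> = (\<integral>\<^sup>+R. f R \<partial>fresh (Suc q))"
    by (subst nn_integral_departure_law_Suc[OF servers_pos srv_rate_pos]) simp_all
  finally show ?case .
qed

text \<open>The induction ranges over all G because the hypothesis is used for
  \<open>step_mean u G\<close> and again for \<open>step_mean u (mix G)\<close>, the two sides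
  joined by \<open>mix_step_mean\<close>.\<close>

lemma path_mix:
  assumes i: "i \<in> regimes M" and u: "u \<in> policies M" and "G \<in> borel_measurable state_space"
  shows "(\<integral>\<^sup>+w. G (path i u q w w k) \<partial>law M i) = (\<integral>\<^sup>+w. mix G (path i u q w w k) \<partial>law M i)"
  using assms(3)
proof (induction k arbitrary: G)
  case 0
  interpret prob_space "law M i" by (rule prob_space_law[OF i])
  note [measurable] = 0
  have "(\<integral>\<^sup>+w. G (0, i, initial_departures M w q) \<partial>law M i) = (\<integral>\<^sup>+R. G (0, i, R) \<partial>fresh q)"
    by (rule initial_departures_law[OF i]) measurable
  also have "\<dots> = (\<integral>\<^sup>+w. mix G (0, i, initial_departures M w q) \<partial>law M i)"
    using emeasure_space_1 by (simp add: mix_def)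
  finally show ?case
    by (simp add: path_def[OF i])
next
  case (Suc k)
  show ?case
    unfolding path_step_mean[OF i u Suc.prems] path_step_mean[OF i u measurable_mix[OF Suc.prems]]
      Suc.IH[OF step_mean_measurable[OF u Suc.prems]] mix_step_mean[OF u Suc.prems]
      Suc.IH[OF step_mean_measurable[OF u measurable_mix[OF Suc.prems]]] ..
qed

text \<open>\<open>path_step\<close> averages over gap, score and next regime,
  \<open>path_mix\<close> over the residual list; together these are the integrals in
  \<open>policy_op\<close>.\<close>

lemma path_stage:
  assumes i: "i \<in> regimes M" and u: "u \<in> policies M"
  shows "(\<integral>\<^sup>+w. ennreal (exp (- disc_rate M * fst (path i u q w w k))) *
      stage u f (snd (snd (path i u q w w k))) (gap (arr_time M) k w) (score M k w)
        (left_value (regime M) i (arr_time M k w) w) \<partial>law M i) =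
    (\<integral>\<^sup>+w. ennreal (exp (- disc_rate M * fst (path i u q w w k))) *
      policy_op u f (length (snd (snd (path i u q w w k)))) (fst (snd (path i u q w w k))) \<partial>law M i)"
proof -
  interpret S: prob_space "exp_law (srv_rate M)" by (rule prob_space_exp_law[OF srv_rate_pos])
  interpret X: sigma_finite_measure score_law by (rule sigma_finite_laws)
  define d where "d z = ennreal (exp (- disc_rate M * fst z))" for z :: state
  define G where "G z = d z * stage_mean (stage u f) (fst (snd z)) (snd (snd z))" for z
  have [measurable]: "d \<in> borel_measurable state_space"
    unfolding d_def[abs_def] by measurable
  have G: "G \<in> borel_measurable state_space"
  proof -
    have [measurable]: "(\<lambda>z :: state. stage_mean (stage u f) (fst (snd z)) (snd (snd z))) \<in> borel_measurable state_space"
      by (rule measurable_stage_mean[OF u]) measurable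
    show ?thesis unfolding G_def[abs_def] by measurable
  qed
  have "(\<integral>\<^sup>+w. d (path i u q w w k) * stage u f (snd (snd (path i u q w w k))) (gap (arr_time M) k w) (score M k w)
        (left_value (regime M) i (arr_time M k w) w) \<partial>law M i) =
    (\<integral>\<^sup>+w. \<integral>\<^sup>+g. \<integral>\<^sup>+x. \<integral>\<^sup>+b. (\<Sum>j\<in>regimes M.
        ennreal (transition (regimes M) (gen M) g (fst (snd (path i u q w w k))) j) *
        (d (path i u q w w k) * stage u f (snd (snd (path i u q w w k))) g x j))
       \<partial>exp_law (srv_rate M) \<partial>score_law \<partial>exp_law (arr_rate M) \<partial>law M i)"
  proof (rule path_step[OF i u, where F="\<lambda>z g x b j. d z * stage u f (snd (snd z)) g x j"])
    have [measurable]: "(\<lambda>y. stage u f (snd (snd (fst y))) (fst (snd y)) (fst (snd (snd y))) (snd (snd (snd (snd y)))))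
      \<in> borel_measurable (state_space \<Otimes>\<^sub>M (borel \<Otimes>\<^sub>M (borel \<Otimes>\<^sub>M (borel \<Otimes>\<^sub>M count_space UNIV))))"
      by (rule measurable_stage[OF u]) measurable
    show "(\<lambda>(z, g, x, b, j). d z * stage u f (snd (snd z)) g x j)
      \<in> borel_measurable (state_space \<Otimes>\<^sub>M (borel \<Otimes>\<^sub>M (borel \<Otimes>\<^sub>M (borel \<Otimes>\<^sub>M count_space UNIV))))"
      unfolding split_beta' by measurable
  qed
  also have "\<dots> = (\<integral>\<^sup>+w. G (path i u q w w k) \<partial>law M i)"
  proof (intro nn_integral_cong)
    fix w
    let ?z = "path i u q w w k"
    have m2: "(\<lambda>y. \<Sum>j\<in>regimes M. ennreal (transition (regimes M) (gen M) (fst y) (fst (snd ?z)) j) *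
         stage u f (snd (snd ?z)) (fst y) (snd y) j) \<in> borel_measurable (exp_law (arr_rate M) \<Otimes>\<^sub>M score_law)"
    proof -
      have [measurable]: "(\<lambda>y. stage u f (snd (snd ?z)) (fst y) (snd y) j)
          \<in> borel_measurable (exp_law (arr_rate M) \<Otimes>\<^sub>M score_law)" for j
        by (rule measurable_stage[OF u]) measurable
      have [measurable]: "(\<lambda>y. transition (regimes M) (gen M) (fst y) (fst (snd ?z)) j)
          \<in> borel_measurable (exp_law (arr_rate M) \<Otimes>\<^sub>M score_law)" for j
        by (rule measurable_transition[OF finite_regimes]) measurable
      show ?thesis by measurable
    qed
    have m1: "(\<lambda>x. \<Sum>j\<in>regimes M. ennreal (transition (regimes M) (gen M) g (fst (snd ?z)) j) *
         stage u f (snd (snd ?z)) g x j) \<in> borel_measurable score_law" for g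
      using measurable_compose[OF measurable_Pair1' m2, of g] by simp
    have m0: "(\<lambda>g. \<integral>\<^sup>+x. (\<Sum>j\<in>regimes M. ennreal (transition (regimes M) (gen M) g (fst (snd ?z)) j) *
         stage u f (snd (snd ?z)) g x j) \<partial>score_law) \<in> borel_measurable (exp_law (arr_rate M))"
      using m2 by (intro X.borel_measurable_nn_integral) (simp add: split_beta')
    have "(\<Sum>j\<in>regimes M. ennreal (transition (regimes M) (gen M) g (fst (snd ?z)) j) *
         (d ?z * stage u f (snd (snd ?z)) g x j)) =
      d ?z * (\<Sum>j\<in>regimes M. ennreal (transition (regimes M) (gen M) g (fst (snd ?z)) j) *
         stage u f (snd (snd ?z)) g x j)" for g x
      by (simp add: sum_distrib_left ac_simps)
    \<comment> \<open>The service time of the stage does not occur in the integrand, so its law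
      integrates to 1.\<close>
    then show "(\<integral>\<^sup>+g. \<integral>\<^sup>+x. \<integral>\<^sup>+b. (\<Sum>j\<in>regimes M.
        ennreal (transition (regimes M) (gen M) g (fst (snd ?z)) j) * (d ?z * stage u f (snd (snd ?z)) g x j))
       \<partial>exp_law (srv_rate M) \<partial>score_law \<partial>exp_law (arr_rate M)) = G ?z"
      using S.emeasure_space_1 m1 m0 by (simp add: G_def stage_mean_def nn_integral_cmult)
  qed
  also have "\<dots> = (\<integral>\<^sup>+w. mix G (path i u q w w k) \<partial>law M i)"
    by (rule path_mix[OF i u G])
  also have "\<dots> = (\<integral>\<^sup>+w. d (path i u q w w k) *
      policy_op u f (length (snd (snd (path i u q w w k)))) (fst (snd (path i u q w w k))) \<partial>law M i)"
  proof (intro nn_integral_cong)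
    fix w
    let ?z = "path i u q w w k"
    have "(\<lambda>R. stage_mean (stage u f) (fst (snd ?z)) R) \<in> borel_measurable (fresh n)" for n
      by (rule measurable_stage_mean[OF u]) measurable
    then show "mix G ?z = d ?z * policy_op u f (length (snd (snd ?z))) (fst (snd ?z))"
      by (simp add: mix_def G_def policy_op_def nn_integral_cmult d_def)
  qed
  finally show ?thesis
    by (simp add: d_def)
qed

section \<open>Finite-horizon costs as iterates of the policy operator\<close>

definition stage_cost :: "nat \<Rightarrow> policy \<Rightarrow> nat \<Rightarrow> 'w \<Rightarrow> nat \<Rightarrow> ennreal" where
  "stage_cost i u q w k = ennreal (exp (- disc_rate M * fst (path i u q w w k))) *
      stage u (\<lambda>_ _. 0) (snd (snd (path i u q w w k))) (gap (arr_time M) k w) (score M k w)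
        (left_value (regime M) i (arr_time M k w) w)"

definition terminal :: "nat \<Rightarrow> policy \<Rightarrow> nat \<Rightarrow> (nat \<Rightarrow> nat \<Rightarrow> ennreal) \<Rightarrow> nat \<Rightarrow> ennreal" where
  "terminal i u q f k = (\<integral>\<^sup>+w. ennreal (exp (- disc_rate M * fst (path i u q w w k))) *
     f (length (snd (snd (path i u q w w k)))) (fst (snd (path i u q w w k))) \<partial>law M i)"

lemma measurable_path_law:
  assumes i: "i \<in> regimes M" and u: "u \<in> policies M"
  shows "(\<lambda>w. path i u q w w k) \<in> measurable (law M i) state_space"
  by (rule measurable_from_primitive_algebra[OF i, of _ UNIV])
    (rule measurable_path[OF i u measurable_ident_sets _ measurable_ident_sets], auto)

lemma measurable_mark_law:
  assumes i: "i \<in> regimes M"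
  shows "(\<lambda>w. left_value (regime M) i (arr_time M k w) w) \<in> measurable (law M i) (count_space UNIV)"
  by (rule measurable_from_primitive_algebra[OF i, of _ UNIV])
    (rule measurable_mark[OF i measurable_arr_time[OF i measurable_ident_sets] measurable_ident_sets], auto)

lemma measurable_stage_cost:
  assumes i: "i \<in> regimes M" and u: "u \<in> policies M"
  shows "(\<lambda>w. stage_cost i u q w k) \<in> borel_measurable (law M i)"
proof -
  note [measurable] = measurable_path_law[OF i u] measurable_mark_law[OF i] gap_random[OF i] score_random[OF i]
  have [measurable]: "(\<lambda>w. stage u (\<lambda>_ _. 0) (snd (snd (path i u q w w k))) (gap (arr_time M) k w) (score M k w)
        (left_value (regime M) i (arr_time M k w) w)) \<in> borel_measurable (law M i)"
    by (rule measurable_stage[OF u]) measurable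
  show ?thesis
    unfolding stage_cost_def by measurable
qed

lemma stage_decompose:
  assumes i: "i \<in> regimes M"
  shows "ennreal (exp (- disc_rate M * fst (path i u q w w k))) *
      stage u f (snd (snd (path i u q w w k))) (gap (arr_time M) k w) (score M k w)
        (left_value (regime M) i (arr_time M k w) w) =
   stage_cost i u q w k + ennreal (exp (- disc_rate M * fst (path i u q w w (Suc k)))) *
     f (length (snd (snd (path i u q w w (Suc k))))) (fst (snd (path i u q w w (Suc k))))"
proof -
  let ?z = "path i u q w w k"
  have *: "path i u q w w (Suc k) = next_state (servers M) (clipped u) ?z (gap (arr_time M) k w) (score M k w)
     (srv_time M (q + k) w) (left_value (regime M) i (arr_time M k w) w)"
    by (simp add: path_def[OF i])
  have e: "ennreal (exp (- disc_rate M * (s + g))) = ennreal (exp (- disc_rate M * s)) * ennreal (exp (- disc_rate M * g))"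
    for s g
    by (simp add: ennreal_mult' exp_add[symmetric] algebra_simps flip: ennreal_mult)
  show ?thesis
    unfolding * stage_cost_def stage_def decision_def next_state_def Let_def fst_conv snd_conv e
    by (auto simp: distrib_left admit_def ac_simps)
qed

lemma terminal_step:
  assumes i: "i \<in> regimes M" and u: "u \<in> policies M"
  shows "(\<integral>\<^sup>+w. stage_cost i u q w k \<partial>law M i) + terminal i u q f (Suc k) = terminal i u q (policy_op u f) k"
proof -
  note [measurable] = measurable_path_law[OF i u] measurable_stage_cost[OF i u]
  have [measurable]: "(\<lambda>w. f (length (snd (snd (path i u q w w (Suc k))))) (fst (snd (path i u q w w (Suc k)))))
      \<in> borel_measurable (law M i)"
    by (rule measurable_nat2; measurable; simp)
  show ?thesis
    unfolding terminal_def path_stage[OF i u, symmetric] stage_decompose[OF i]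
    by (rule nn_integral_add[symmetric]) measurable
qed

lemma terminal_0:
  assumes i: "i \<in> regimes M"
  shows "terminal i u q f 0 = f q i"
proof -
  interpret prob_space "law M i" by (rule prob_space_law[OF i])
  show ?thesis
    using emeasure_space_1 by (simp add: terminal_def path_def[OF i])
qed

text \<open>The last stage cost and the cost to go f after it merge into the cost to go
  \<open>policy_op u f\<close> one stage earlier, so the induction needs arbitrary f.\<close>

lemma partial_cost:
  assumes i: "i \<in> regimes M" and u: "u \<in> policies M"
  shows "(\<Sum>k<n. \<integral>\<^sup>+w. stage_cost i u q w k \<partial>law M i) + terminal i u q f n = ((policy_op u ^^ n) f) q i"
proof (induction n arbitrary: f)
  case 0
  then show ?case by (simp add: terminal_0[OF i])
next
  case (Suc n)
  have "(\<Sum>k<Suc n. \<integral>\<^sup>+w. stage_cost i u q w k \<partial>law M i) + terminal i u q f (Suc n) =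
      (\<Sum>k<n. \<integral>\<^sup>+w. stage_cost i u q w k \<partial>law M i) + terminal i u q (policy_op u f) n"
    by (simp add: add.assoc terminal_step[OF i u])
  also have "\<dots> = ((policy_op u ^^ Suc n) f) q i"
    by (simp add: Suc.IH funpow_swap1)
  finally show ?case .
qed

lemma total_cost_lfp:
  assumes i: "i \<in> regimes M" and u: "u \<in> policies M"
  shows "(\<integral>\<^sup>+w. (\<Sum>k. stage_cost i u q w k) \<partial>law M i) = lfp (policy_op u) q i"
proof -
  have "(\<integral>\<^sup>+w. (\<Sum>k. stage_cost i u q w k) \<partial>law M i) = (\<Sum>k. \<integral>\<^sup>+w. stage_cost i u q w k \<partial>law M i)"
    by (rule nn_integral_suminf[OF measurable_stage_cost[OF i u]])
  also have "\<dots> = (SUP n. \<Sum>k<n. \<integral>\<^sup>+w. stage_cost i u q w k \<partial>law M i)"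
    by (rule suminf_eq_SUP)
  also have "\<dots> = (SUP n. ((policy_op u ^^ n) bot) q i)"
  proof (intro SUP_cong refl)
    fix n
    have "terminal i u q bot n = 0"
      by (simp add: terminal_def bot_ennreal)
    then show "(\<Sum>k<n. \<integral>\<^sup>+w. stage_cost i u q w k \<partial>law M i) = ((policy_op u ^^ n) bot) q i"
      using partial_cost[OF i u, where n=n and q=q and f=bot] by simp
  qed
  also have "\<dots> = lfp (policy_op u) q i"
    by (simp add: sup_continuous_lfp[OF sup_continuous_policy_op[OF u]] image_comp)
  finally show ?thesis .
qed

end

subsection \<open>The cost of a path as a sum over stages\<close>

lemma residual_residual:
  assumes "0 \<le> g"
  shows "residual g (residual s ds) = residual (s + g) ds"
  using assms unfolding residual_def
  by (induction ds) (auto simp: algebra_simps)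

lemma in_system_left_residual: "in_system_left ds t = length (residual t ds)"
  by (simp add: in_system_left_def residual_def)

text \<open>Admission commutes with resetting the clock at the arrival time; a nonnegative service
  time ensures that the new task survives the filter.\<close>

lemma residual_admit:
  assumes m: "1 \<le> m" and b: "0 \<le> b"
  shows "residual t (admit m ds t b) = admit m (residual t ds) 0 b"
proof -
  have "t \<le> entry m ds t"
    by (rule entry_ge[OF m])
  then have "entry m (residual t ds) 0 = entry m ds t - t"
    using entry_residual[OF m order_refl, of t ds] by simp
  with \<open>t \<le> entry m ds t\<close> b show ?thesis
    unfolding admit_entry by (simp add: residual_def)
qed

lemma length_filter_residual:
  assumes "0 \<le> r"
  shows "length (filter (\<lambda>d. r < d) (residual s ds)) = length (filter (\<lambda>d. s + r < d) ds)"
  using assms unfolding residual_def by (induction ds) auto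

lemma measurable_length_filter_less:
  fixes R :: "real list"
  shows "(\<lambda>r. length (filter (\<lambda>d. r < d) R)) \<in> measurable borel (count_space UNIV)"
  by (rule measurable_compose[OF measurable_list_filter[OF measurable_list_space_const] measurable_length_list_space])
    measurable

text \<open>Tilting by the discount factor turns the density of rate l into
  \<open>l / (l + a)\<close> times the density of rate \<open>l + a\<close>.\<close>

lemma nn_integral_exponential_discount:
  assumes "0 < l" "0 < a"
  shows "(\<integral>\<^sup>+g. ennreal (exp (- a * g)) \<partial>exp_law l) = ennreal (l / (l + a))"
proof -
  interpret prob_space "exp_law (l + a)" by (rule prob_space_exp_law) (use assms in simp)
  have "(\<integral>\<^sup>+g. ennreal (exp (- a * g)) \<partial>exp_law l) =
      (\<integral>\<^sup>+g. ennreal (exponential_density l g) * ennreal (exp (- a * g)) \<partial>lborel)"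
    unfolding exp_law_def by (subst nn_integral_density) auto
  also have "\<dots> = (\<integral>\<^sup>+g. ennreal (l / (l + a)) * ennreal (exponential_density (l + a) g) \<partial>lborel)"
  proof (intro nn_integral_cong)
    fix g :: real
    have "exponential_density l g * exp (- a * g) = l / (l + a) * exponential_density (l + a) g"
    proof (cases "g < 0")
      case False
      have "exp (- g * l) * exp (- a * g) = exp (- g * (l + a))"
        by (simp add: exp_add[symmetric] algebra_simps)
      then have "exponential_density l g * exp (- a * g) = l * exp (- g * (l + a))"
        using False by (simp add: exponential_density_def mult.assoc)
      then show ?thesis
        using False assms by (simp add: exponential_density_def)
    qed (simp add: exponential_density_def)
    then show "ennreal (exponential_density l g) * ennreal (exp (- a * g)) =
        ennreal (l / (l + a)) * ennreal (exponential_density (l + a) g)"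
      using assms by (simp add: ennreal_mult'[symmetric] exponential_density_nonneg)
  qed
  also have "\<dots> = ennreal (l / (l + a)) * (\<integral>\<^sup>+g. ennreal (exponential_density (l + a) g) \<partial>lborel)"
    by (rule nn_integral_cmult) simp
  also have "(\<integral>\<^sup>+g. ennreal (exponential_density (l + a) g) \<partial>lborel) = emeasure (exp_law (l + a)) UNIV"
    unfolding exp_law_def by (subst emeasure_density) auto
  also have "\<dots> = 1"
    using emeasure_space_1 by simp
  finally show ?thesis by simp
qed

section \<open>Non-explosion of the arrivals and pathwise costs\<close>

context hybrid_control
begin

context
  fixes i :: nat
  assumes i: "i \<in> regimes M"
begin

interpretation prob_space "law M i"
  by (rule prob_space_law[OF i])

lemma arr_time_random [measurable]: "arr_time M n \<in> borel_measurable (law M i)"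
proof -
  have "(\<lambda>x. arr_time M n (id x)) \<in> borel_measurable (primitive_algebra M i UNIV)"
    by (rule measurable_arr_time[OF i measurable_ident]) simp
  then show ?thesis
    by (intro measurable_from_primitive_algebra[OF i, of _ UNIV]) simp
qed

text \<open>The discount factor at the n-th arrival is a product of independent factors of mean r,
  so the means form a geometric series. This gives both non-explosion and finiteness of
  \<open>V\<close>.\<close>

lemma discount_sum_finite:
  "(\<integral>\<^sup>+w. (\<Sum>n. ennreal (exp (- disc_rate M * arr_time M n w))) \<partial>law M i) < \<infinity>"
proof -
  define r where "r = arr_rate M / (arr_rate M + disc_rate M)"
  have r: "0 \<le> r" "r < 1"
    using arr_rate_pos disc_rate_pos by (auto simp: r_def)
  have "(\<integral>\<^sup>+w. ennreal (exp (- disc_rate M * arr_time M n w)) \<partial>law M i) = ennreal (r ^ Suc n)" for n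
  proof -
    have ind: "indep_vars (\<lambda>_. borel) (\<lambda>l w. ennreal (exp (- disc_rate M * gap (arr_time M) l w))) {..n}"
      by (rule indep_vars_compose2[OF indep_vars_subset[OF gap_indep[OF i]],
            where Y="\<lambda>_ x. ennreal (exp (- disc_rate M * x))"]) auto
    have "(\<integral>\<^sup>+w. ennreal (exp (- disc_rate M * arr_time M n w)) \<partial>law M i) =
        (\<integral>\<^sup>+w. (\<Prod>l\<le>n. ennreal (exp (- disc_rate M * gap (arr_time M) l w))) \<partial>law M i)"
      by (simp add: arr_time_gap[of "arr_time M" n] sum_distrib_left exp_sum prod_ennreal sum_negf[symmetric] del: sum_negf)
    also have "\<dots> = (\<Prod>l\<le>n. \<integral>\<^sup>+w. ennreal (exp (- disc_rate M * gap (arr_time M) l w)) \<partial>law M i)"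
      by (rule indep_vars_nn_integral[OF _ ind]) auto
    also have "\<dots> = (\<Prod>l\<le>n. ennreal r)"
    proof (intro prod.cong refl)
      fix l
      have "(\<integral>\<^sup>+w. ennreal (exp (- disc_rate M * gap (arr_time M) l w)) \<partial>law M i) =
          (\<integral>\<^sup>+g. ennreal (exp (- disc_rate M * g)) \<partial>exp_law (arr_rate M))"
        unfolding distr_gap[OF i, of l, symmetric]
        using gap_random[OF i] by (subst nn_integral_distr) auto
      then show "(\<integral>\<^sup>+w. ennreal (exp (- disc_rate M * gap (arr_time M) l w)) \<partial>law M i) = ennreal r"
        by (simp only: nn_integral_exponential_discount[OF arr_rate_pos disc_rate_pos] r_def)
    qed
    also have "\<dots> = ennreal (r ^ Suc n)"
      using r by (simp add: ennreal_power del: power_Suc)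
    finally show ?thesis .
  qed
  then have "(\<integral>\<^sup>+w. (\<Sum>n. ennreal (exp (- disc_rate M * arr_time M n w))) \<partial>law M i) = (\<Sum>n. ennreal (r ^ Suc n))"
    by (subst nn_integral_suminf) auto
  moreover have "summable (\<lambda>n. r ^ Suc n)"
    unfolding summable_Suc_iff using r by (simp add: summable_geometric)
  then have "(\<Sum>n. ennreal (r ^ Suc n)) \<noteq> top"
    using r by (intro ennreal_suminf_neq_top) auto
  ultimately show ?thesis
    by (simp add: less_top)
qed

text \<open>A sum with finite mean is almost surely finite, so the discount factors tend to 0, which
  forces the arrival times past every bound.\<close>

lemma AE_arr_time_unbounded: "AE w in law M i. \<forall>t. \<exists>n. t < arr_time M n w"
proof -
  have "AE w in law M i. (\<Sum>n. ennreal (exp (- disc_rate M * arr_time M n w))) \<noteq> \<infinity>"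
    using discount_sum_finite by (intro nn_integral_PInf_AE) auto
  then show ?thesis
  proof eventually_elim
    case (elim w)
    have "summable (\<lambda>n. exp (- disc_rate M * arr_time M n w))"
      using elim by (intro summable_suminf_not_top) auto
    then have lim: "(\<lambda>n. exp (- disc_rate M * arr_time M n w)) \<longlonglongrightarrow> 0"
      by (rule summable_LIMSEQ_zero)
    show ?case
    proof
      fix t
      have "\<forall>\<^sub>F n in sequentially. exp (- disc_rate M * arr_time M n w) < exp (- disc_rate M * t)"
        by (rule order_tendstoD[OF lim]) simp
      then obtain n where "exp (- disc_rate M * arr_time M n w) < exp (- disc_rate M * t)"
        using eventually_happens by fastforce
      then show "\<exists>n. t < arr_time M n w"
        using disc_rate_pos by (auto intro!: exI[of _ n])
    qed
  qed
qed

text \<open>Positive gaps order the arrivals, nonnegative service times put departures after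
  admissions, and unbounded arrival times let the stages cover the half line.\<close>

definition regular :: "'w \<Rightarrow> bool" where
  "regular w \<longleftrightarrow> w \<in> space (law M i) \<and> (\<forall>n. 0 < gap (arr_time M) n w) \<and> (\<forall>n. 0 \<le> srv_time M n w)
     \<and> (\<forall>t. \<exists>n. t < arr_time M n w)"

lemma AE_regular: "AE w in law M i. regular w"
  using AE_gap_pos[OF i] AE_service_nonneg[OF i] AE_arr_time_unbounded AE_space
  by eventually_elim (simp add: regular_def)

context
  fixes w
  assumes w: "regular w"
begin

lemma arr_time_Suc_less: "arr_time M n w < arr_time M (Suc n) w"
  using w gap.simps(2)[of "arr_time M" n w] by (force simp: regular_def dest!: spec[of _ "Suc n"])

lemma arr_time_pos: "0 < arr_time M n w"
proof (induction n)
  case 0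
  show ?case using w by (force simp: regular_def dest!: spec[of _ 0])
next
  case (Suc n)
  then show ?case using arr_time_Suc_less[of n] by linarith
qed

lemma regime_left_value: "regime_left M (arr_time M n w) w = left_value (regime M) i (arr_time M n w) w"
  using arr_time_pos by (simp add: regime_left_def left_value_def)

lemma regime_left_in: "regime_left M (arr_time M n w) w \<in> regimes M"
  unfolding regime_left_value
  using left_value_in[OF regime_chain[OF i] finite_regimes i, of w] w by (auto simp: regular_def)

lemma score_in: "score M n w \<in> {0..1}"
  using score_range[OF i, of w n] w by (simp add: regular_def)

text \<open>The time origin is put in front of the arrival times, so stage k occupies
  \<open>{epoch k..<epoch (Suc k)}\<close>.\<close>

definition epoch :: "nat \<Rightarrow> real" where
  "epoch k = case_nat 0 (\<lambda>l. arr_time M l w) k"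

lemma epoch_0 [simp]: "epoch 0 = 0" and epoch_Suc: "epoch (Suc k) = arr_time M k w"
  by (simp_all add: epoch_def)

lemma epoch_gap: "epoch (Suc k) = epoch k + gap (arr_time M) k w"
  by (cases k) (simp_all add: epoch_def)

lemma epoch_mono: "epoch k < epoch (Suc k)"
  using w by (simp add: epoch_gap regular_def)

lemma initial_departures_nonneg: "\<forall>d\<in>set (initial_departures M w q). 0 \<le> d"
proof (induction q)
  case (Suc q)
  have "0 \<le> entry (servers M) (initial_departures M w q) 0 + srv_time M q w"
    using entry_ge[OF servers_pos, of 0] w by (simp add: regular_def add_nonneg_nonneg)
  with Suc show ?case by (simp add: admit_entry)
qed simp

text \<open>This links the chain of residual lists to the absolute departure times of the model.
  Clipping is invisible here, because a regular sample point has scores in the unit interval and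
  actual regimes.\<close>

lemma path_departures:
  assumes u: "u \<in> policies M"
  shows "fst (path i u q w w k) = epoch k \<and>
    snd (snd (path i u q w w k)) = residual (epoch k) (departures M u q w k)"
proof (induction k)
  case 0
  have "residual 0 (initial_departures M w q) = initial_departures M w q"
    unfolding residual_def using initial_departures_nonneg[of q]
    by (simp add: filter_True)
  then show ?case
    by (simp add: path_def[OF i])
next
  case (Suc k)
  let ?t = "arr_time M k w"
  let ?ds = "departures M u q w k"
  have t: "epoch k + gap (arr_time M) k w = ?t"
    by (simp add: epoch_gap[symmetric] epoch_Suc)
  have g: "0 \<le> gap (arr_time M) k w"
    using w by (simp add: regular_def less_imp_le)
  have r: "residual (gap (arr_time M) k w) (residual (epoch k) ?ds) = residual ?t ?ds"
    using residual_residual[OF g, of "epoch k" ?ds] t by simp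
  have c: "clipped u n (regime_left M ?t w) (score M k w) = u n (regime_left M ?t w) (score M k w)" for n
    using score_in[of k] regime_left_in[of k] by (simp add: clipped_def)
  have b: "0 \<le> srv_time M (q + k) w"
    using w by (simp add: regular_def)
  have "path i u q w w (Suc k) = next_state (servers M) (clipped u) (path i u q w w k) (gap (arr_time M) k w)
      (score M k w) (srv_time M (q + k) w) (regime_left M ?t w)"
    by (simp add: path_def[OF i] regime_left_value)
  then show ?case
    using Suc unfolding next_state_def
    by (simp add: r t c Let_def in_system_left_residual residual_admit[OF servers_pos b] epoch_Suc)
qed

lemma hold_stage:
  "ennreal (exp (- disc_rate M * s)) * hold (residual s ds) g =
     (\<integral>\<^sup>+t. indicator {s..<s + g} t * ennreal (exp (- disc_rate M * t) * hold_cost M (in_system ds t)) \<partial>lborel)"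
proof -
  have [measurable]: "(\<lambda>r. hold_cost M (length (filter (\<lambda>d. r < d) R))) \<in> borel_measurable borel" for R :: "real list"
    by (rule measurable_compose[OF measurable_length_filter_less]) simp
  have "(\<integral>\<^sup>+t. indicator {s..<s + g} t * ennreal (exp (- disc_rate M * t) * hold_cost M (in_system ds t)) \<partial>lborel) =
     (\<integral>\<^sup>+r. indicator {s..<s + g} (s + 1 * r) * ennreal (exp (- disc_rate M * (s + 1 * r)) *
        hold_cost M (in_system ds (s + 1 * r))) \<partial>lborel)"
    unfolding in_system_def by (subst nn_integral_real_affine[of _ 1 s]) auto
  also have "\<dots> = (\<integral>\<^sup>+r. ennreal (exp (- disc_rate M * s)) * (indicator {0..<g} r * ennreal (exp (- disc_rate M * r) *
        hold_cost M (length (filter (\<lambda>d. r < d) (residual s ds))))) \<partial>lborel)"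
  proof (intro nn_integral_cong)
    fix r :: real
    have "exp (- disc_rate M * (s + r)) = exp (- disc_rate M * s) * exp (- disc_rate M * r)"
      by (simp add: exp_add[symmetric] algebra_simps)
    then show "indicator {s..<s + g} (s + 1 * r) * ennreal (exp (- disc_rate M * (s + 1 * r)) *
        hold_cost M (in_system ds (s + 1 * r))) =
       ennreal (exp (- disc_rate M * s)) * (indicator {0..<g} r * ennreal (exp (- disc_rate M * r) *
        hold_cost M (length (filter (\<lambda>d. r < d) (residual s ds)))))"
      by (auto simp: indicator_def in_system_def length_filter_residual ennreal_mult' mult.assoc)
  qed
  also have "\<dots> = ennreal (exp (- disc_rate M * s)) * hold (residual s ds) g"
    unfolding hold_def by (rule nn_integral_cmult) measurable
  finally show ?thesis ..
qed

lemma epoch_strict_mono: "strict_mono epoch"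
  using epoch_mono by (simp add: strict_mono_Suc_iff)

lemma epoch_cover:
  assumes "0 \<le> t"
  obtains k where "t \<in> {epoch k..<epoch (Suc k)}"
proof -
  define k where "k = (LEAST k. t < epoch (Suc k))"
  obtain n where "t < arr_time M n w"
    using w unfolding regular_def by blast
  then have "t < epoch (Suc n)"
    by (simp add: epoch_Suc)
  then have 1: "t < epoch (Suc k)"
    unfolding k_def by (rule LeastI)
  have "epoch k \<le> t"
  proof (cases k)
    case (Suc l)
    then have "\<not> t < epoch (Suc l)"
      unfolding k_def using not_less_Least[of l "\<lambda>k. t < epoch (Suc k)"] by simp
    with Suc show ?thesis by simp
  qed (use assms in simp)
  with 1 show ?thesis
    by (intro that[of k]) simp
qed

lemma epoch_unique:
  assumes "t \<in> {epoch k..<epoch (Suc k)}" "t \<in> {epoch l..<epoch (Suc l)}"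
  shows "k = l"
proof (rule ccontr)
  assume "k \<noteq> l"
  then consider "Suc k \<le> l" | "Suc l \<le> k" by linarith
  then show False
  proof cases
    case 1
    then have "epoch (Suc k) \<le> epoch l"
      using epoch_strict_mono by (simp add: strict_mono_less_eq)
    with assms show ?thesis by simp
  next
    case 2
    then have "epoch (Suc l) \<le> epoch k"
      using epoch_strict_mono by (simp add: strict_mono_less_eq)
    with assms show ?thesis by simp
  qed
qed

lemma queue_epoch:
  assumes t: "t \<in> {epoch k..<epoch (Suc k)}"
  shows "queue M u q w t = in_system (departures M u q w k) t"
proof -
  have "arr_time M n w \<le> t \<longleftrightarrow> n < k" for n
  proof
    assume "arr_time M n w \<le> t"
    then have "epoch (Suc n) < epoch (Suc k)"
      using t by (simp add: epoch_Suc)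
    then show "n < k"
      using epoch_strict_mono by (simp add: strict_mono_less)
  next
    assume "n < k"
    then have "epoch (Suc n) \<le> epoch k"
      using epoch_strict_mono by (simp add: strict_mono_less_eq Suc_le_eq)
    then show "arr_time M n w \<le> t"
      using t by (simp add: epoch_Suc)
  qed
  then have "{n. arr_time M n w \<le> t} = {..<k}" by auto
  then show ?thesis
    by (simp add: queue_def)
qed

text \<open>The half-open stages partition the half line, and inside a stage the list of departure
  times is constant.\<close>

lemma holding_cost_sum:
  "(\<integral>\<^sup>+t\<in>{0..}. ennreal (exp (- disc_rate M * t) * hold_cost M (queue M u q w t)) \<partial>lborel) =
   (\<Sum>k. ennreal (exp (- disc_rate M * epoch k)) * hold (residual (epoch k) (departures M u q w k)) (gap (arr_time M) k w))"
proof -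
  have m: "(\<lambda>t. indicator {epoch k..<epoch (Suc k)} t * ennreal (exp (- disc_rate M * t) *
      hold_cost M (in_system (departures M u q w k) t))) \<in> borel_measurable lborel" for k
  proof -
    have [measurable]: "(\<lambda>t. hold_cost M (in_system (departures M u q w k) t)) \<in> borel_measurable borel"
      unfolding in_system_def
      by (rule measurable_compose[OF measurable_length_filter_less]) simp
    show ?thesis by measurable
  qed
  have "(\<integral>\<^sup>+t\<in>{0..}. ennreal (exp (- disc_rate M * t) * hold_cost M (queue M u q w t)) \<partial>lborel) =
    (\<integral>\<^sup>+t. (\<Sum>k. indicator {epoch k..<epoch (Suc k)} t * ennreal (exp (- disc_rate M * t) *
      hold_cost M (in_system (departures M u q w k) t))) \<partial>lborel)"
  proof (intro nn_integral_cong)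
    fix t :: real
    let ?f = "\<lambda>k. indicator {epoch k..<epoch (Suc k)} t * ennreal (exp (- disc_rate M * t) *
      hold_cost M (in_system (departures M u q w k) t))"
    show "ennreal (exp (- disc_rate M * t) * hold_cost M (queue M u q w t)) * indicator {0..} t = (\<Sum>k. ?f k)"
    proof (cases "0 \<le> t")
      case True
      then obtain k0 where k0: "t \<in> {epoch k0..<epoch (Suc k0)}" by (rule epoch_cover)
      have "?f = (\<lambda>k. if k = k0 then ?f k else 0)"
        using epoch_unique[OF k0] by (auto simp: fun_eq_iff indicator_def)
      then have "(\<Sum>k. ?f k) = ?f k0"
        using sums_single[of k0 ?f] by (metis (lifting) sums_unique)
      then show ?thesis
        using k0 True queue_epoch[OF k0, of u q] by simp
    next
      case False
      have "0 \<le> epoch k" for k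
        using epoch_strict_mono strict_mono_less_eq[of epoch 0 k] by simp
      then have z: "?f = (\<lambda>k. 0)"
        using False by (auto simp: indicator_def fun_eq_iff intro: order_trans)
      show ?thesis
        using False by (subst z) simp
    qed
  qed
  also have "\<dots> = (\<Sum>k. \<integral>\<^sup>+t. indicator {epoch k..<epoch (Suc k)} t * ennreal (exp (- disc_rate M * t) *
      hold_cost M (in_system (departures M u q w k) t)) \<partial>lborel)"
    by (rule nn_integral_suminf[OF m])
  also have "\<dots> = (\<Sum>k. ennreal (exp (- disc_rate M * epoch k)) *
      hold (residual (epoch k) (departures M u q w k)) (gap (arr_time M) k w))"
    unfolding hold_stage epoch_gap ..
  finally show ?thesis .
qed

lemma path_cost:
  assumes u: "u \<in> policies M"
  shows "(\<integral>\<^sup>+t\<in>{0..}. ennreal (exp (- disc_rate M * t) * hold_cost M (queue M u q w t)) \<partial>lborel)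
        + (\<Sum>n. ennreal (exp (- disc_rate M * arr_time M n w) *
             ((1 - real (action M u q w n)) *
                auto_cost M (score M n w) (regime_left M (arr_time M n w) w)
              + real (action M u q w n) * esc_cost M))) = (\<Sum>k. stage_cost i u q w k)"
proof -
  define A where "A k = ennreal (exp (- disc_rate M * epoch k)) *
      hold (residual (epoch k) (departures M u q w k)) (gap (arr_time M) k w)" for k
  define B where "B k = ennreal (exp (- disc_rate M * arr_time M k w) *
             ((1 - real (action M u q w k)) *
                auto_cost M (score M k w) (regime_left M (arr_time M k w) w)
              + real (action M u q w k) * esc_cost M))" for k
  have sc: "stage_cost i u q w k = A k + B k" for k
  proof -
    let ?ds = "departures M u q w k" and ?g = "gap (arr_time M) k w" and ?j = "regime_left M (arr_time M k w) w"
    let ?t = "arr_time M k w"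
    have g: "0 \<le> ?g"
      using w by (simp add: regular_def less_imp_le)
    have t: "epoch k + ?g = ?t"
      by (simp add: epoch_gap[symmetric] epoch_Suc)
    have a: "clipped u (length (residual ?g (residual (epoch k) ?ds))) ?j (score M k w) = action M u q w k"
      using score_in[of k] regime_left_in[of k]
      by (simp add: clipped_def action_def residual_residual[OF g] t in_system_left_residual)
    \<comment> \<open>With values 0 and 1 only, the weighted cost in \<open>J\<close> reduces to the
      case distinction in \<open>decision\<close>.\<close>
    have a01: "action M u q w k \<in> {0, 1}"
    proof -
      have "u n ?j \<in> measurable (restrict_space borel {0..1}) (count_space {0, 1})" for n
        using u regime_left_in[of k] by (auto simp: policies_def)
      from measurable_space[OF this, of "score M k w"] show ?thesis
        using score_in[of k] by (simp add: action_def space_restrict_space)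
    qed
    have c: "clipped_cost (score M k w) ?j = auto_cost M (score M k w) ?j"
      using score_in[of k] regime_left_in[of k] by (simp add: clipped_cost_def)
    have e: "exp (- disc_rate M * ?t) = exp (- disc_rate M * epoch k) * exp (- disc_rate M * ?g)"
      unfolding t[symmetric] by (simp add: exp_add[symmetric] algebra_simps)
    show ?thesis
      unfolding stage_cost_def regime_left_value[symmetric] stage_def decision_def a c
        conjunct1[OF path_departures[OF u]] conjunct2[OF path_departures[OF u]] A_def B_def e
      using a01 by (auto simp: distrib_left ennreal_mult' mult.assoc)
  qed
  have "(\<Sum>k. A k) + (\<Sum>k. B k) = (\<Sum>k. A k + B k)"
    by (rule suminf_add) auto
  then show ?thesis
    unfolding holding_cost_sum sc A_def B_def .
qed

end

lemma J_eq_lfp: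
  assumes u: "u \<in> policies M"
  shows "J M u q i = lfp (policy_op u) q i"
proof -
  have "J M u q i = (\<integral>\<^sup>+w. (\<Sum>k. stage_cost i u q w k) \<partial>law M i)"
    unfolding J_def
    by (rule nn_integral_cong_AE, use AE_regular in eventually_elim) (rule path_cost[OF _ u])
  then show ?thesis
    using total_cost_lfp[OF i u] by simp
qed

text \<open>A policy that never escalates keeps the queue at most q and pays at most C per arrival,
  and the discounted number of arrivals has finite mean.\<close>

lemma V_finite: "V M q i < \<infinity>"
proof -
  define u :: policy where "u = (\<lambda>_ _ _. 0)"
  have u: "u \<in> policies M"
    by (simp add: policies_def u_def)
  \<comment> \<open>By monotonicity the cost is largest at score 1; summing over the regimes bounds
    the maximum.\<close>
  define C where "C = (\<Sum>j\<in>regimes M. auto_cost M 1 j)"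
  define D where "D = ennreal (hold_cost M q / disc_rate M)"
  have ds: "departures M u q w n = initial_departures M w q" for w n
    by (induction n) (simp_all add: u_def Let_def)
  have queue: "queue M u q w t \<le> q" for w t
    unfolding queue_def ds in_system_def using length_filter_le[of _ "initial_departures M w q"] by simp
  \<comment> \<open>\<open>disc_rate M\<close> times the discount factor is a probability density on
    the half line, so the constant rate \<open>hold_cost M q\<close> costs exactly D.\<close>
  have hold: "(\<integral>\<^sup>+t\<in>{0..}. ennreal (exp (- disc_rate M * t) * hold_cost M (queue M u q w t)) \<partial>lborel) \<le> D" for w
  proof -
    interpret E: prob_space "exp_law (disc_rate M)" by (rule prob_space_exp_law[OF disc_rate_pos])
    have "(\<integral>\<^sup>+t\<in>{0..}. ennreal (exp (- disc_rate M * t) * hold_cost M (queue M u q w t)) \<partial>lborel) \<le>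
       (\<integral>\<^sup>+t. D * ennreal (exponential_density (disc_rate M) t) \<partial>lborel)"
    proof (intro nn_integral_mono)
      fix t :: real
      have "exp (- disc_rate M * t) * hold_cost M (queue M u q w t) \<le> exp (- disc_rate M * t) * hold_cost M q"
        using queue monoD[OF hold_cost_mono] by (intro mult_left_mono) auto
      moreover have "D * ennreal (exponential_density (disc_rate M) t) =
          ennreal (exp (- disc_rate M * t) * hold_cost M q) * indicator {0..} t"
        using disc_rate_pos hold_cost_nonneg[of q]
        by (auto simp: D_def exponential_density_def indicator_def mult.commute simp flip: ennreal_mult')
      ultimately show "ennreal (exp (- disc_rate M * t) * hold_cost M (queue M u q w t)) * indicator {0..} t
          \<le> D * ennreal (exponential_density (disc_rate M) t)"
        by (auto simp: indicator_def intro!: ennreal_leI)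
    qed
    also have "\<dots> = D * (\<integral>\<^sup>+t. ennreal (exponential_density (disc_rate M) t) \<partial>lborel)"
      by (rule nn_integral_cmult) simp
    also have "(\<integral>\<^sup>+t. ennreal (exponential_density (disc_rate M) t) \<partial>lborel) = emeasure (exp_law (disc_rate M)) UNIV"
      unfolding exp_law_def by (subst emeasure_density) auto
    also have "\<dots> = 1"
      using E.emeasure_space_1 by simp
    finally show ?thesis by simp
  qed
  have cost: "auto_cost M (score M n w) (regime_left M (arr_time M n w) w) \<le> C" if w: "regular w" for w n
  proof -
    let ?j = "regime_left M (arr_time M n w) w"
    have j: "?j \<in> regimes M" by (rule regime_left_in[OF w])
    have "auto_cost M (score M n w) ?j \<le> auto_cost M 1 ?j"
      using strict_mono_on_leD[OF auto_cost_strict_mono[OF j], of "score M n w" 1] score_in[OF w, of n] by auto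
    also have "\<dots> \<le> C"
      unfolding C_def using auto_cost_nonneg[of 1] j by (intro member_le_sum) auto
    finally show ?thesis .
  qed
  have "V M q i \<le> J M u q i"
    unfolding V_def by (rule INF_lower[OF u])
  also have "\<dots> \<le> (\<integral>\<^sup>+w. D + ennreal C * (\<Sum>n. ennreal (exp (- disc_rate M * arr_time M n w))) \<partial>law M i)"
    unfolding J_def
  proof (rule nn_integral_mono_AE, use AE_regular in eventually_elim)
    case (elim w)
    have "(\<Sum>n. ennreal (exp (- disc_rate M * arr_time M n w) *
             ((1 - real (action M u q w n)) * auto_cost M (score M n w) (regime_left M (arr_time M n w) w)
              + real (action M u q w n) * esc_cost M))) \<le>
       (\<Sum>n. ennreal C * ennreal (exp (- disc_rate M * arr_time M n w)))"
    proof (intro suminf_le)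
      fix n
      have "action M u q w n = 0"
        by (simp add: action_def u_def)
      then have "exp (- disc_rate M * arr_time M n w) *
             ((1 - real (action M u q w n)) * auto_cost M (score M n w) (regime_left M (arr_time M n w) w)
              + real (action M u q w n) * esc_cost M) \<le> C * exp (- disc_rate M * arr_time M n w)"
        using cost[OF elim, of n] by simp
      then show "ennreal (exp (- disc_rate M * arr_time M n w) *
             ((1 - real (action M u q w n)) * auto_cost M (score M n w) (regime_left M (arr_time M n w) w)
              + real (action M u q w n) * esc_cost M)) \<le> ennreal C * ennreal (exp (- disc_rate M * arr_time M n w))"
        by (simp add: ennreal_mult''[symmetric] ennreal_leI)
    qed auto
    with hold[of w] show ?case
      by (intro add_mono) auto
  qed
  also have "\<dots> = D + ennreal C * (\<integral>\<^sup>+w. (\<Sum>n. ennreal (exp (- disc_rate M * arr_time M n w))) \<partial>law M i)"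
    using emeasure_space_1 by (simp add: nn_integral_add nn_integral_cmult)
  also have "\<dots> < \<infinity>"
    using discount_sum_finite by (simp add: D_def ennreal_mult_less_top)
  finally show ?thesis .
qed

end

end

subsection \<open>The Bellman equation and the threshold\<close>

text \<open>A finite threshold is itself an admissible score at which the task is escalated, so any
  other threshold is at most it. Exchanging the two gives equality, infinity included.\<close>

lemma is_threshold_unique:
  assumes "is_threshold M q i T" "is_threshold M q i T'"
  shows "T = T'"
proof -
  have le: "T' \<le> T" if T: "is_threshold M q i T" and T': "is_threshold M q i T'" for T T'
  proof (cases "T = \<infinity>")
    case False
    then obtain s where s: "s \<in> {0..1}" "T = ereal s"
      using T by (auto simp: is_threshold_def)
    then have "a_star M q i s = 1"
      using T by (simp add: is_threshold_def)
    then have "T' \<le> ereal s"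
      using T' s(1) unfolding is_threshold_def by (metis zero_neq_one)
    with s show ?thesis by simp
  qed simp
  show ?thesis
    using le[OF assms] le[OF assms(2) assms(1)] by (rule antisym[rotated])
qed

context hybrid_control
begin

definition greedy :: "(nat \<Rightarrow> nat \<Rightarrow> ennreal) \<Rightarrow> policy" where
  "greedy f q i s =
     (if ennreal (esc_cost M) + f (Suc q) i \<le> ennreal (auto_cost M s i) + f q i then 1 else 0)"

text \<open>The minimum is taken inside all integrals, pointwise in queue length, regime and score.
  This is exactly what a policy observes, so one policy attains it everywhere.\<close>

definition bellman :: "(nat \<Rightarrow> nat \<Rightarrow> ennreal) \<Rightarrow> nat \<Rightarrow> nat \<Rightarrow> ennreal" where
  "bellman f q i = (\<integral>\<^sup>+R. stage_mean (\<lambda>R g x j. hold R g + ennreal (exp (- disc_rate M * g)) *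
     min (ennreal (esc_cost M) + f (Suc (length (residual g R))) j)
         (ennreal (clipped_cost x j) + f (length (residual g R)) j)) i R \<partial>fresh q)"

lemma stage_mean_mono:
  assumes "\<And>g x j. S R g x j \<le> S' R g x j"
  shows "stage_mean S i R \<le> stage_mean S' i R"
  unfolding stage_mean_def by (intro nn_integral_mono sum_mono mult_left_mono assms) auto

lemma mono_bellman: "mono bellman"
proof (intro monoI le_funI)
  fix f f' :: "nat \<Rightarrow> nat \<Rightarrow> ennreal" and q i
  assume f: "f \<le> f'"
  show "bellman f q i \<le> bellman f' q i"
    unfolding bellman_def using f
    by (intro nn_integral_mono stage_mean_mono add_mono mult_left_mono min.mono order_refl) (auto simp: le_fun_def)
qed

lemma bellman_le_policy_op: "bellman f \<le> policy_op u f"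
proof (intro le_funI)
  fix q i
  show "bellman f q i \<le> policy_op u f q i"
    unfolding bellman_def policy_op_def stage_def decision_def
    by (intro nn_integral_mono stage_mean_mono add_mono mult_left_mono) auto
qed

lemma greedy_policy: "greedy f \<in> policies M"
proof -
  have "greedy f q i \<in> measurable (restrict_space borel {0..1}) (count_space {0, 1})" if "i \<in> regimes M" for q i
  proof -
    have [measurable]: "(\<lambda>s. auto_cost M s i) \<in> borel_measurable (restrict_space borel {0..1})"
      by (rule borel_measurable_continuous_on_restrict[OF auto_cost_continuous[OF that]])
    have "Measurable.pred (restrict_space borel {0..1})
        (\<lambda>s. ennreal (esc_cost M) + f (Suc q) i \<le> ennreal (auto_cost M s i) + f q i)"
      by measurable
    then show ?thesis
      unfolding greedy_def[abs_def] pred_def by (rule measurable_If[rotated 2]) simp_all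
  qed
  then show ?thesis
    by (simp add: policies_def)
qed

lemma policy_op_greedy: "policy_op (greedy f) f = bellman f"
proof (intro ext)
  fix q i
  have "stage (greedy f) f R g x j = hold R g + ennreal (exp (- disc_rate M * g)) *
     min (ennreal (esc_cost M) + f (Suc (length (residual g R))) j)
         (ennreal (clipped_cost x j) + f (length (residual g R)) j)" if "j \<in> regimes M" for R g x j
    using that by (auto simp: stage_def decision_def clipped_def greedy_def clipped_cost_def min_def)
  then show "policy_op (greedy f) f q i = bellman f q i"
    unfolding policy_op_def bellman_def stage_mean_def by (intro nn_integral_cong sum.cong refl) simp
qed

lemma V_eq_lfp:
  assumes i: "i \<in> regimes M"
  shows "V M q i = lfp bellman q i" and "J M (greedy (lfp bellman)) q i = lfp bellman q i"
proof -
  have lower: "lfp bellman q i \<le> J M u q i" if u: "u \<in> policies M" for u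
  proof -
    have "lfp bellman \<le> lfp (policy_op u)"
      by (rule lfp_mono) (rule bellman_le_policy_op)
    then show ?thesis
      by (simp add: J_eq_lfp[OF i u] le_fun_def)
  qed
  have "lfp (policy_op (greedy (lfp bellman))) \<le> lfp bellman"
    by (intro lfp_lowerbound) (simp add: policy_op_greedy lfp_fixpoint[OF mono_bellman])
  then have upper: "J M (greedy (lfp bellman)) q i \<le> lfp bellman q i"
    by (simp add: J_eq_lfp[OF i greedy_policy] le_fun_def)
  with lower[OF greedy_policy] show J: "J M (greedy (lfp bellman)) q i = lfp bellman q i"
    by (rule antisym[rotated])
  show "V M q i = lfp bellman q i"
    unfolding V_def
    using lower J greedy_policy by (intro antisym INF_greatest INF_lower2[OF greedy_policy[of "lfp bellman"]]) auto
qed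

lemma a_star_greedy: "a_star M = greedy (V M)"
  by (simp add: a_star_def greedy_def fun_eq_iff)

text \<open>\<open>V M\<close> and \<open>lfp bellman\<close> are known to agree only on actual
  regimes; clipping removes the remaining values, so both greedy rules induce the same
  operator.\<close>

lemma J_a_star:
  assumes i: "i \<in> regimes M"
  shows "J M (a_star M) q i = V M q i"
proof -
  have "clipped (greedy (V M)) = clipped (greedy (lfp bellman))"
    by (auto simp: clipped_def greedy_def fun_eq_iff V_eq_lfp(1))
  then have "policy_op (a_star M) = policy_op (greedy (lfp bellman))"
    by (simp add: fun_eq_iff policy_op_def stage_mean_def stage_def decision_def a_star_greedy)
  moreover have "a_star M \<in> policies M"
    unfolding a_star_greedy by (rule greedy_policy)
  ultimately show ?thesis
    using V_eq_lfp[OF i] by (simp add: J_eq_lfp[OF i] greedy_policy)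
qed

text \<open>Finiteness of both values allows the comparison in \<open>ennreal\<close> to be carried
  out, and rearranged, in the reals.\<close>

lemma a_star_iff:
  assumes i: "i \<in> regimes M" and s: "s \<in> {0..1}"
  shows "a_star M q i s = (if esc_cost M + Delta_V M q i \<le> auto_cost M s i then 1 else 0)"
proof -
  obtain a b where ab: "V M q i = ennreal a" "0 \<le> a" "V M (q + 1) i = ennreal b" "0 \<le> b"
    using V_finite[OF i] by (metis ennreal_cases infinity_ennreal_def less_irrefl)
  have "ennreal (esc_cost M) + ennreal b \<le> ennreal (auto_cost M s i) + ennreal a \<longleftrightarrow>
      esc_cost M + b \<le> auto_cost M s i + a"
    using ab esc_cost_pos auto_cost_nonneg[OF s i] by (simp flip: ennreal_plus)
  then show ?thesis
    using ab unfolding a_star_def Delta_V_def by (auto simp: algebra_simps)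
qed

text \<open>Continuity of the automation cost makes A closed, so a nonempty A contains its infimum;
  monotonicity makes it upward closed in the unit interval. Hence A is the interval from
  \<open>Inf A\<close> to 1.\<close>

lemma T_star_threshold:
  assumes i: "i \<in> regimes M"
  shows "is_threshold M q i (T_star M q i)"
proof -
  define c where "c = esc_cost M + Delta_V M q i"
  define A where "A = {s \<in> {0..1}. c \<le> auto_cost M s i}"
  have T: "T_star M q i = (if A = {} then \<infinity> else ereal (Inf A))"
    by (simp add: T_star_def A_def c_def Let_def)
  have A: "a_star M q i s = (if s \<in> A then 1 else 0)" if "s \<in> {0..1}" for s
    using that a_star_iff[OF i that] by (simp add: A_def c_def)
  show ?thesis
  proof (cases "A = {}")
    case True
    then show ?thesis
      by (simp add: is_threshold_def T A)
  next
    case False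
    have bdd: "bdd_below A"
      by (auto simp: A_def intro: bdd_belowI[of _ 0])
    have "closed A"
    proof -
      have "closedin (top_of_set {0..1}) ({0..1} \<inter> (\<lambda>s. auto_cost M s i) -` {c..})"
        by (rule continuous_closedin_preimage[OF auto_cost_continuous[OF i]]) simp
      moreover have "{0..1} \<inter> (\<lambda>s. auto_cost M s i) -` {c..} = A"
        by (auto simp: A_def)
      ultimately show ?thesis
        by (metis closed_atLeastAtMost closedin_closed_trans)
    qed
    then have Inf: "Inf A \<in> A"
      using closed_contains_Inf[OF False bdd] by simp
    have "s \<in> A \<longleftrightarrow> Inf A \<le> s" if s: "s \<in> {0..1}" for s
    proof
      show "Inf A \<le> s" if "s \<in> A"
        by (rule cInf_lower[OF that bdd])
    next
      assume "Inf A \<le> s"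
      then have "auto_cost M (Inf A) i \<le> auto_cost M s i"
        using strict_mono_on_leD[OF auto_cost_strict_mono[OF i], of "Inf A" s] Inf s by (auto simp: A_def)
      with Inf s show "s \<in> A" by (auto simp: A_def)
    qed
    then show ?thesis
      using False Inf by (auto simp: is_threshold_def T A) (auto simp: A_def)
  qed
qed

end

theorem theorem1:
  fixes M :: "'w hybrid_model"
  assumes "hybrid_control M"
  shows "(\<forall>q. \<forall>i\<in>regimes M.
            (\<exists>!T. is_threshold M q i T) \<and> is_threshold M q i (T_star M q i))
       \<and> a_star M \<in> policies M
       \<and> (\<forall>q. \<forall>i\<in>regimes M. J M (a_star M) q i = V M q i)"
proof -
  interpret hybrid_control M by fact
  show ?thesis
    using T_star_threshold is_threshold_unique J_a_star greedy_policy[of "V M"]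
    unfolding a_star_greedy[symmetric] by blast
qed

end
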